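(* For every sufficiently large $n \in \mathbb{N}$, there exist signs $\varepsilon_k\in\{-1,1\}$, $-2n\le k\le 2n$, such that the Laurent polynomial $P(z) = \sum_{k=-2n}^{2n} \varepsilon_k z^k$ satisfies \[ 2^{-160}\sqrt{n} \le |P(z)| \le 2^{12}\sqrt{n} \] for all $z \in \mathbb{C}$ with $|z| = 1$. *)

theory Defs
  imports "HOL-Analysis.Analysis"
begin

end

theory Submission
  imports Defs "HOL-Real_Asymp.Real_Asymp"
begin

text \<open>Make the coefficients symmetric on a sparse set C of even frequencies and antisymmetric elsewhere:
  on the unit circle the real part of P is then 1 + 2c with c a cosine polynomial on C, and the
  imaginary part is 2s with s a sine polynomial. For c take two modulated Rudin-Shapiro blocks. Since
  the blocks form a Golay pair, c and its first three derivatives are never simultaneously small, so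
  c is small only on few cells of length pi/(2n). A sign is attached to each cluster of such cells in
  such a way (Spencer's theorem) that the convolution of this sign pattern with a Fejer-Korovkin kernel
  has odd sine coefficients in [-1,1] while being of size 33 sqrt n or more on the bad cells. Rounding
  these coefficients to signs (Spencer's theorem again, on a grid) changes s by at most 32.7 sqrt n.\<close>

section \<open>Discrepancy of fractional colourings\<close>

text \<open>The decisive comparison is 33 against 32.7. Rounding may move s by about 32.7 sqrt n
  whatever the target is, so the target must exceed that on the bad cells although its coefficients
  stay in [-1, 1]. Rarity of bad cells makes this possible: the blocks have frequencies bounded by a
  multiple of T <= n / 2^50, so c cannot oscillate within 2^37 cells and such a window holds few bad
  cells. Only about n / 2^37 signs are then free, their discrepancy against the odd sines is at most
  sqrt n / 100, and this slack pays for amplifying the coefficients by 100. The kernel mass then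
  amounts to 50 sqrt n, of which a share of 0.17 may carry the wrong sign: 50 (1 - 2 * 0.17) = 33.
  The price is the exponent 160: three divisions by a cell length of relative size T / n cost about
  2^-129, and sqrt (T / n) costs another 2^-26. Odd sines vanish at 0, so c itself must be large
  there. Even frequencies in c and odd ones in the target make both absolute values invariant under
  x -> -x and x -> x + pi, which leaves a quarter circle to treat.\<close>

lemma homogeneous_system_nontrivial_solution:
  fixes a :: "'i \<Rightarrow> 'a \<Rightarrow> real"
  assumes "finite F" "finite I" "card I < card F"
  shows "\<exists>u. (\<forall>x. x \<notin> F \<longrightarrow> u x = 0) \<and> (\<exists>x\<in>F. u x \<noteq> 0) \<and> (\<forall>i\<in>I. (\<Sum>x\<in>F. a i x * u x) = 0)"
  using assms(2,1,3)
proof (induction I arbitrary: F a rule: finite_induct)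
  case empty
  then obtain x where "x \<in> F" by fastforce
  then show ?case by (intro exI[of _ "\<lambda>y. if y = x then 1 else 0"]) auto
next
  case (insert i I)
  have cI: "card I < card F" "card (insert i I) = Suc (card I)"
    using insert by auto
  show ?case
  proof (cases "\<forall>x\<in>F. a i x = 0")
    case True
    then show ?thesis using insert.IH[OF insert.prems(1) cI(1), of a] by auto
  next
    case False
    then obtain p where p: "p \<in> F" "a i p \<noteq> 0" by auto
    define G where "G = F - {p}"
    have F: "F = insert p G" "finite G" "p \<notin> G" using p insert.prems by (auto simp: G_def)
    have "card I < card G" using insert.prems cI F by auto
    \<comment> \<open>Gaussian elimination: the pivot (i, p) clears column p from the other rows,
      leaving one row and one unknown fewer.\<close>
    from insert.IH[OF F(2) this, of "\<lambda>j x. a j x - a j p * a i x / a i p"]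
    obtain u where u: "\<forall>x. x \<notin> G \<longrightarrow> u x = 0" "\<exists>x\<in>G. u x \<noteq> 0"
      "\<forall>j\<in>I. (\<Sum>x\<in>G. (a j x - a j p * a i x / a i p) * u x) = 0" by blast
    define c where "c = - (\<Sum>x\<in>G. a i x * u x) / a i p"
    define v where "v = u(p := c)"
    have S: "(\<Sum>x\<in>F. a j x * v x) = a j p * c + (\<Sum>x\<in>G. a j x * u x)" for j
    proof -
      have "(\<Sum>x\<in>G. a j x * v x) = (\<Sum>x\<in>G. a j x * u x)"
        by (rule sum.cong) (use F in \<open>auto simp: v_def\<close>)
      then show ?thesis using F by (simp add: v_def)
    qed
    have "(\<Sum>x\<in>F. a j x * v x) = 0" if "j \<in> insert i I" for j
    proof (cases "j = i")
      case True
      then show ?thesis using S p by (simp add: c_def)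
    next
      case False
      then have "(\<Sum>x\<in>G. (a j x - a j p * a i x / a i p) * u x) = 0" using that u by auto
      moreover have "(\<Sum>x\<in>G. (a j x - a j p * a i x / a i p) * u x)
          = (\<Sum>x\<in>G. a j x * u x) - a j p / a i p * (\<Sum>x\<in>G. a i x * u x)"
        by (simp add: sum_subtractf sum_distrib_left algebra_simps)
      ultimately show ?thesis using S[of j] by (simp add: c_def)
    qed
    moreover have "\<exists>x\<in>F. v x \<noteq> 0" using u(2) F by (auto simp: v_def)
    moreover have "\<forall>x. x \<notin> F \<longrightarrow> v x = 0" using u(1) F by (auto simp: v_def)
    ultimately show ?thesis by blast
  qed
qed

text \<open>No Gram-Schmidt is involved: the vectors already found are added to the system as
  further equations, and a nontrivial solution, which the dimension count still provides, is
  normalised.\<close>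

lemma orthonormal_system_in_kernel:
  fixes a :: "'i \<Rightarrow> 'a \<Rightarrow> real"
  assumes "finite F" "finite I" "d + card I \<le> card F"
  shows "\<exists>u::nat \<Rightarrow> 'a \<Rightarrow> real. (\<forall>k<d. (\<forall>x. x \<notin> F \<longrightarrow> u k x = 0) \<and> (\<forall>i\<in>I. (\<Sum>x\<in>F. a i x * u k x) = 0)) \<and>
     (\<forall>k<d. \<forall>l<d. (\<Sum>x\<in>F. u k x * u l x) = (if k = l then 1 else 0))"
  using assms(3)
proof (induction d)
  case 0
  then show ?case by auto
next
  case (Suc d)
  have "d + card I \<le> card F" using Suc.prems by simp
  from Suc.IH[OF this] obtain u :: "nat \<Rightarrow> 'a \<Rightarrow> real" where
    "\<forall>k<d. (\<forall>x. x \<notin> F \<longrightarrow> u k x = 0) \<and> (\<forall>i\<in>I. (\<Sum>x\<in>F. a i x * u k x) = 0)"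
    "\<forall>k<d. \<forall>l<d. (\<Sum>x\<in>F. u k x * u l x) = (if k = l then 1 else 0)"
    by blast
  then have
    u: "\<And>k x. k < d \<Longrightarrow> x \<notin> F \<Longrightarrow> u k x = 0"
       "\<And>k i. k < d \<Longrightarrow> i \<in> I \<Longrightarrow> (\<Sum>x\<in>F. a i x * u k x) = 0"
       "\<And>k l. k < d \<Longrightarrow> l < d \<Longrightarrow> (\<Sum>x\<in>F. u k x * u l x) = (if k = l then 1 else 0)"
    by auto
  have "card (I <+> {..<d}) < card F" using Suc.prems assms by (simp add: card_Plus)
  from homogeneous_system_nontrivial_solution[OF assms(1) _ this, of "case_sum a u"]
  obtain w where w: "\<forall>x. x \<notin> F \<longrightarrow> w x = 0" "\<exists>x\<in>F. w x \<noteq> 0"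
    "\<forall>i\<in>I <+> {..<d}. (\<Sum>x\<in>F. case_sum a u i x * w x) = 0"
    using assms by auto
  have w1: "(\<Sum>x\<in>F. a i x * w x) = 0" if "i \<in> I" for i
    using w(3) that by (force dest: bspec[where x="Inl i"])
  have w2: "(\<Sum>x\<in>F. u k x * w x) = 0" if "k < d" for k
    using w(3) that by (force dest: bspec[where x="Inr k"])
  define s where "s = (\<Sum>x\<in>F. (w x)\<^sup>2)"
  have s: "s > 0" unfolding s_def using w(2) assms(1) by (auto intro!: sum_pos2)
  define v where "v = u(d := (\<lambda>x. w x / sqrt s))"
  have vd: "(\<Sum>x\<in>F. f x * v d x) = (\<Sum>x\<in>F. f x * w x) / sqrt s" for f
    by (simp add: v_def sum_divide_distrib)
  have vd': "(\<Sum>x\<in>F. v d x * f x) = (\<Sum>x\<in>F. f x * w x) / sqrt s" for f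
    using vd[of f] by (simp add: mult.commute)
  have dd: "(\<Sum>x\<in>F. v d x * v d x) = 1"
    using s by (simp add: v_def s_def[symmetric] power2_eq_square[symmetric] power_divide flip: sum_divide_distrib)
  have old: "v k = u k" if "k < d" for k using that by (simp add: v_def)
  have "\<forall>k<Suc d. (\<forall>x. x \<notin> F \<longrightarrow> v k x = 0) \<and> (\<forall>i\<in>I. (\<Sum>x\<in>F. a i x * v k x) = 0)"
    using u w(1) w1 vd old by (auto simp: less_Suc_eq v_def)
  moreover have "\<forall>k<Suc d. \<forall>l<Suc d. (\<Sum>x\<in>F. v k x * v l x) = (if k = l then 1 else 0)"
    using u(3) old dd vd vd' w2 by (auto simp: less_Suc_eq)
  ultimately show ?case by blast
qed

lemma bessel_finite:
  fixes u :: "nat \<Rightarrow> 'a \<Rightarrow> real"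
  assumes on: "\<And>k l. k < d \<Longrightarrow> l < d \<Longrightarrow> (\<Sum>x\<in>F. u k x * u l x) = (if k = l then 1 else 0)"
  shows "(\<Sum>k<d. (\<Sum>x\<in>F. v x * u k x)\<^sup>2) \<le> (\<Sum>x\<in>F. (v x)\<^sup>2)"
proof -
  define c where "c k = (\<Sum>x\<in>F. v x * u k x)" for k
  define p where "p x = (\<Sum>k<d. c k * u k x)" for x
  have vp: "(\<Sum>x\<in>F. v x * p x) = (\<Sum>k<d. (c k)\<^sup>2)"
  proof -
    have "(\<Sum>x\<in>F. v x * p x) = (\<Sum>x\<in>F. \<Sum>k<d. c k * (v x * u k x))"
      by (simp add: p_def sum_distrib_left algebra_simps)
    also have "\<dots> = (\<Sum>k<d. \<Sum>x\<in>F. c k * (v x * u k x))" by (rule sum.swap)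
    finally show ?thesis by (simp add: c_def power2_eq_square flip: sum_distrib_left)
  qed
  have up: "(\<Sum>x\<in>F. u k x * p x) = c k" if "k < d" for k
  proof -
    have "(\<Sum>x\<in>F. u k x * p x) = (\<Sum>x\<in>F. \<Sum>l<d. c l * (u k x * u l x))"
      by (simp add: p_def sum_distrib_left algebra_simps)
    also have "\<dots> = (\<Sum>l<d. \<Sum>x\<in>F. c l * (u k x * u l x))" by (rule sum.swap)
    also have "\<dots> = (\<Sum>l<d. c l * (if k = l then 1 else 0))"
      using on that by (intro sum.cong) (auto simp flip: sum_distrib_left)
    finally show ?thesis using that by (simp add: if_distrib cong: if_cong)
  qed
  have pp: "(\<Sum>x\<in>F. p x * p x) = (\<Sum>k<d. (c k)\<^sup>2)"
  proof -
    have "(\<Sum>x\<in>F. p x * p x) = (\<Sum>x\<in>F. \<Sum>k<d. c k * (u k x * p x))"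
      by (subst (2) p_def) (simp add: sum_distrib_left algebra_simps)
    also have "\<dots> = (\<Sum>k<d. \<Sum>x\<in>F. c k * (u k x * p x))" by (rule sum.swap)
    also have "\<dots> = (\<Sum>k<d. c k * c k)" using up by (simp flip: sum_distrib_left)
    finally show ?thesis by (simp add: power2_eq_square)
  qed
  have "0 \<le> (\<Sum>x\<in>F. (v x - p x)\<^sup>2)" by (simp add: sum_nonneg)
  also have "\<dots> = (\<Sum>x\<in>F. (v x)\<^sup>2) - 2 * (\<Sum>x\<in>F. v x * p x) + (\<Sum>x\<in>F. p x * p x)"
    by (simp add: power2_eq_square algebra_simps sum.distrib sum_subtractf sum_distrib_left)
  finally show ?thesis using vp pp by (simp add: c_def)
qed

section \<open>Partial colouring with a cosh potential\<close>

lemma cosh_le_quadratic: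
  fixes z :: real
  assumes "\<bar>z\<bar> \<le> 1 / 50"
  shows "cosh z \<le> 1 + 51 / 100 * z\<^sup>2"
proof -
  \<comment> \<open>Half-angle: cosh z = 1 + 2 sinh^2 (z / 2), so it suffices that sinh w <= 1.005
    w, which follows from elementary bounds of exp. The count closing
    \<open>partial_colouring\<close> tolerates any constant up to 21/40 in place of 51/100.\<close>
  define w where "w = \<bar>z\<bar> / 2"
  have w: "0 \<le> w" "w \<le> 1 / 100" using assms by (auto simp: w_def)
  have "exp w \<le> 1 + w + w\<^sup>2" using w by (intro exp_bound) auto
  moreover have "exp (- w) \<ge> 1 - w" using exp_ge_add_one_self[of "- w"] by simp
  ultimately have "sinh w \<le> w + w\<^sup>2 / 2" by (simp add: sinh_def)
  also have "\<dots> \<le> w * (201 / 200)"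
    using mult_left_mono[OF w(2) w(1)] by (simp add: power2_eq_square)
  finally have "sinh w \<le> w * (201 / 200)" .
  then have "(sinh w)\<^sup>2 \<le> (w * (201 / 200))\<^sup>2" using w by (intro power_mono) auto
  moreover have "cosh (2 * w) = 1 + 2 * (sinh w)\<^sup>2"
    by (simp add: cosh_double cosh_square_eq)
  moreover have "cosh (2 * w) = cosh z" by (simp add: w_def)
  moreover have "(w * (201 / 200))\<^sup>2 = (201 / 200)\<^sup>2 * z\<^sup>2 / 4" by (simp add: w_def power_mult_distrib power_divide)
  ultimately have "cosh z \<le> 1 + (201 / 200)\<^sup>2 / 2 * z\<^sup>2" by simp
  also have "\<dots> \<le> 1 + 51 / 100 * z\<^sup>2"
    by (intro add_left_mono mult_right_mono) (auto simp: power2_eq_square)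
  finally show ?thesis .
qed

text \<open>Tychonoff's theorem. Colourings are functions on the whole index type; outside the
  finite set being coloured the factor will be the singleton {0}.\<close>

lemma compact_box_function_space:
  fixes B :: "'a \<Rightarrow> real set"
  assumes "\<And>i. compact (B i)"
  shows "compact (Pi\<^sub>E UNIV B)"
proof -
  have "compactin (product_topology (\<lambda>i::'a. euclidean) UNIV) (Pi\<^sub>E UNIV B)"
    using assms by (simp add: compactin_PiE)
  then show ?thesis by (simp add: euclidean_product_topology)
qed

text \<open>At a minimiser x of the potential over the polytope, compare x with x + s u and x - s u for u running
  through an orthonormal basis of the directions that keep tight constraints tight: the cosh terms gain at
  most a multiple of the squared norms of the rows, by Bessel, whereas the Gaussian factor loses the full
  dimension of that space. Hence at most half of the coordinates are fractional.\<close>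

lemma partial_colouring:
  fixes v :: "'j \<Rightarrow> 'a \<Rightarrow> real" and x0 :: "'a \<Rightarrow> real" and q m :: real
  assumes fin: "finite X" "finite J"
    and v: "\<And>j i. j \<in> J \<Longrightarrow> i \<in> X \<Longrightarrow> \<bar>v j i\<bar> \<le> 1"
    and x0: "\<And>i. i \<in> X \<Longrightarrow> \<bar>x0 i\<bar> \<le> 1"
    and q: "card X \<le> q" "0 < q" "q \<le> m" and m: "card J \<le> m"
  shows "\<exists>x. (\<forall>i\<in>X. \<bar>x i\<bar> \<le> 1) \<and>
     (\<forall>j\<in>J. \<bar>\<Sum>i\<in>X. v j i * (x i - x0 i)\<bar> \<le> 2 * sqrt (7 / 10 * q * ln (16 * m / q))) \<and>
     card {i\<in>X. \<bar>x i\<bar> < 1} \<le> q / 2"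
proof (cases "J = {}")
  case True
  then show ?thesis using q by (intro exI[of _ "\<lambda>_. 1"]) auto
next
  case False
  define L where "L = ln (16 * m / q)"
  have "1 < 16 * m / q" using q by (simp add: field_simps)
  then have L: "L > 0" "exp L = 16 * m / q" by (auto simp: L_def)
  \<comment> \<open>\<open>c\<close> is the permitted deviation. The parameters satisfy lam * c = 2
    L and kap * q = L: a tight row contributes cosh (2 L) >= (16 m / q)^2 / 2 to the potential,
    whereas the Gaussian factor varies by at most exp L = 16 m / q. The ratio lam^2 = 10/7 kap is
    what turns 51/100 into 51/70 in the final count.\<close>
  define c where "c = 2 * sqrt (7 / 10 * q * L)"
  define lam where "lam = sqrt (L / (7 / 10 * q))"
  define kap where "kap = L / q"
  have lam: "lam > 0" "lam\<^sup>2 = 10 / 7 * kap" using L q by (auto simp: lam_def kap_def field_simps)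
  have kap: "kap > 0" using L q by (simp add: kap_def)
  have lamc: "lam * c = 2 * L"
  proof -
    have "lam * c = 2 * sqrt (L / (7 / 10 * q) * (7 / 10 * q * L))"
      unfolding lam_def c_def by (simp only: real_sqrt_mult mult_ac)
    also have "L / (7 / 10 * q) * (7 / 10 * q * L) = L\<^sup>2" using q by (simp add: power2_eq_square)
    finally show ?thesis using L by simp
  qed
  have c: "c > 0" using L q by (auto simp: c_def)
  define dev where "dev x j = (\<Sum>i\<in>X. v j i * (x i - x0 i))" for x :: "'a \<Rightarrow> real" and j
  define Psi where "Psi x = (\<Sum>j\<in>J. cosh (lam * dev x j))" for x
  define G where "G x = exp (- kap * (\<Sum>i\<in>X. (x i)\<^sup>2)) * Psi x" for x :: "'a \<Rightarrow> real"
  define B where "B i = (if i \<in> X then {-1..1::real} else {0})" for i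
  have B_iff: "y \<in> B i \<longleftrightarrow> (if i \<in> X then \<bar>y\<bar> \<le> 1 else y = 0)" for y i
    by (auto simp: B_def)
  define Q where "Q = Pi\<^sub>E UNIV B \<inter> {x. \<forall>j\<in>J. \<bar>dev x j\<bar> \<le> c}"
  have contdev: "continuous_on UNIV (\<lambda>x. dev x j)" for j
    unfolding dev_def by (intro continuous_intros continuous_on_product_coordinates)
  have contG: "continuous_on S G" for S
    unfolding G_def Psi_def
    by (rule continuous_on_subset[of UNIV])
       (intro continuous_intros continuous_on_product_coordinates contdev | simp)+
  have "closed {x. \<forall>j\<in>J. \<bar>dev x j\<bar> \<le> c}"
    by (simp only: Ball_def) (intro closed_Collect_all closed_Collect_imp closed_Collect_le
        continuous_intros contdev open_Collect_const)
  moreover have "compact (Pi\<^sub>E UNIV B)" by (rule compact_box_function_space) (auto simp: B_def)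
  ultimately have "compact Q" unfolding Q_def by blast
  \<comment> \<open>The starting point \<open>x0\<close>, cut off outside X: all its deviations
    vanish, so the minimum of \<open>G\<close> is at most \<open>card J\<close>.\<close>
  define x1 where "x1 i = (if i \<in> X then x0 i else 0)" for i
  have dev_x1: "dev x1 j = 0" for j unfolding dev_def x1_def by (intro sum.neutral) auto
  have x1: "x1 \<in> Q" unfolding Q_def using x0 c
    by (auto simp: dev_x1 x1_def B_iff PiE_iff)
  then obtain x where x: "x \<in> Q" and min: "\<And>y. y \<in> Q \<Longrightarrow> G x \<le> G y"
    using continuous_attains_inf[OF \<open>compact Q\<close> _ contG] by blast
  have xX: "\<And>i. i \<in> X \<Longrightarrow> \<bar>x i\<bar> \<le> 1" "\<And>i. i \<notin> X \<Longrightarrow> x i = 0"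
    using x by (auto simp: Q_def B_iff PiE_iff split: if_splits)
  have xJ: "\<And>j. j \<in> J \<Longrightarrow> \<bar>dev x j\<bar> \<le> c" using x by (simp add: Q_def)
  have Psi_pos: "Psi y > 0" for y
    unfolding Psi_def using fin False by (intro sum_pos) (auto simp: cosh_real_pos)
  have Psi_le: "Psi x \<le> m * (16 * m / q)"
  proof -
    have "G x \<le> G x1" using min x1 by blast
    also have "\<dots> = exp (- kap * (\<Sum>i\<in>X. (x1 i)\<^sup>2)) * card J" by (simp add: G_def Psi_def dev_x1)
    also have "\<dots> \<le> 1 * real (card J)"
      using kap by (intro mult_right_mono) (auto intro!: mult_nonneg_nonneg sum_nonneg)
    finally have Gm: "G x \<le> m" using m by simp
    have G0: "0 \<le> G x" using Psi_pos[of x] by (simp add: G_def)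
    have "Psi x = exp (kap * (\<Sum>i\<in>X. (x i)\<^sup>2)) * G x"
      by (simp add: G_def exp_minus)
    moreover have e: "exp (kap * (\<Sum>i\<in>X. (x i)\<^sup>2)) \<le> exp L"
    proof -
      have "(\<Sum>i\<in>X. (x i)\<^sup>2) \<le> (\<Sum>i\<in>X. 1)"
        using xX by (intro sum_mono) (auto simp: abs_square_le_1)
      also have "\<dots> \<le> q" using q by simp
      finally have "kap * (\<Sum>i\<in>X. (x i)\<^sup>2) \<le> kap * q" using kap by (intro mult_left_mono) auto
      then show ?thesis using q by (simp add: kap_def)
    qed
    moreover have "exp (kap * (\<Sum>i\<in>X. (x i)\<^sup>2)) * G x \<le> exp L * m"
      by (intro mult_mono e Gm G0) simp
    ultimately have "Psi x \<le> exp L * m" by simp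
    then show ?thesis using L by (simp add: mult.commute)
  qed
  define T where "T = {j\<in>J. \<bar>dev x j\<bar> = c}"
  have finT: "finite T" using fin by (simp add: T_def)
  \<comment> \<open>Each tight row accounts for (16 m / q)^2 / 2 of a potential that is at most m *
    16 m / q, hence at most 2 m / (16 m / q) = q / 8 rows are tight.\<close>
  have cardT: "card T \<le> q / 8"
  proof -
    have ch: "cosh (lam * dev x j) \<ge> (16 * m / q)\<^sup>2 / 2" if "j \<in> T" for j
    proof -
      have "\<bar>lam * dev x j\<bar> = 2 * L" using that lam lamc by (simp add: T_def abs_mult)
      then have "cosh (lam * dev x j) = cosh (2 * L)" by (metis cosh_real_abs)
      also have "\<dots> \<ge> exp (2 * L) / 2" by (simp add: cosh_def)
      also have "exp (2 * L) = (16 * m / q)\<^sup>2" using L by (simp add: exp_double)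
      finally show ?thesis .
    qed
    have "card T * ((16 * m / q)\<^sup>2 / 2) \<le> (\<Sum>j\<in>T. cosh (lam * dev x j))"
      using sum_mono[OF ch, of T "\<lambda>x. x"] by simp
    also have "\<dots> \<le> Psi x" unfolding Psi_def
      using fin by (intro sum_mono2) (auto simp: T_def cosh_real_nonneg)
    also note Psi_le
    finally have "card T * ((16 * m / q)\<^sup>2 / 2) \<le> m * (16 * m / q)" .
    then show ?thesis using q by (simp add: field_simps power2_eq_square)
  qed
  define F where "F = {i\<in>X. \<bar>x i\<bar> < 1}"
  have finF: "finite F" and FX: "F \<subseteq> X" using fin by (auto simp: F_def)
  have "card F \<le> q / 2"
  proof (rule ccontr)
    assume "\<not> ?thesis"
    then have cF: "card F > q / 2" by simp
    \<comment> \<open>Dimension of the directions on F that do not move any tight row. Since card T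
      <= q / 8 < card F / 4, it exceeds 3/4 of card F.\<close>
    define d where "d = card F - card T"
    have dT: "d + card T \<le> card F" "3 * card F < 4 * d" using cardT cF q by (auto simp: d_def)
    obtain u :: "nat \<Rightarrow> 'a \<Rightarrow> real" where
      "\<forall>k<d. (\<forall>x. x \<notin> F \<longrightarrow> u k x = 0) \<and> (\<forall>i\<in>T. (\<Sum>x\<in>F. v i x * u k x) = 0)"
      and on: "\<forall>k<d. \<forall>l<d. (\<Sum>x\<in>F. u k x * u l x) = (if k = l then 1 else 0)"
      using orthonormal_system_in_kernel[OF finF finT dT(1), of v] by blast
    then have u0: "\<And>k i. k < d \<Longrightarrow> i \<notin> F \<Longrightarrow> u k i = 0"
      and uT: "\<And>k j. k < d \<Longrightarrow> j \<in> T \<Longrightarrow> (\<Sum>i\<in>F. v j i * u k i) = 0" by auto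
    define w where "w k j = (\<Sum>i\<in>F. v j i * u k i)" for k j
    have dev_shift: "dev (\<lambda>i. x i + s * u k i) j = dev x j + s * w k j" if "k < d" for k s j
    proof -
      have "w k j = (\<Sum>i\<in>X. v j i * u k i)" unfolding w_def
        using fin FX u0[OF that] by (intro sum.mono_neutral_left) auto
      then show ?thesis by (simp add: dev_def algebra_simps sum.distrib sum_subtractf sum_distrib_left)
    qed
    have sq_shift: "(\<Sum>i\<in>X. (x i + s * u k i)\<^sup>2) = (\<Sum>i\<in>X. (x i)\<^sup>2) + 2 * s * (\<Sum>i\<in>X. x i * u k i) + s\<^sup>2"
      if "k < d" for k s
    proof -
      have "(\<Sum>i\<in>X. u k i * u k i) = (\<Sum>i\<in>F. u k i * u k i)"
        using fin FX u0[OF that] by (intro sum.mono_neutral_right) auto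
      then have "(\<Sum>i\<in>X. u k i * u k i) = 1" using on that by simp
      then have "s\<^sup>2 = (\<Sum>i\<in>X. s\<^sup>2 * (u k i * u k i))" by (simp flip: sum_distrib_left)
      then show ?thesis
        by (simp add: power2_eq_square algebra_simps sum.distrib sum_distrib_left)
    qed
    have ev: "eventually (\<lambda>s. \<bar>a + s * b\<bar> < r \<and> \<bar>a + (- s) * b\<bar> < r) (at_right 0)" if "\<bar>a\<bar> < r" for a b r :: real
    proof (rule eventually_conj)
      have "((\<lambda>s. \<bar>a + s * b\<bar>) \<longlongrightarrow> \<bar>a + 0 * b\<bar>) (at_right 0)" by (intro tendsto_intros)
      then show "eventually (\<lambda>s. \<bar>a + s * b\<bar> < r) (at_right 0)"
        by (rule order_tendstoD) (use that in simp)
      have "((\<lambda>s. \<bar>a + (- s) * b\<bar>) \<longlongrightarrow> \<bar>a + (- 0) * b\<bar>) (at_right 0)" by (intro tendsto_intros)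
      then show "eventually (\<lambda>s. \<bar>a + (- s) * b\<bar> < r) (at_right 0)"
        by (rule order_tendstoD) (use that in simp)
    qed
    \<comment> \<open>Only finitely many strict inequalities are involved, so one step size s serves
      every direction and both signs.\<close>
    have "eventually (\<lambda>s. \<forall>k\<in>{..<d}. \<forall>i\<in>F. \<bar>x i + s * u k i\<bar> < 1 \<and> \<bar>x i + (- s) * u k i\<bar> < 1) (at_right 0)"
      using finF by (intro eventually_ball_finite ballI ev) (auto simp: F_def)
    moreover have "eventually (\<lambda>s. \<forall>k\<in>{..<d}. \<forall>j\<in>J - T. \<bar>dev x j + s * w k j\<bar> < c \<and> \<bar>dev x j + (- s) * w k j\<bar> < c) (at_right 0)"
      using fin xJ by (intro eventually_ball_finite ballI ev) (auto simp: T_def less_le)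
    moreover have "eventually (\<lambda>s. \<forall>k\<in>{..<d}. \<forall>j\<in>J. \<bar>0 + s * (lam * w k j)\<bar> < 1 / 50 \<and> \<bar>0 + (- s) * (lam * w k j)\<bar> < 1 / 50) (at_right 0)"
      using fin by (intro eventually_ball_finite ballI ev) auto
    moreover have "eventually (\<lambda>s::real. s > 0) (at_right 0)" by (rule eventually_at_right_less)
    ultimately have "eventually (\<lambda>s. (\<forall>k\<in>{..<d}. \<forall>i\<in>F. \<bar>x i + s * u k i\<bar> < 1 \<and> \<bar>x i + (- s) * u k i\<bar> < 1) \<and>
       (\<forall>k\<in>{..<d}. \<forall>j\<in>J - T. \<bar>dev x j + s * w k j\<bar> < c \<and> \<bar>dev x j + (- s) * w k j\<bar> < c) \<and>
       (\<forall>k\<in>{..<d}. \<forall>j\<in>J. \<bar>0 + s * (lam * w k j)\<bar> < 1 / 50 \<and> \<bar>0 + (- s) * (lam * w k j)\<bar> < 1 / 50) \<and> s > 0) (at_right 0)"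
      by (simp only: eventually_conj_iff)
    from eventually_happens'[OF trivial_limit_at_right_real this]
    obtain s where s: "s > 0"
      and sF': "\<forall>k\<in>{..<d}. \<forall>i\<in>F. \<bar>x i + s * u k i\<bar> < 1 \<and> \<bar>x i + (- s) * u k i\<bar> < 1"
      and sJ': "\<forall>k\<in>{..<d}. \<forall>j\<in>J - T. \<bar>dev x j + s * w k j\<bar> < c \<and> \<bar>dev x j + (- s) * w k j\<bar> < c"
      and sz': "\<forall>k\<in>{..<d}. \<forall>j\<in>J. \<bar>0 + s * (lam * w k j)\<bar> < 1 / 50 \<and> \<bar>0 + (- s) * (lam * w k j)\<bar> < 1 / 50"
      by (elim exE conjE)
    have sF: "\<bar>x i + s * u k i\<bar> < 1 \<and> \<bar>x i + (- s) * u k i\<bar> < 1" if "k < d" "i \<in> F" for k i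
      using sF' that by blast
    have sJ: "\<bar>dev x j + s * w k j\<bar> < c \<and> \<bar>dev x j + (- s) * w k j\<bar> < c" if "k < d" "j \<in> J - T" for k j
      using sJ' that by blast
    have sz: "\<bar>s * (lam * w k j)\<bar> < 1 / 50" if "k < d" "j \<in> J" for k j
    proof -
      have "\<bar>0 + s * (lam * w k j)\<bar> < 1 / 50" using sz' that by blast
      then show ?thesis by simp
    qed
    have inQ: "(\<lambda>i. x i + r * u k i) \<in> Q" if k: "k < d" and r: "r = s \<or> r = - s" for k r
    proof -
      have "\<bar>x i + r * u k i\<bar> \<le> 1" if "i \<in> X" for i
      proof (cases "i \<in> F")
        case True
        then show ?thesis using sF[OF k True] r by auto
      next
        case False
        then show ?thesis using u0[OF k False] xX that by simp
      qed
      moreover have "x i + r * u k i = 0" if "i \<notin> X" for i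
        using xX(2)[OF that] u0[OF k, of i] that FX by auto
      moreover have "\<bar>dev x j + r * w k j\<bar> \<le> c" if "j \<in> J" for j
      proof (cases "j \<in> T")
        case True
        then show ?thesis using uT[OF k True] xJ that by (simp add: w_def)
      next
        case False
        then show ?thesis using sJ[OF k, of j] r that by auto
      qed
      ultimately show ?thesis unfolding Q_def
        by (auto simp: dev_shift[OF k] B_iff PiE_iff)
    qed
    define z where "z k j = s * (lam * w k j)" for k j
    have step: "kap * s\<^sup>2 * Psi x \<le> 51 / 100 * (\<Sum>j\<in>J. cosh (lam * dev x j) * (z k j)\<^sup>2)" if k: "k < d" for k
    proof -
      define S where "S = (\<Sum>i\<in>X. (x i)\<^sup>2)"
      define I where "I = (\<Sum>i\<in>X. x i * u k i)"
      define P1 where "P1 = Psi (\<lambda>i. x i + s * u k i)"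
      define P2 where "P2 = Psi (\<lambda>i. x i + (- s) * u k i)"
      define M where "M = (\<Sum>j\<in>J. cosh (lam * dev x j) * cosh (z k j))"
      have P12: "P1 > 0" "P2 > 0" by (auto simp: P1_def P2_def Psi_pos)
      \<comment> \<open>The sinh parts of cosh (a + z) and cosh (a - z) cancel in the mean. The term
        2 s I, linear in s, cancels when the two minimality inequalities are multiplied; the product
        P1 * P2 that appears is bounded by M^2 through the AM-GM inequality.\<close>
      have "(P1 + P2) / 2 = M"
        unfolding P1_def P2_def Psi_def dev_shift[OF k] M_def z_def
        by (simp add: sum.distrib[symmetric] sum_divide_distrib algebra_simps cosh_add cosh_diff)
      moreover have "P1 * P2 \<le> ((P1 + P2) / 2)\<^sup>2"
        using sum_squares_ge_zero[of "P1 - P2" 0] by (simp add: power2_eq_square field_simps)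
      ultimately have PM: "P1 * P2 \<le> M\<^sup>2" by simp
      have M: "M > 0" using \<open>(P1 + P2) / 2 = M\<close> P12 by simp
      have G0: "G x = exp (- kap * S) * Psi x" by (simp add: G_def S_def)
      have E: "exp (- kap * (S + r + s\<^sup>2)) = exp (- kap * (S + s\<^sup>2)) * exp (- kap * r)" for r
        by (simp add: exp_add[symmetric] algebra_simps)
      have "G x \<le> exp (- kap * (S + 2 * s * I + s\<^sup>2)) * P1"
        using min[OF inQ[OF k, of s]] by (simp add: G_def sq_shift[OF k] S_def I_def P1_def)
      moreover have "G x \<le> exp (- kap * (S + - (2 * s * I) + s\<^sup>2)) * P2"
        using min[OF inQ[OF k, of "- s"]] sq_shift[OF k, of "- s"] by (simp add: G_def S_def I_def P2_def)
      moreover have "0 \<le> G x" using Psi_pos[of x] by (simp add: G0)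
      ultimately have "G x * G x \<le> (exp (- kap * (S + s\<^sup>2)) * exp (- kap * (2 * s * I)) * P1) *
          (exp (- kap * (S + s\<^sup>2)) * exp (- kap * (- (2 * s * I))) * P2)"
        unfolding E by (intro mult_mono) (use P12 in auto)
      also have "\<dots> = (exp (- kap * (S + s\<^sup>2)))\<^sup>2 * (P1 * P2) * (exp (- kap * (2 * s * I)) * exp (- kap * (- (2 * s * I))))"
        by (simp only: power2_eq_square mult_ac)
      also have "exp (- kap * (2 * s * I)) * exp (- kap * (- (2 * s * I))) = 1"
        by (simp flip: exp_add)
      also have "(exp (- kap * (S + s\<^sup>2)))\<^sup>2 * (P1 * P2) * 1 \<le> (exp (- kap * (S + s\<^sup>2)))\<^sup>2 * M\<^sup>2"
        using PM by (simp add: mult_left_mono)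
      finally have "(G x)\<^sup>2 \<le> (exp (- kap * (S + s\<^sup>2)) * M)\<^sup>2"
        by (simp only: power_mult_distrib power2_eq_square mult_ac)
      then have "G x \<le> exp (- kap * (S + s\<^sup>2)) * M" by (rule power2_le_imp_le) (rule mult_nonneg_nonneg[OF exp_ge_zero less_imp_le[OF M]])
      also have "exp (- kap * (S + s\<^sup>2)) = exp (- kap * S) * exp (- (kap * s\<^sup>2))"
        by (simp add: exp_add[symmetric] algebra_simps)
      finally have "Psi x \<le> exp (- (kap * s\<^sup>2)) * M"
        unfolding G0 mult.assoc by (simp only: mult_le_cancel_left_pos exp_gt_zero)
      then have "exp (kap * s\<^sup>2) * Psi x \<le> M" by (simp add: exp_minus field_simps)
      moreover have "(1 + kap * s\<^sup>2) * Psi x \<le> exp (kap * s\<^sup>2) * Psi x"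
        using Psi_pos[of x] by (intro mult_right_mono) auto
      moreover have "M \<le> (\<Sum>j\<in>J. cosh (lam * dev x j) * (1 + 51 / 100 * (z k j)\<^sup>2))"
        unfolding M_def using sz[OF k]
        by (intro sum_mono mult_left_mono cosh_le_quadratic) (auto simp: z_def less_imp_le cosh_real_nonneg)
      moreover have "\<dots> = Psi x + 51 / 100 * (\<Sum>j\<in>J. cosh (lam * dev x j) * (z k j)\<^sup>2)"
        by (simp add: Psi_def algebra_simps sum.distrib sum_distrib_left)
      ultimately show ?thesis by (simp add: algebra_simps)
    qed
    have zsum: "(\<Sum>k<d. (z k j)\<^sup>2) \<le> s\<^sup>2 * lam\<^sup>2 * card F" if j: "j \<in> J" for j
    proof -
      have "(\<Sum>k<d. (w k j)\<^sup>2) \<le> (\<Sum>i\<in>F. (v j i)\<^sup>2)"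
        unfolding w_def using on by (intro bessel_finite) auto
      also have "\<dots> \<le> (\<Sum>i\<in>F. 1)"
        using v[OF j] FX by (intro sum_mono) (auto simp: abs_square_le_1)
      finally have "(\<Sum>k<d. (w k j)\<^sup>2) \<le> card F" by simp
      then have "s\<^sup>2 * lam\<^sup>2 * (\<Sum>k<d. (w k j)\<^sup>2) \<le> s\<^sup>2 * lam\<^sup>2 * card F"
        by (intro mult_left_mono) auto
      then show ?thesis by (simp add: z_def power_mult_distrib sum_distrib_left algebra_simps)
    qed
    have "d * (kap * s\<^sup>2 * Psi x) \<le> (\<Sum>k<d. 51 / 100 * (\<Sum>j\<in>J. cosh (lam * dev x j) * (z k j)\<^sup>2))"
      using sum_mono[of "{..<d}" "\<lambda>_. kap * s\<^sup>2 * Psi x", OF step] by simp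
    also have "\<dots> = 51 / 100 * (\<Sum>j\<in>J. \<Sum>k<d. cosh (lam * dev x j) * (z k j)\<^sup>2)"
      by (subst sum.swap) (simp add: sum_distrib_left)
    also have "\<dots> = 51 / 100 * (\<Sum>j\<in>J. cosh (lam * dev x j) * (\<Sum>k<d. (z k j)\<^sup>2))"
      by (simp add: sum_distrib_left)
    also have "\<dots> \<le> 51 / 100 * (\<Sum>j\<in>J. cosh (lam * dev x j) * (s\<^sup>2 * lam\<^sup>2 * card F))"
      using zsum by (intro mult_left_mono sum_mono) (auto simp: cosh_real_nonneg)
    also have "\<dots> = (kap * s\<^sup>2 * Psi x) * (51 / 70 * card F)"
      unfolding sum_distrib_right[symmetric] Psi_def[symmetric] lam by simp
    finally have "(kap * s\<^sup>2 * Psi x) * d \<le> (kap * s\<^sup>2 * Psi x) * (51 / 70 * card F)"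
      by (simp add: mult.commute)
    moreover have "kap * s\<^sup>2 * Psi x > 0" using kap s Psi_pos by simp
    \<comment> \<open>Here 51/100 * 10/7 = 51/70, which is below 3/4: the contradiction with the
      size of d.\<close>
    ultimately have "d \<le> 51 / 70 * card F" by (simp only: mult_le_cancel_left_pos)
    then show False using dT cF q by linarith
  qed
  then show ?thesis using xX xJ
    by (intro exI[of _ x]) (auto simp: F_def dev_def c_def L_def)
qed

text \<open>Partial colouring is iterated on the coordinates that are still fractional. Each round
  halves q and adds ln 2 to ln (16 m / q), which is at least 4 ln 2 and so grows by a factor of at
  most 5/4. The deviations thus decay geometrically with ratio sqrt (5/8), and the constant 8 closes
  the recursion because 2 sqrt (7/10) + 8 sqrt (5/8) <= 8.\<close>

lemma linear_discrepancy:
  fixes v :: "'j \<Rightarrow> 'a \<Rightarrow> real" and x0 :: "'a \<Rightarrow> real" and q m :: real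
  assumes "finite X" "finite J"
    and v: "\<And>j i. j \<in> J \<Longrightarrow> i \<in> X \<Longrightarrow> \<bar>v j i\<bar> \<le> 1"
    and "\<And>i. i \<in> X \<Longrightarrow> \<bar>x0 i\<bar> \<le> 1"
    and "card X \<le> q" "0 < q" "q \<le> m" and m: "card J \<le> m"
  shows "\<exists>x. (\<forall>i\<in>X. x i \<in> {-1, 1}) \<and>
     (\<forall>j\<in>J. \<bar>\<Sum>i\<in>X. v j i * (x i - x0 i)\<bar> \<le> 8 * sqrt (q * ln (16 * m / q)))"
proof -
  \<comment> \<open>N bounds the number of halvings; once q < 1 the set X is empty.\<close>
  obtain N :: nat where "q < 2 ^ N" using real_arch_pow[of 2 q] by auto
  then show ?thesis using assms
  proof (induction N arbitrary: X q x0)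
    case 0
    then have "q < 1" by simp
    with 0 have "real (card X) < 1" by linarith
    then have "X = {}" using 0(2) by simp
    then show ?case using 0 by (intro exI[of _ "\<lambda>_. 1"]) auto
  next
    case (Suc N)
    define L where "L = ln (16 * m / q)"
    have "ln (16::real) = 4 * ln 2" using ln_realpow[of 2 4] by simp
    moreover have "ln 16 \<le> L" unfolding L_def using Suc.prems by (subst ln_le_cancel_iff) (auto simp: field_simps)
    moreover have "ln (2::real) > 0" by simp
    ultimately have L: "ln 2 \<le> L / 4" "L > 0" by linarith+
    obtain x where x: "\<forall>i\<in>X. \<bar>x i\<bar> \<le> 1"
      "\<forall>j\<in>J. \<bar>\<Sum>i\<in>X. v j i * (x i - x0 i)\<bar> \<le> 2 * sqrt (7 / 10 * q * L)"
      "card {i\<in>X. \<bar>x i\<bar> < 1} \<le> q / 2"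
      using partial_colouring[of X J v x0 q m] Suc.prems unfolding L_def by blast
    define F where "F = {i\<in>X. \<bar>x i\<bar> < 1}"
    have FX: "F \<subseteq> X" "finite F" using Suc.prems by (auto simp: F_def)
    have "\<exists>y. (\<forall>i\<in>F. y i \<in> {-1, 1}) \<and>
       (\<forall>j\<in>J. \<bar>\<Sum>i\<in>F. v j i * (y i - x i)\<bar> \<le> 8 * sqrt (q / 2 * ln (16 * m / (q / 2))))"
      using Suc.prems x FX by (intro Suc.IH) (auto simp: F_def)
    then obtain y where y: "\<forall>i\<in>F. y i \<in> {-1, 1}"
      "\<forall>j\<in>J. \<bar>\<Sum>i\<in>F. v j i * (y i - x i)\<bar> \<le> 8 * sqrt (q / 2 * ln (16 * m / (q / 2)))" by blast
    define z where "z i = (if i \<in> F then y i else x i)" for i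
    have z1: "\<forall>i\<in>X. z i \<in> {-1, 1}"
      using y(1) x(1) by (auto simp: z_def F_def)
    have "8 * sqrt (q / 2 * ln (16 * m / (q / 2))) \<le> 8 * (7906 / 10000 * sqrt (q * L))"
    proof -
      have "16 * m / (q / 2) = 2 * (16 * m / q)" using Suc.prems by simp
      then have "ln (16 * m / (q / 2)) = ln 2 + L" unfolding L_def
        using Suc.prems by (simp only:) (rule ln_mult_pos, auto)
      also have "\<dots> \<le> 5 / 4 * L" using L by simp
      finally have "q / 2 * ln (16 * m / (q / 2)) \<le> q / 2 * (5 / 4 * L)"
        using Suc.prems by (intro mult_left_mono) auto
      also have "\<dots> \<le> (7906 / 10000)\<^sup>2 * (q * L)"
        using Suc.prems L by (simp add: power2_eq_square)
      finally have "sqrt (q / 2 * ln (16 * m / (q / 2))) \<le> sqrt ((7906 / 10000)\<^sup>2 * (q * L))"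
        by (rule real_sqrt_le_mono)
      also have "\<dots> = 7906 / 10000 * sqrt (q * L)" by (subst real_sqrt_mult) simp
      finally show ?thesis by simp
    qed
    moreover have "2 * sqrt (7 / 10 * q * L) \<le> 2 * (8367 / 10000 * sqrt (q * L))"
    proof -
      have "sqrt (7 / 10 * q * L) \<le> sqrt ((8367 / 10000)\<^sup>2 * (q * L))"
        using Suc.prems L by (intro real_sqrt_le_mono) (simp add: power2_eq_square)
      also have "\<dots> = 8367 / 10000 * sqrt (q * L)" by (subst real_sqrt_mult) simp
      finally show ?thesis by simp
    qed
    moreover have "sqrt (q * L) \<ge> 0" using Suc.prems L by simp
    ultimately have bound: "2 * sqrt (7 / 10 * q * L) + 8 * sqrt (q / 2 * ln (16 * m / (q / 2))) \<le> 8 * sqrt (q * L)"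
      by linarith
    have "\<bar>\<Sum>i\<in>X. v j i * (z i - x0 i)\<bar> \<le> 8 * sqrt (q * L)" if j: "j \<in> J" for j
    proof -
      have "(\<Sum>i\<in>F. v j i * (y i - x i)) = (\<Sum>i\<in>X. v j i * (z i - x i))"
        using FX Suc.prems by (intro sum.mono_neutral_cong_left) (auto simp: z_def)
      then have "(\<Sum>i\<in>X. v j i * (z i - x0 i)) =
          (\<Sum>i\<in>X. v j i * (x i - x0 i)) + (\<Sum>i\<in>F. v j i * (y i - x i))"
        by (simp add: sum.distrib[symmetric] algebra_simps)
      then show ?thesis using bspec[OF x(2) j] bspec[OF y(2) j] bound by linarith
    qed
    then show ?case using z1 unfolding L_def by blast
  qed
qed

section \<open>Signs for sparse sets of cells\<close>

text \<open>Unfolded, \<open>gap_free k A\<close> forbids chains of k + 1 elements of A with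
  consecutive differences at least 2. The recursive form fits induction from the minimum
  upwards.\<close>

fun gap_free :: "nat \<Rightarrow> nat set \<Rightarrow> bool" where
  "gap_free 0 A \<longleftrightarrow> A = {}"
| "gap_free (Suc k) A \<longleftrightarrow> (\<forall>a\<in>A. gap_free k {x\<in>A. a + 2 \<le> x})"

text \<open>Greedy: besides the minimum a, only a + 1 can fail to lie at a + 2 or beyond, so each
  level of the recursion costs at most two elements.\<close>

lemma card_gap_free: "finite A \<Longrightarrow> gap_free k A \<Longrightarrow> card A \<le> 2 * k"
proof (induction k arbitrary: A)
  case (Suc k)
  show ?case
  proof (cases "A = {}")
    case False
    define a where "a = Min A"
    have a: "a \<in> A" "\<And>x. x \<in> A \<Longrightarrow> a \<le> x" using Suc.prems False by (auto simp: a_def)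
    have "card {x\<in>A. a + 2 \<le> x} \<le> 2 * k" using Suc a by auto
    moreover have "A \<subseteq> {x\<in>A. a + 2 \<le> x} \<union> {a, a + 1}" using a(2) by (force simp: le_less_Suc_eq)
    then have "card A \<le> card ({x\<in>A. a + 2 \<le> x} \<union> {a, a + 1})"
      using Suc.prems by (intro card_mono) auto
    moreover have "\<dots> \<le> card {x\<in>A. a + 2 \<le> x} + card {a, a + 1}" by (rule card_Un_le)
    ultimately show ?thesis by simp
  qed simp
qed simp

lemma card_UN_le_const:
  assumes "finite I" "card I \<le> k" "\<And>i. i \<in> I \<Longrightarrow> card (F i) \<le> c"
  shows "card (\<Union>i\<in>I. F i) \<le> k * c"
proof -
  have "card (\<Union>i\<in>I. F i) \<le> (\<Sum>i\<in>I. card (F i))" by (rule card_UN_le[OF assms(1)])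
  also have "\<dots> \<le> (\<Sum>i\<in>I. c)" by (intro sum_mono assms(3))
  also have "\<dots> \<le> k * c" using assms(2) by simp
  finally show ?thesis .
qed

text \<open>Signs are constant on blocks whose boundaries avoid the neighbourhood of the bad cells;
  every block meets at most two windows and hence at most twelve bad cells.\<close>

lemma block_signs:
  fixes f :: "'k \<Rightarrow> nat \<Rightarrow> real" and q m :: real
  assumes bad: "bad \<subseteq> {..<n}" and w: "w \<ge> 100"
    and sparse: "\<And>a b c d. a \<in> bad \<Longrightarrow> b \<in> bad \<Longrightarrow> c \<in> bad \<Longrightarrow> d \<in> bad \<Longrightarrow>
       a + 2 \<le> b \<Longrightarrow> b + 2 \<le> c \<Longrightarrow> c + 2 \<le> d \<Longrightarrow> d < a + w \<Longrightarrow> False"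
    and f: "\<And>k j. k \<in> J \<Longrightarrow> j < n \<Longrightarrow> \<bar>f k j\<bar> \<le> 1"
    and J: "finite J" "card J \<le> m" and q: "real n / real w + 2 \<le> q" "q \<le> m"
  shows "\<exists>g. (\<forall>j. \<bar>g j\<bar> \<le> 1) \<and>
     (\<forall>i\<in>bad. \<exists>s. \<bar>s\<bar> = 1 \<and> (\<forall>j<n. i \<le> j + 2 \<longrightarrow> j \<le> i + 2 \<longrightarrow> g j = s)) \<and>
     (\<forall>k\<in>J. \<bar>\<Sum>j<n. g j * f k j\<bar> \<le> 480 * sqrt (q * ln (16 * m / q)))"
proof -
  have finbad: "finite bad" using bad by (rule finite_subset) simp
  have win: "card {b\<in>bad. a \<le> b \<and> b < a + w} \<le> 6" for a
  proof -
    have "False" if "p \<in> bad" "p' \<in> bad" "r \<in> bad" "x \<in> bad" "a \<le> p" "p + 2 \<le> p'" "p' + 2 \<le> r" "r + 2 \<le> x" "x < a + w" for p p' r x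
      using sparse[of p p' r x] that by linarith
    then have "gap_free 3 {b\<in>bad. a \<le> b \<and> b < a + w}"
      unfolding numeral_3_eq_3 gap_free.simps by blast
    from card_gap_free[OF _ this] finbad show ?thesis by simp
  qed
  define U where "U = {j. j < n \<and> (\<exists>i\<in>bad. i \<le> j + 2 \<and> j \<le> i + 2)}"
  define nb where "nb b = {b - 2..b + 2}" for b :: nat
  have nb: "card (nb b) \<le> 5" for b by (simp add: nb_def)
  have finU: "finite U" by (simp add: U_def)
  \<comment> \<open>Every window of w cells contains a cut point away from the bad cells: those that
    can reach into it lie in three consecutive windows, at most 18 in number, and each occupies 5
    positions. This gives 90 < 100 <= w.\<close>
  have "\<exists>c\<in>{i * w..<(i + 1) * w}. c \<notin> U" for i
  proof (rule ccontr)
    assume "\<not> ?thesis"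
    then have sub: "{i * w..<(i + 1) * w} \<subseteq> U" by auto
    \<comment> \<open>For i = 0 the truncated i - 1 only repeats the window itself.\<close>
    define S where "S = {b\<in>bad. (i - 1) * w \<le> b \<and> b < (i - 1) * w + w} \<union> {b\<in>bad. i * w \<le> b \<and> b < i * w + w}
      \<union> {b\<in>bad. (i + 1) * w \<le> b \<and> b < (i + 1) * w + w}"
    have "card S \<le> 6 + 6 + 6"
      unfolding S_def by (intro order_trans[OF card_Un_le] add_mono win)
    then have cS: "card S \<le> 18" by simp
    have finS: "finite S" using finbad by (simp add: S_def)
    have "{i * w..<(i + 1) * w} \<subseteq> (\<Union>b\<in>S. nb b)"
    proof
      fix j assume j: "j \<in> {i * w..<(i + 1) * w}"
      then obtain b where b: "b \<in> bad" "b \<le> j + 2" "j \<le> b + 2" using sub by (auto simp: U_def)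
      have "b \<in> S"
      proof (cases "b < i * w")
        case True
        then have i: "i > 0" by (cases i) auto
        then have "(i - 1) * w + w = i * w" by (cases i) auto
        then show ?thesis using b j True w by (auto simp: S_def)
      next
        case False
        then show ?thesis using b j w by (auto simp: S_def)
      qed
      moreover have "j \<in> nb b" using b by (auto simp: nb_def)
      ultimately show "j \<in> (\<Union>b\<in>S. nb b)" by blast
    qed
    then have "card {i * w..<(i + 1) * w} \<le> card (\<Union>b\<in>S. nb b)"
      using finS by (intro card_mono) (auto simp: nb_def)
    also have "\<dots> \<le> 18 * 5" by (rule card_UN_le_const[OF finS cS nb])
    finally show False using w by simp
  qed
  then obtain c where c: "\<And>i. c i \<in> {i * w..<(i + 1) * w}" "\<And>i. c i \<notin> U" by metis
  \<comment> \<open>Number of the block containing j when the line is cut at the points c 0, c 1,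
    ...; within window j div w the number goes up at the cut.\<close>
  define ka where "ka j = j div w + (if c (j div w) \<le> j then 1 else 0)" for j
  have dw: "(j div w) * w \<le> j" "j < (j div w + 1) * w" for j
    using w by (simp, metis Suc_eq_plus1 add.commute dividend_less_times_div less_le_trans mult.commute mult_Suc_right not_gr_zero w zero_less_numeral)
  \<comment> \<open>A change of block between j and j' means that a cut lies in between, and cuts
    avoid U. Since U contains all cells within 2 of a bad cell, the block number is constant around
    each bad cell.\<close>
  have jump: "\<exists>x. j < x \<and> x \<le> j' \<and> x \<notin> U" if jj: "j \<le> j'" "ka j \<noteq> ka j'" for j j'
  proof -
    define i where "i = j div w"
    define i' where "i' = j' div w"
    have ii: "i \<le> i'" using jj by (simp add: i_def i'_def div_le_mono)
    have j: "j < (i + 1) * w" and j': "i' * w \<le> j'" using dw by (auto simp: i_def i'_def)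
    have ci: "c k < (k + 1) * w" "k * w \<le> c k" for k using c(1)[of k] by auto
    have mono: "a * w \<le> b * w" if "a \<le> b" for a b using that by simp
    consider "i = i'" | "i < i'" "c i' \<le> j'" | "i + 1 < i'" "j' < c i'" | "i' = i + 1" "j' < c i'" using ii by linarith
    then show ?thesis
    proof cases
      case 1
      then have "j < c i" "c i \<le> j'" using jj by (auto simp: ka_def i_def i'_def split: if_splits)
      then show ?thesis using c(2) by blast
    next
      case 2
      then have "j < c i'" using j mono[of "i + 1" i'] ci(2)[of i'] by linarith
      then show ?thesis using c(2) 2 by blast
    next
      case 3
      then have "j < c (i' - 1)" using j mono[of "i + 1" "i' - 1"] ci(2)[of "i' - 1"] by linarith
      moreover have "c (i' - 1) \<le> j'" using ci(1)[of "i' - 1"] j' 3 by simp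
      ultimately show ?thesis using c(2) by blast
    next
      case 4
      then have "j < c i" using jj by (auto simp: ka_def i_def[symmetric] i'_def[symmetric] split: if_splits)
      moreover have "c i \<le> j'" using ci(1)[of i] j' 4 by simp
      ultimately show ?thesis using c(2) by blast
    qed
  qed
  have same: "ka j = ka b" if b: "b \<in> bad" and j: "j < n" "b \<le> j + 2" "j \<le> b + 2" for b j
  proof (rule ccontr)
    assume ne: "ka j \<noteq> ka b"
    have bn: "b < n" using b bad by auto
    obtain x where x: "min j b < x" "x \<le> max j b" "x \<notin> U"
      using jump[of j b] jump[of b j] ne by (cases "j \<le> b") (auto simp: min_def max_def)
    have "x < n" "b \<le> x + 2" "x \<le> b + 2" using x(1,2) j bn by linarith+
    then show False using x(3) b by (auto simp: U_def)
  qed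
  define fib where "fib i = {j\<in>U. ka j = i}" for i
  have fib: "card (fib i) \<le> 60" for i
  proof -
    define S where "S = {b\<in>bad. (i - 1) * w \<le> b \<and> b < (i - 1) * w + w} \<union> {b\<in>bad. i * w \<le> b \<and> b < i * w + w}"
    have "card S \<le> 6 + 6"
      unfolding S_def by (intro order_trans[OF card_Un_le] add_mono win)
    then have cS: "card S \<le> 12" by simp
    have finS: "finite S" using finbad by (simp add: S_def)
    have "fib i \<subseteq> (\<Union>b\<in>S. nb b)"
    proof
      fix j assume j: "j \<in> fib i"
      then obtain b where b: "b \<in> bad" "b \<le> j + 2" "j \<le> b + 2" "j < n" and kj: "ka j = i" by (auto simp: U_def fib_def)
      then have kb: "ka b = i" using same by simp
      then have "b div w = i \<or> b div w = i - 1" by (auto simp: ka_def split: if_splits)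
      moreover have "l * w \<le> b \<and> b < l * w + w" if "b div w = l" for l
        using dw[of b] unfolding that distrib_right by simp
      ultimately have "b \<in> S" using b(1) unfolding S_def by blast
      moreover have "j \<in> nb b" using b by (auto simp: nb_def)
      ultimately show "j \<in> (\<Union>b\<in>S. nb b)" by blast
    qed
    then have "card (fib i) \<le> card (\<Union>b\<in>S. nb b)" using finS by (intro card_mono) (auto simp: nb_def)
    also have "\<dots> \<le> 12 * 5" by (rule card_UN_le_const[OF finS cS nb])
    finally show ?thesis by simp
  qed
  have finfib: "finite (fib i)" for i using finU by (simp add: fib_def)
  \<comment> \<open>Block numbers reach n div w + 1, one beyond the last window; this is the source
    of the + 2 in the lower bound for q.\<close>
  define X where "X = {..n div w + 1}"
  \<comment> \<open>A block is coupled to a row only through its cells in U, of which there are at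
    most 12 * 5 = 60, however long the block is. This is why \<open>g\<close> will be 0 off U.
    Dividing by 60 normalises the rows, and 480 = 60 * 8.\<close>
  define v where "v k i = (\<Sum>j\<in>fib i. f k j) / 60" for k i
  have v: "\<bar>v k i\<bar> \<le> 1" if "k \<in> J" for k i
  proof -
    have "\<bar>\<Sum>j\<in>fib i. f k j\<bar> \<le> (\<Sum>j\<in>fib i. 1)"
      by (rule order_trans[OF sum_abs], rule sum_mono) (use f that in \<open>auto simp: fib_def U_def\<close>)
    also have "\<dots> \<le> 60" using fib[of i] by simp
    finally show ?thesis by (simp add: v_def)
  qed
  have "real (n div w) \<le> real n / real w" by (rule of_nat_div_le_of_nat)
  then have cX: "real (card X) \<le> q" using q by (simp add: X_def)
  then have q0: "q > 0" by (simp add: X_def)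
  obtain be where be: "\<forall>i\<in>X. be i \<in> {-1, 1}"
    and disc: "\<forall>k\<in>J. \<bar>\<Sum>i\<in>X. v k i * (be i - 0)\<bar> \<le> 8 * sqrt (q * ln (16 * m / q))"
    using linear_discrepancy[of X J v "\<lambda>_. 0" q m] v J q0 q(2) cX by (auto simp: X_def)
  define g where "g j = (if j \<in> U then be (ka j) else 0)" for j
  have kaX: "ka j \<in> X" if "j < n" for j
    using div_le_mono[of j n w] that by (auto simp: ka_def X_def)
  have be1: "\<bar>be i\<bar> = 1" if "i \<in> X" for i using bspec[OF be that] by auto
  have "\<bar>g j\<bar> \<le> 1" for j
    using be1[OF kaX[of j]] by (auto simp: g_def U_def)
  moreover have "\<exists>s. \<bar>s\<bar> = 1 \<and> (\<forall>j<n. i \<le> j + 2 \<longrightarrow> j \<le> i + 2 \<longrightarrow> g j = s)" if i: "i \<in> bad" for i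
  proof (intro exI conjI allI impI)
    show "\<bar>be (ka i)\<bar> = 1" using be1[OF kaX[of i]] i bad by auto
    fix j assume j: "j < n" "i \<le> j + 2" "j \<le> i + 2"
    then have "j \<in> U" using i by (auto simp: U_def)
    then show "g j = be (ka i)" using same[OF i j] by (simp add: g_def)
  qed
  moreover have "\<bar>\<Sum>j<n. g j * f k j\<bar> \<le> 480 * sqrt (q * ln (16 * m / q))" if k: "k \<in> J" for k
  proof -
    have "(\<Sum>j<n. g j * f k j) = (\<Sum>j\<in>U. be (ka j) * f k j)"
      by (rule sum.mono_neutral_cong_right) (auto simp: g_def U_def)
    also have "\<dots> = (\<Sum>i\<in>X. \<Sum>j\<in>fib i. be (ka j) * f k j)"
      unfolding fib_def using finU kaX by (intro sum.group[symmetric]) (auto simp: X_def U_def)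
    also have "\<dots> = (\<Sum>i\<in>X. 60 * (v k i * (be i - 0)))"
      by (rule sum.cong[OF refl]) (auto simp: v_def fib_def sum_distrib_left mult.commute)
    finally have "\<bar>\<Sum>j<n. g j * f k j\<bar> = 60 * \<bar>\<Sum>i\<in>X. v k i * (be i - 0)\<bar>"
      by (simp add: sum_distrib_left[symmetric] abs_mult)
    then show ?thesis using bspec[OF disc k] by linarith
  qed
  ultimately show ?thesis by blast
qed

section \<open>Rudin-Shapiro cosine polynomials\<close>

text \<open>The operator z d/dz applied r times to the polynomial with coefficients a.\<close>

definition moment_sum :: "(nat \<Rightarrow> real) \<Rightarrow> nat \<Rightarrow> nat \<Rightarrow> complex \<Rightarrow> complex"
  where "moment_sum a T r z = (\<Sum>j<T. of_real (a j) * of_nat j ^ r * z ^ j)"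

text \<open>Concatenation is the Rudin-Shapiro step A(z) + s z^T B(z), with (T + j)^r expanded by
  the binomial theorem.\<close>

lemma moment_sum_append:
  "moment_sum (\<lambda>j. if j < T then a j else s * b (j - T)) (2 * T) r z =
     moment_sum a T r z + of_real s * z ^ T * (\<Sum>l\<le>r. of_nat (r choose l) * of_nat T ^ (r - l) * moment_sum b T l z)"
proof -
  have "moment_sum (\<lambda>j. if j < T then a j else s * b (j - T)) (2 * T) r z =
      moment_sum a T r z + (\<Sum>j<T. of_real (s * b j) * of_nat (T + j) ^ r * z ^ (T + j))"
  proof -
    have "{..<2 * T} = {..<T} \<union> {T..<2 * T}" by auto
    moreover have "{T..<2 * T} = (\<lambda>j. T + j) ` {..<T}"
    proof (intro equalityI subsetI)
      fix j assume "j \<in> {T..<2 * T}"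
      then show "j \<in> (\<lambda>j. T + j) ` {..<T}" by (intro image_eqI[of _ _ "j - T"]) auto
    qed auto
    ultimately have U: "{..<2 * T} = {..<T} \<union> (\<lambda>j. T + j) ` {..<T}" by simp
    show ?thesis unfolding moment_sum_def U
      by (subst sum.union_disjoint) (auto simp: sum.reindex intro!: sum.cong)
  qed
  also have "(\<Sum>j<T. of_real (s * b j) * of_nat (T + j) ^ r * z ^ (T + j)) =
      of_real s * z ^ T * (\<Sum>j<T. \<Sum>l\<le>r. of_nat (r choose l) * of_nat T ^ (r - l) * (of_real (b j) * of_nat j ^ l * z ^ j))"
  proof -
    have "(of_nat (T + j) :: complex) ^ r = (\<Sum>l\<le>r. of_nat (r choose l) * of_nat j ^ l * of_nat T ^ (r - l))" for j
      by (simp add: add.commute[of T] binomial_ring)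
    then show ?thesis
      by (simp add: sum_distrib_left sum_distrib_right power_add algebra_simps)
  qed
  also have "(\<Sum>j<T. \<Sum>l\<le>r. of_nat (r choose l) * of_nat T ^ (r - l) * (of_real (b j) * of_nat j ^ l * z ^ j)) =
      (\<Sum>l\<le>r. of_nat (r choose l) * of_nat T ^ (r - l) * moment_sum b T l z)"
    unfolding moment_sum_def by (subst sum.swap) (simp add: sum_distrib_left)
  finally show ?thesis .
qed

text \<open>In units of T^r * A, the constant 2 must not grow faster than the factor 2^r * sqrt 2
  allows. Bounding every term by 2 would give 2 + 4 = 6 > 4 sqrt 2 for r = 1. The term l = 0 is only
  sqrt 2, by the Golay identity, and 4 + sqrt 2 < 4 sqrt 2.\<close>

lemma moment_bound_step:
  fixes A :: real
  assumes z: "cmod z = 1" and r: "r \<ge> 1" and s: "\<bar>s\<bar> = 1" and A: "A \<ge> 0" "A\<^sup>2 = T"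
    and a: "cmod (moment_sum a T r z) \<le> 2 * real T ^ r * A"
    and b0: "cmod (moment_sum b T 0 z) \<le> sqrt 2 * A"
    and b: "\<And>l. 1 \<le> l \<Longrightarrow> cmod (moment_sum b T l z) \<le> 2 * real T ^ l * A"
  shows "cmod (moment_sum (\<lambda>j. if j < T then a j else s * b (j - T)) (2 * T) r z) \<le> 2 * (2 * real T) ^ r * (sqrt 2 * A)"
proof -
  have "cmod (\<Sum>l\<le>r. of_nat (r choose l) * of_nat T ^ (r - l) * moment_sum b T l z)
      \<le> (\<Sum>l\<le>r. real (r choose l) * (2 * real T ^ r * A)) - (2 - sqrt 2) * real T ^ r * A"
  proof -
    have 1: "cmod (of_nat (r choose l) * of_nat T ^ (r - l) * moment_sum b T l z) \<le> real (r choose l) * (2 * real T ^ r * A)"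
      if l: "l \<in> {1..r}" for l
    proof -
      have "real T ^ (r - l) * real T ^ l = real T ^ r"
        using l by (simp flip: power_add)
      then have e: "real T ^ (r - l) * (2 * real T ^ l * A) = 2 * real T ^ r * A"
        by simp
      have "real T ^ (r - l) * cmod (moment_sum b T l z) \<le> real T ^ (r - l) * (2 * real T ^ l * A)"
        using b[of l] l by (intro mult_left_mono) auto
      then show ?thesis unfolding e by (simp only: norm_mult norm_power norm_of_nat mult.assoc) (rule mult_left_mono, auto)
    qed
    have split: "(\<Sum>l\<le>r. f l) = f 0 + (\<Sum>l\<in>{1..r}. f l)" for f :: "nat \<Rightarrow> real"
      by (simp add: sum.atLeast_Suc_atMost atMost_atLeast0)
    have "cmod (\<Sum>l\<le>r. of_nat (r choose l) * of_nat T ^ (r - l) * moment_sum b T l z)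
       \<le> (\<Sum>l\<le>r. cmod (of_nat (r choose l) * of_nat T ^ (r - l) * moment_sum b T l z))" by (rule norm_sum)
    also have "\<dots> \<le> real T ^ r * (sqrt 2 * A) + (\<Sum>l\<in>{1..r}. real (r choose l) * (2 * real T ^ r * A))"
      unfolding split using b0 by (intro add_mono sum_mono 1) (auto simp: norm_mult norm_power intro!: mult_left_mono)
    finally show ?thesis unfolding split by (simp add: algebra_simps)
  qed
  also have "(\<Sum>l\<le>r. real (r choose l) * (2 * real T ^ r * A)) = 2 ^ r * (2 * real T ^ r * A)"
    by (simp flip: sum_distrib_right of_nat_sum add: choose_row_sum)
  finally have "cmod (\<Sum>l\<le>r. of_nat (r choose l) * of_nat T ^ (r - l) * moment_sum b T l z)
     \<le> 2 ^ r * (2 * real T ^ r * A) - (2 - sqrt 2) * real T ^ r * A" .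
  then have "cmod (moment_sum (\<lambda>j. if j < T then a j else s * b (j - T)) (2 * T) r z)
      \<le> 2 * real T ^ r * A + (2 ^ r * (2 * real T ^ r * A) - (2 - sqrt 2) * real T ^ r * A)"
    unfolding moment_sum_append using a z s
    by (intro order_trans[OF norm_triangle_ineq] add_mono) (auto simp: norm_mult norm_power)
  also have "\<dots> = (real T ^ r * A) * (2 * 2 ^ r + sqrt 2)" by (simp add: algebra_simps)
  also have "\<dots> \<le> (real T ^ r * A) * (2 * 2 ^ r * sqrt 2)"
  proof (intro mult_left_mono)
    have s2: "sqrt 2 \<ge> 14 / 10" by (rule real_le_rsqrt) (simp add: power2_eq_square)
    have "(2::real) ^ 1 \<le> 2 ^ r" using r by (intro power_increasing) auto
    then have "2 * 2 ^ r * (sqrt 2 - 1) \<ge> 4 * (sqrt 2 - 1)" using s2 by (intro mult_right_mono) auto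
    moreover have "4 * (sqrt 2 - 1) \<ge> sqrt 2" using s2 by simp
    ultimately show "2 * 2 ^ r + sqrt 2 \<le> 2 * 2 ^ r * sqrt 2" by (simp add: algebra_simps)
  qed (use A in auto)
  finally show ?thesis by (simp add: power_mult_distrib algebra_simps)
qed

text \<open>The last clause says that the values at 1 are (x, x) or (x, 0) with x >= 0. The
  recursion sends these to (2 x, 0) and (x, x), so the pattern persists. It makes the cosine
  polynomial large at 0, where every sine polynomial vanishes.\<close>

definition golay_pair :: "nat \<Rightarrow> (nat \<Rightarrow> real) \<Rightarrow> (nat \<Rightarrow> real) \<Rightarrow> bool" where
  "golay_pair T a b \<longleftrightarrow>
    (\<forall>j. a j \<in> {-1, 1} \<and> b j \<in> {-1, 1}) \<and>
    (\<forall>z. cmod z = 1 \<longrightarrow> (cmod (moment_sum a T 0 z))\<^sup>2 + (cmod (moment_sum b T 0 z))\<^sup>2 = 2 * real T) \<and>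
    (\<forall>z r. cmod z = 1 \<longrightarrow> r \<ge> 1 \<longrightarrow>
       cmod (moment_sum a T r z) \<le> 2 * real T ^ r * sqrt T \<and> cmod (moment_sum b T r z) \<le> 2 * real T ^ r * sqrt T) \<and>
    (\<exists>x\<ge>0. moment_sum a T 0 1 = of_real x \<and> moment_sum b T 0 1 \<in> {0, of_real x})"

lemma rudin_shapiro: "\<exists>a b. golay_pair (2 ^ t) a b"
proof (induction t)
  case 0
  show ?case
    by (intro exI[of _ "\<lambda>_. 1"]) (auto simp: golay_pair_def moment_sum_def norm_power power_0_left)
next
  case (Suc t)
  define T :: nat where "T = 2 ^ t"
  have TS: "2 ^ Suc t = 2 * T" by (simp add: T_def)
  from Suc obtain a b where ab: "golay_pair T a b" unfolding T_def by blast
  have s: "\<And>j. a j \<in> {-1, 1} \<and> b j \<in> {-1, 1::real}"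
    and sq: "\<And>z. cmod z = 1 \<Longrightarrow> (cmod (moment_sum a T 0 z))\<^sup>2 + (cmod (moment_sum b T 0 z))\<^sup>2 = 2 * real T"
    and mom: "\<And>z r. cmod z = 1 \<Longrightarrow> r \<ge> 1 \<Longrightarrow> cmod (moment_sum a T r z) \<le> 2 * real T ^ r * sqrt T \<and> cmod (moment_sum b T r z) \<le> 2 * real T ^ r * sqrt T"
    using ab unfolding golay_pair_def by simp_all
  obtain x where x: "x \<ge> 0" "moment_sum a T 0 1 = of_real x" "moment_sum b T 0 1 \<in> {0, of_real x}"
    using ab unfolding golay_pair_def by (elim conjE exE) blast
  define a' where "a' j = (if j < T then a j else 1 * b (j - T))" for j
  define b' where "b' j = (if j < T then a j else (-1) * b (j - T))" for j
  have zero: "moment_sum a' (2 * T) 0 z = moment_sum a T 0 z + z ^ T * moment_sum b T 0 z"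
    "moment_sum b' (2 * T) 0 z = moment_sum a T 0 z - z ^ T * moment_sum b T 0 z" for z
    unfolding a'_def[abs_def] b'_def[abs_def] moment_sum_append by auto
  have par: "(cmod (u + v))\<^sup>2 + (cmod (u - v))\<^sup>2 = 2 * ((cmod u)\<^sup>2 + (cmod v)\<^sup>2)" for u v
    unfolding cmod_power2 by (simp add: power2_eq_square algebra_simps)
  have b0: "cmod (moment_sum b T 0 z) \<le> sqrt 2 * sqrt T" if "cmod z = 1" for z
  proof -
    have "(cmod (moment_sum b T 0 z))\<^sup>2 \<le> 2 * real T"
      using sq[OF that] zero_le_power2[of "cmod (moment_sum a T 0 z)"] by linarith
    then show ?thesis by (simp add: real_le_rsqrt flip: real_sqrt_mult)
  qed
  have "\<forall>j. a' j \<in> {-1, 1} \<and> b' j \<in> {-1, 1}" using s by (auto simp: a'_def b'_def)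
  moreover have "\<forall>z. cmod z = 1 \<longrightarrow> (cmod (moment_sum a' (2 * T) 0 z))\<^sup>2 + (cmod (moment_sum b' (2 * T) 0 z))\<^sup>2 = 2 * real (2 * T)"
    using sq by (simp add: zero par norm_mult norm_power)
  moreover have "\<forall>z r. cmod z = 1 \<longrightarrow> r \<ge> 1 \<longrightarrow> cmod (moment_sum a' (2 * T) r z) \<le> 2 * real (2 * T) ^ r * sqrt (2 * T)
     \<and> cmod (moment_sum b' (2 * T) r z) \<le> 2 * real (2 * T) ^ r * sqrt (2 * T)"
  proof (intro allI impI)
    fix z :: complex and r :: nat assume z: "cmod z = 1" and r: "r \<ge> 1"
    have "cmod (moment_sum (\<lambda>j. if j < T then a j else c * b (j - T)) (2 * T) r z) \<le> 2 * (2 * real T) ^ r * (sqrt 2 * sqrt T)"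
      if "\<bar>c\<bar> = 1" for c :: real
      using mom[OF z] b0[OF z] r that by (intro moment_bound_step[OF z]) auto
    from this[of 1] this[of "-1"]
    show "cmod (moment_sum a' (2 * T) r z) \<le> 2 * real (2 * T) ^ r * sqrt (2 * T)
       \<and> cmod (moment_sum b' (2 * T) r z) \<le> 2 * real (2 * T) ^ r * sqrt (2 * T)"
      unfolding a'_def[abs_def] b'_def[abs_def] by (simp add: real_sqrt_mult)
  qed
  moreover have "\<exists>x\<ge>0. moment_sum a' (2 * T) 0 1 = of_real x \<and> moment_sum b' (2 * T) 0 1 \<in> {0, of_real x}"
    using x by (intro exI[of _ "if moment_sum b T 0 1 = 0 then x else 2 * x"]) (auto simp: zero)
  ultimately have "golay_pair (2 * T) a' b'" unfolding golay_pair_def by (intro conjI)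
  then show ?case unfolding TS by blast
qed

section \<open>Divided differences\<close>

lemma rolle_zero:
  fixes f :: "real \<Rightarrow> real"
  assumes "\<And>x. (f has_real_derivative f' x) (at x)" "a < b" "f a = 0" "f b = 0"
  obtains z where "a < z" "z < b" "f' z = 0"
  using MVT2[of a b f f'] assms by auto

text \<open>A divided difference of order k equals f^(k) / k! at some intermediate point. Its
  numerator doubles at each order, while the denominators are at least l, 2 l and 3 l; multiplying
  by 1, 2 and 6 yields the constants 2, 4 and 8.\<close>

lemma small_derivatives_of_separated_small_values:
  fixes f0 f1 f2 f3 :: "real \<Rightarrow> real"
  assumes d0: "\<And>x. (f0 has_real_derivative f1 x) (at x)"
    and d1: "\<And>x. (f1 has_real_derivative f2 x) (at x)"
    and d2: "\<And>x. (f2 has_real_derivative f3 x) (at x)"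
    and l: "l > 0" "y0 + l \<le> y1" "y1 + l \<le> y2" "y2 + l \<le> y3"
    and e: "\<bar>f0 y0\<bar> \<le> e" "\<bar>f0 y1\<bar> \<le> e" "\<bar>f0 y2\<bar> \<le> e" "\<bar>f0 y3\<bar> \<le> e"
  shows "\<exists>x\<in>{y0..y3}. \<bar>f1 x\<bar> \<le> 2 * e / l" "\<exists>x\<in>{y0..y3}. \<bar>f2 x\<bar> \<le> 4 * e / l ^ 2"
    "\<exists>x\<in>{y0..y3}. \<bar>f3 x\<bar> \<le> 8 * e / l ^ 3"
proof -
  define f01 where "f01 = (f0 y1 - f0 y0) / (y1 - y0)"
  define f12 where "f12 = (f0 y2 - f0 y1) / (y2 - y1)"
  define f23 where "f23 = (f0 y3 - f0 y2) / (y3 - y2)"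
  define f012 where "f012 = (f12 - f01) / (y2 - y0)"
  define f123 where "f123 = (f23 - f12) / (y3 - y1)"
  define f0123 where "f0123 = (f123 - f012) / (y3 - y0)"
  have div: "\<bar>x / y\<bar> \<le> b / c" if "\<bar>x\<bar> \<le> b" "c \<le> y" "0 < c" for x y b c :: real
    using that unfolding abs_divide by (intro frac_le) auto
  have b1: "\<bar>f01\<bar> \<le> 2 * e / l" "\<bar>f12\<bar> \<le> 2 * e / l" "\<bar>f23\<bar> \<le> 2 * e / l"
    unfolding f01_def f12_def f23_def by (rule div; use l e in linarith)+
  have b2: "\<bar>f012\<bar> \<le> (4 * e / l) / (2 * l)" "\<bar>f123\<bar> \<le> (4 * e / l) / (2 * l)"
    unfolding f012_def f123_def by (rule div; use l b1 in linarith)+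
  have "(4 * e / l) / (2 * l) = 2 * e / l ^ 2" using l by (simp add: power2_eq_square)
  then have b2': "\<bar>f012\<bar> \<le> 2 * e / l ^ 2" "\<bar>f123\<bar> \<le> 2 * e / l ^ 2" using b2 by (simp_all only:)
  have "\<bar>f0123\<bar> \<le> (4 * e / l ^ 2) / (3 * l)"
    unfolding f0123_def by (rule div; use l b2' in linarith)
  moreover have "(4 * e / l ^ 2) / (3 * l) = (8 * e / l ^ 3) / 6"
    using l by (simp add: power2_eq_square power3_eq_cube)
  ultimately have "\<bar>f0123\<bar> \<le> (8 * e / l ^ 3) / 6" by (simp only:)
  moreover have "\<bar>6 * f\<bar> \<le> c" if "\<bar>f\<bar> \<le> c / 6" for f c :: real using that by linarith
  ultimately have b3: "\<bar>6 * f0123\<bar> \<le> 8 * e / l ^ 3" by blast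
  have v1: "f0 y1 = f0 y0 + f01 * (y1 - y0)" using l by (simp add: f01_def)
  have v2: "f0 y2 = f0 y1 + f12 * (y2 - y1)" using l by (simp add: f12_def)
  have v3: "f0 y3 = f0 y2 + f23 * (y3 - y2)" using l by (simp add: f23_def)
  have v12: "f12 = f01 + f012 * (y2 - y0)" using l by (simp add: f012_def)
  have v23: "f23 = f12 + f123 * (y3 - y1)" using l by (simp add: f123_def)
  have v123: "f123 = f012 + f0123 * (y3 - y0)" using l by (simp add: f0123_def)
  show "\<exists>x\<in>{y0..y3}. \<bar>f1 x\<bar> \<le> 2 * e / l"
  proof -
    obtain z where "y0 < z" "z < y1" "f0 y1 - f0 y0 = (y1 - y0) * f1 z"
      using MVT2[of y0 y1 f0 f1] d0 l by auto
    then have "f1 z = f01" "z \<in> {y0..y3}" using l by (auto simp: f01_def)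
    then show ?thesis using b1 by auto
  qed
  show "\<exists>x\<in>{y0..y3}. \<bar>f2 x\<bar> \<le> 4 * e / l ^ 2"
  proof -
    \<comment> \<open>\<open>f0\<close> minus its quadratic Newton interpolant at y0, y1, y2;
      Rolle's theorem is applied twice. The third derivative is treated alike with the cubic
      interpolant.\<close>
    define g where "g t = f0 t - f0 y0 - f01 * (t - y0) - f012 * ((t - y0) * (t - y1))" for t
    define g1 where "g1 t = f1 t - f01 - f012 * ((t - y0) + (t - y1))" for t
    define g2 where "g2 t = f2 t - 2 * f012" for t
    have dg: "(g has_real_derivative g1 t) (at t)" for t
      unfolding g_def[abs_def] g1_def by (auto intro!: derivative_eq_intros d0 simp: algebra_simps)
    have dg1: "(g1 has_real_derivative g2 t) (at t)" for t
      unfolding g1_def[abs_def] g2_def by (auto intro!: derivative_eq_intros d1 simp: algebra_simps)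
    have "g y0 = 0" by (simp add: g_def)
    moreover have "g y1 = 0" by (simp add: g_def v1)
    moreover have "g y2 = 0" unfolding g_def v2 v12 v1 by (simp add: algebra_simps)
    ultimately obtain z1 z2 where z: "y0 < z1" "z1 < y1" "g1 z1 = 0" "y1 < z2" "z2 < y2" "g1 z2 = 0"
      using rolle_zero[of g g1 y0 y1] rolle_zero[of g g1 y1 y2] dg l by (metis add.commute less_add_same_cancel2 order_less_le_trans)
    then obtain x where "z1 < x" "x < z2" "g2 x = 0"
      using rolle_zero[of g1 g2 z1 z2] dg1 by (metis order_less_trans)
    then have "f2 x = 2 * f012" "x \<in> {y0..y3}" using z l by (auto simp: g2_def)
    then show ?thesis using b2'(1) by (intro bexI[of _ x]) auto
  qed
  show "\<exists>x\<in>{y0..y3}. \<bar>f3 x\<bar> \<le> 8 * e / l ^ 3"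
  proof -
    define g where "g t = f0 t - f0 y0 - f01 * (t - y0) - f012 * ((t - y0) * (t - y1))
       - f0123 * ((t - y0) * (t - y1) * (t - y2))" for t
    define g1 where "g1 t = f1 t - f01 - f012 * ((t - y0) + (t - y1))
       - f0123 * ((t - y1) * (t - y2) + (t - y0) * (t - y2) + (t - y0) * (t - y1))" for t
    define g2 where "g2 t = f2 t - 2 * f012 - f0123 * (2 * ((t - y0) + (t - y1) + (t - y2)))" for t
    define g3 where "g3 t = f3 t - 6 * f0123" for t
    have dg: "(g has_real_derivative g1 t) (at t)" for t
      unfolding g_def[abs_def] g1_def by (auto intro!: derivative_eq_intros d0 simp: algebra_simps)
    have dg1: "(g1 has_real_derivative g2 t) (at t)" for t
      unfolding g1_def[abs_def] g2_def by (auto intro!: derivative_eq_intros d1 simp: algebra_simps)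
    have dg2: "(g2 has_real_derivative g3 t) (at t)" for t
      unfolding g2_def[abs_def] g3_def by (auto intro!: derivative_eq_intros d2 simp: algebra_simps)
    have y: "y0 < y1" "y1 < y2" "y2 < y3" using l by auto
    have g0: "g y0 = 0" by (simp add: g_def)
    have gy1: "g y1 = 0" by (simp add: g_def v1)
    have gy2: "g y2 = 0" unfolding g_def v2 v12 v1 by (simp add: algebra_simps)
    have gy3: "g y3 = 0" unfolding g_def v3 v23 v123 v2 v12 v1 by (simp add: algebra_simps)
    obtain z1 where z1: "y0 < z1" "z1 < y1" "g1 z1 = 0" using rolle_zero[OF dg y(1) g0 gy1] .
    obtain z2 where z2: "y1 < z2" "z2 < y2" "g1 z2 = 0" using rolle_zero[OF dg y(2) gy1 gy2] .
    obtain z3 where z3: "y2 < z3" "z3 < y3" "g1 z3 = 0" using rolle_zero[OF dg y(3) gy2 gy3] .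
    have z: "z1 < z2" "z2 < z3" using z1 z2 z3 by auto
    obtain w1 where w1: "z1 < w1" "w1 < z2" "g2 w1 = 0" using rolle_zero[OF dg1 z(1) z1(3) z2(3)] .
    obtain w2 where w2: "z2 < w2" "w2 < z3" "g2 w2 = 0" using rolle_zero[OF dg1 z(2) z2(3) z3(3)] .
    have w: "w1 < w2" using w1 w2 by auto
    obtain x where x: "w1 < x" "x < w2" "g3 x = 0" using rolle_zero[OF dg2 w w1(3) w2(3)] .
    then have "f3 x = 6 * f0123" "x \<in> {y0..y3}" using w1 w2 z1 z3 by (auto simp: g3_def)
    then show ?thesis using b3 by (intro bexI[of _ x]) auto
  qed
qed

section \<open>Derivatives of the modulated blocks\<close>

definition block_sum :: "(nat \<Rightarrow> real) \<Rightarrow> nat \<Rightarrow> nat \<Rightarrow> nat \<Rightarrow> real \<Rightarrow> complex"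
  where "block_sum a T A r x = (\<Sum>j<T. of_real (a j * real (A * T + j) ^ r) * cis (real (A * T + j) * x))"

lemma Re_block_sum: "Re (block_sum a T A r x) = (\<Sum>j<T. a j * real (A * T + j) ^ r * cos (real (A * T + j) * x))"
  and Im_block_sum: "Im (block_sum a T A r x) = (\<Sum>j<T. a j * real (A * T + j) ^ r * sin (real (A * T + j) * x))"
  unfolding block_sum_def Re_sum Im_sum by simp_all

lemma has_derivative_Re_block_sum:
  "((\<lambda>x. Re (block_sum a T A r x)) has_real_derivative - Im (block_sum a T A (Suc r) x)) (at x)"
  unfolding Re_block_sum Im_block_sum sum_negf[symmetric]
  by (rule DERIV_sum) (auto intro!: derivative_eq_intros simp: algebra_simps)

lemma has_derivative_Im_block_sum:
  "((\<lambda>x. Im (block_sum a T A r x)) has_real_derivative Re (block_sum a T A (Suc r) x)) (at x)"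
  unfolding Re_block_sum Im_block_sum
  by (rule DERIV_sum) (auto intro!: derivative_eq_intros simp: algebra_simps)

lemma block_sum_moments:
  "block_sum a T A r x = cis (real (A * T) * x) *
     (\<Sum>l\<le>r. of_nat (r choose l) * of_nat (A * T) ^ (r - l) * moment_sum a T l (cis x))"
proof -
  have e: "of_real (a j * real (A * T + j) ^ r) * cis (real (A * T + j) * x) =
     cis (real (A * T) * x) * (\<Sum>l\<le>r. of_nat (r choose l) * of_nat (A * T) ^ (r - l) * (of_real (a j) * of_nat j ^ l * cis x ^ j))" for j
  proof -
    have "(of_real (real (A * T + j) ^ r) :: complex) = (of_nat j + of_nat (A * T)) ^ r" by (simp add: add.commute)
    also have "\<dots> = (\<Sum>l\<le>r. of_nat (r choose l) * of_nat j ^ l * of_nat (A * T) ^ (r - l))"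
      by (rule binomial_ring)
    finally have "of_real (a j * real (A * T + j) ^ r) = of_real (a j) * (\<Sum>l\<le>r. of_nat (r choose l) * of_nat j ^ l * (of_nat (A * T) :: complex) ^ (r - l))"
      by simp
    moreover have "cis (real (A * T + j) * x) = cis (real (A * T) * x) * cis x ^ j"
      unfolding Complex.DeMoivre cis_mult by (rule arg_cong[of _ _ cis]) (simp add: algebra_simps)
    ultimately show ?thesis by (simp only: sum_distrib_left mult_ac)
  qed
  show ?thesis unfolding block_sum_def e moment_sum_def sum_distrib_left[of _ _ "{..<T}"]
    by (subst sum.swap) (simp add: sum_distrib_left)
qed

lemma norm_block_sum_0: "cmod (block_sum a T A 0 x) = cmod (moment_sum a T 0 (cis x))"
  unfolding block_sum_moments by (simp add: norm_mult)

text \<open>Up to the factor i^r, \<open>block_sum a T A r\<close> is the r-th derivative of the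
  block moved to frequencies A T, ..., A T + T - 1. For large A the block is almost monochromatic,
  so differentiation is almost multiplication by A T; the error consists of the binomial terms with
  l >= 1.\<close>

lemma block_sum_approx:
  assumes b: "\<And>l. 1 \<le> l \<Longrightarrow> cmod (moment_sum a T l (cis x)) \<le> 2 * real T ^ l * sqrt T"
  shows "cmod (block_sum a T A r x - of_real (real (A * T) ^ r) * block_sum a T A 0 x)
     \<le> 2 * sqrt T * real T ^ r * (real (A + 1) ^ r - real A ^ r)"
proof -
  define t where "t l = of_nat (r choose l) * of_nat (A * T) ^ (r - l) * moment_sum a T l (cis x)" for l
  have "block_sum a T A r x - of_real (real (A * T) ^ r) * block_sum a T A 0 x = cis (real (A * T) * x) * (\<Sum>l\<in>{1..r}. t l)"
    unfolding block_sum_moments t_def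
    by (simp add: sum.atLeast_Suc_atMost atMost_atLeast0 algebra_simps)
  then have "cmod (block_sum a T A r x - of_real (real (A * T) ^ r) * block_sum a T A 0 x) = cmod (\<Sum>l\<in>{1..r}. t l)"
    by (simp add: norm_mult)
  also have "\<dots> \<le> (\<Sum>l\<in>{1..r}. real (r choose l) * real A ^ (r - l) * (2 * sqrt T * real T ^ r))"
  proof (rule order_trans[OF norm_sum], rule sum_mono)
    fix l assume l: "l \<in> {1..r}"
    have "cmod (t l) = real (r choose l) * real A ^ (r - l) * (real T ^ (r - l) * cmod (moment_sum a T l (cis x)))"
      by (simp add: t_def norm_mult norm_power power_mult_distrib)
    also have "\<dots> \<le> real (r choose l) * real A ^ (r - l) * (real T ^ (r - l) * (2 * real T ^ l * sqrt T))"
      using b[of l] l by (intro mult_left_mono) auto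
    also have "real T ^ (r - l) * (2 * real T ^ l * sqrt T) = 2 * sqrt T * (real T ^ (r - l) * real T ^ l)" by simp
    also have "real T ^ (r - l) * real T ^ l = real T ^ r" using l by (simp flip: power_add)
    finally show "cmod (t l) \<le> real (r choose l) * real A ^ (r - l) * (2 * sqrt T * real T ^ r)" .
  qed
  also have "\<dots> = (2 * sqrt T * real T ^ r) * (\<Sum>l\<in>{1..r}. real (r choose l) * real A ^ (r - l))"
    by (simp add: sum_distrib_left mult_ac)
  also have "(\<Sum>l\<in>{1..r}. real (r choose l) * real A ^ (r - l)) = real (A + 1) ^ r - real A ^ r"
  proof -
    have "real (A + 1) ^ r = (\<Sum>l\<le>r. real (r choose l) * real A ^ (r - l))"
      using binomial_ring[of 1 "real A" r] by (simp add: add.commute)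
    then show ?thesis by (simp add: sum.atLeast_Suc_atMost atMost_atLeast0)
  qed
  finally show ?thesis .
qed

text \<open>The two shifts differ by a factor 2, which keeps the Vandermonde system of the
  derivatives well conditioned. Their size compared with the block length T makes the relative error
  in the r-th derivative of order r / 128.\<close>

definition rs_cosine :: "nat \<Rightarrow> (nat \<Rightarrow> real) \<Rightarrow> (nat \<Rightarrow> real) \<Rightarrow> real \<Rightarrow> real" where
  "rs_cosine T a b x = Re (block_sum a T 128 0 x + block_sum b T 256 0 x)"

lemma golay_pair_norm_le:
  assumes "golay_pair T a b" "cmod z = 1"
  shows "cmod (moment_sum a T 0 z) \<le> 2 * sqrt T" "cmod (moment_sum b T 0 z) \<le> 2 * sqrt T"
proof -
  have sq: "(cmod (moment_sum a T 0 z))\<^sup>2 + (cmod (moment_sum b T 0 z))\<^sup>2 = 2 * real T"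
    using assms unfolding golay_pair_def by blast
  have "(2 * sqrt T)\<^sup>2 = 4 * real T" by (simp add: power_mult_distrib)
  then have "(cmod (moment_sum a T 0 z))\<^sup>2 \<le> (2 * sqrt T)\<^sup>2" "(cmod (moment_sum b T 0 z))\<^sup>2 \<le> (2 * sqrt T)\<^sup>2"
    using sq zero_le_power2[of "cmod (moment_sum a T 0 z)"] zero_le_power2[of "cmod (moment_sum b T 0 z)"]
    by linarith+
  then show "cmod (moment_sum a T 0 z) \<le> 2 * sqrt T" "cmod (moment_sum b T 0 z) \<le> 2 * sqrt T"
    by (auto intro: power2_le_imp_le)
qed

lemma golay_block_sums:
  assumes g: "golay_pair T a b"
  shows "cmod (block_sum a T A r x - of_real (real (A * T) ^ r) * block_sum a T A 0 x)
     \<le> 2 * sqrt T * real T ^ r * (real (A + 1) ^ r - real A ^ r)" (is ?A1)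
   and "cmod (block_sum b T A r x - of_real (real (A * T) ^ r) * block_sum b T A 0 x)
     \<le> 2 * sqrt T * real T ^ r * (real (A + 1) ^ r - real A ^ r)" (is ?B1)
   and "cmod (block_sum a T A r x) \<le> 2 * sqrt T * real T ^ r * real (A + 1) ^ r"
   and "cmod (block_sum b T A r x) \<le> 2 * sqrt T * real T ^ r * real (A + 1) ^ r"
proof -
  have mom: "\<And>l. 1 \<le> l \<Longrightarrow> cmod (moment_sum a T l (cis x)) \<le> 2 * real T ^ l * sqrt T"
    "\<And>l. 1 \<le> l \<Longrightarrow> cmod (moment_sum b T l (cis x)) \<le> 2 * real T ^ l * sqrt T"
    using g norm_cis[of x] unfolding golay_pair_def by blast+
  show 1: ?A1 and 2: ?B1 using block_sum_approx mom by blast+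
  have bound: "cmod u \<le> 2 * sqrt T * real T ^ r * real (A + 1) ^ r"
    if "cmod (u - of_real (real (A * T) ^ r) * w) \<le> 2 * sqrt T * real T ^ r * (real (A + 1) ^ r - real A ^ r)"
      and w: "cmod w \<le> 2 * sqrt T" for u w
  proof -
    have "cmod (of_real (real (A * T) ^ r) * w) = real (A * T) ^ r * cmod w"
      by (simp add: norm_mult norm_power)
    also have "\<dots> \<le> real (A * T) ^ r * (2 * sqrt T)" using w by (intro mult_left_mono) auto
    also have "\<dots> = 2 * sqrt T * real T ^ r * real A ^ r" by (simp add: power_mult_distrib)
    finally have "cmod u \<le> 2 * sqrt T * real T ^ r * real A ^ r + 2 * sqrt T * real T ^ r * (real (A + 1) ^ r - real A ^ r)"
      using norm_triangle_ineq[of "u - of_real (real (A * T) ^ r) * w" "of_real (real (A * T) ^ r) * w"] that(1)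
      by simp
    then show ?thesis by (simp add: algebra_simps)
  qed
  show "cmod (block_sum a T A r x) \<le> 2 * sqrt T * real T ^ r * real (A + 1) ^ r"
    by (rule bound[OF 1]) (simp add: norm_block_sum_0 golay_pair_norm_le[OF g])
  show "cmod (block_sum b T A r x) \<le> 2 * sqrt T * real T ^ r * real (A + 1) ^ r"
    by (rule bound[OF 2]) (simp add: norm_block_sum_0 golay_pair_norm_le[OF g])
qed

lemma mvt_drift:
  fixes f :: "real \<Rightarrow> real"
  assumes d: "\<And>x. (f has_real_derivative f' x) (at x)" and "\<And>x. \<bar>f' x\<bar> \<le> M"
    and "x \<in> {u..v}" "y \<in> {u..v}" "\<bar>f y\<bar> \<le> e"
  shows "\<bar>f x\<bar> \<le> e + M * (v - u)"
proof -
  have "norm (f x - f y) \<le> M * norm (x - y)"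
    by (rule field_differentiable_bound[of UNIV f f'])
       (use assms in \<open>auto intro: has_field_derivative_at_within\<close>)
  moreover have "M * norm (x - y) \<le> M * (v - u)"
    using assms(2)[of 0] assms(3,4) by (intro mult_left_mono) auto
  ultimately show ?thesis using assms(5) by (simp add: dist_norm)
qed

text \<open>The normalised real and imaginary parts of the two blocks are recovered from the cosine
  polynomial and its first three derivatives by solving a Vandermonde system; all four cannot be
  small because the blocks form a Golay pair.\<close>

lemma golay_vandermonde:
  fixes p P r R F0 F1 F2 F3 :: real
  assumes "F0 = p + r"
    and "\<bar>F1 + P / 2 + R\<bar> \<le> 4 / 256"
    and "\<bar>F2 + p / 4 + r\<bar> \<le> 1540 / 65536"
    and "\<bar>F3 - P / 8 - R\<bar> \<le> 493828 / 16777216"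
    and "\<bar>F0\<bar> \<le> 3021 / 10000" "\<bar>F1\<bar> \<le> 253 / 1000" "\<bar>F2\<bar> \<le> 2282 / 10000" "\<bar>F3\<bar> \<le> 1 / 100"
  shows "p\<^sup>2 + P\<^sup>2 + r\<^sup>2 + R\<^sup>2 < 2"
proof -
  \<comment> \<open>The system splits: F0 and F2 determine the real parts p and r, F1 and F3 the
    imaginary parts P and R.\<close>
  have "\<bar>p\<bar> \<le> 74 / 100" "\<bar>r\<bar> \<le> 44 / 100" "\<bar>P\<bar> \<le> 83 / 100" "\<bar>R\<bar> \<le> 15 / 100"
    subgoal using assms(1,3,5,7) by linarith
    subgoal using assms(1,3,5,7) by linarith
    subgoal using assms(2,4,6,8) by linarith
    subgoal using assms(2,4,6,8) by linarith
    done
  moreover have sq: "x\<^sup>2 \<le> c\<^sup>2" if "\<bar>x\<bar> \<le> c" for x c :: real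
    using power_mono[OF that, of 2] by simp
  ultimately have "p\<^sup>2 \<le> (74 / 100)\<^sup>2" "r\<^sup>2 \<le> (44 / 100)\<^sup>2" "P\<^sup>2 \<le> (83 / 100)\<^sup>2" "R\<^sup>2 \<le> (15 / 100)\<^sup>2"
    by (simp_all only: sq)
  then have "p\<^sup>2 + P\<^sup>2 + r\<^sup>2 + R\<^sup>2 \<le> (74 / 100)\<^sup>2 + (83 / 100)\<^sup>2 + (44 / 100)\<^sup>2 + (15 / 100)\<^sup>2"
    by (intro add_mono)
  also have "\<dots> < 2" by (simp add: power2_eq_square)
  finally show ?thesis .
qed

text \<open>Four separated small values make each of the first three derivatives small somewhere.
  The interval is so short that the bounds carry over to one common point, where the Vandermonde
  system then contradicts the Golay identity |u|^2 + |v|^2 = 2 T.\<close>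

lemma rs_cosine_not_small:
  assumes g: "golay_pair T a b" and T: "T \<ge> 1"
    and l: "l > 0" "y0 + l \<le> y1" "y1 + l \<le> y2" "y2 + l \<le> y3"
    and W: "(y3 - y0) * (256 * T) \<le> 1 / 10"
    and e: "8 * e \<le> (256 * T * l) ^ 3 * sqrt T / 100"
    and small: "\<bar>rs_cosine T a b y0\<bar> \<le> e" "\<bar>rs_cosine T a b y1\<bar> \<le> e"
      "\<bar>rs_cosine T a b y2\<bar> \<le> e" "\<bar>rs_cosine T a b y3\<bar> \<le> e"
  shows False
proof -
  define s where "s = sqrt T"
  define B where "B = 256 * real T"
  have s: "s > 0" "s\<^sup>2 = T" and B: "B > 0" using T by (auto simp: s_def B_def)
  define u where "u r x = block_sum a T 128 r x" for r x
  define v where "v r x = block_sum b T 256 r x" for r x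
  define f0 where "f0 x = Re (u 0 x) + Re (v 0 x)" for x
  define f1 where "f1 x = - Im (u 1 x) - Im (v 1 x)" for x
  define f2 where "f2 x = - Re (u 2 x) - Re (v 2 x)" for x
  define f3 where "f3 x = Im (u 3 x) + Im (v 3 x)" for x
  have d0: "(f0 has_real_derivative f1 x) (at x)" for x
    unfolding f0_def[abs_def] f1_def u_def v_def
    using DERIV_add[OF has_derivative_Re_block_sum[of a T 128 0 x] has_derivative_Re_block_sum[of b T 256 0 x]] by simp
  have d1: "(f1 has_real_derivative f2 x) (at x)" for x
    unfolding f1_def[abs_def] f2_def u_def v_def
    using DERIV_diff[OF DERIV_minus[OF has_derivative_Im_block_sum[of a T 128 1 x]] has_derivative_Im_block_sum[of b T 256 1 x]]
    by (simp add: numeral_2_eq_2)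
  have d2: "(f2 has_real_derivative f3 x) (at x)" for x
    unfolding f2_def[abs_def] f3_def u_def v_def
    using DERIV_diff[OF DERIV_minus[OF has_derivative_Re_block_sum[of a T 128 2 x]] has_derivative_Re_block_sum[of b T 256 2 x]]
    by (simp add: numeral_3_eq_3 numeral_2_eq_2)
  have rs: "rs_cosine T a b x = f0 x" for x by (simp add: rs_cosine_def f0_def u_def v_def)
  have nu: "cmod (u r x) \<le> 2 * s * T ^ r * 129 ^ r" and nv: "cmod (v r x) \<le> 2 * s * T ^ r * 257 ^ r" for r x
    using golay_block_sums(3)[OF g, of 128 r x] golay_block_sums(4)[OF g, of 256 r x] by (simp_all add: u_def v_def s_def)
  have M1: "\<bar>f1 x\<bar> \<le> s * B * (302 / 100)" for x
  proof -
    have "\<bar>f1 x\<bar> \<le> cmod (u 1 x) + cmod (v 1 x)"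
      unfolding f1_def using abs_Im_le_cmod[of "u 1 x"] abs_Im_le_cmod[of "v 1 x"] by linarith
    also have "\<dots> \<le> (s * T) * (2 * (129 + 257))" using nu[of 1 x] nv[of 1 x] by simp
    also have "\<dots> \<le> (s * T) * (256 * (302 / 100))" using s by (intro mult_left_mono) auto
    finally show ?thesis by (simp add: B_def)
  qed
  have M2: "\<bar>f2 x\<bar> \<le> s * B ^ 2 * (2524 / 1000)" for x
  proof -
    have "\<bar>f2 x\<bar> \<le> cmod (u 2 x) + cmod (v 2 x)"
      unfolding f2_def using abs_Re_le_cmod[of "u 2 x"] abs_Re_le_cmod[of "v 2 x"] by linarith
    also have "\<dots> \<le> (s * T ^ 2) * (2 * (129 ^ 2 + 257 ^ 2))" using nu[of 2 x] nv[of 2 x] by simp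
    also have "\<dots> \<le> (s * T ^ 2) * (256 ^ 2 * (2524 / 1000))" using s by (intro mult_left_mono) auto
    finally show ?thesis by (simp add: B_def power_mult_distrib)
  qed
  have M3: "\<bar>f3 x\<bar> \<le> s * B ^ 3 * (228 / 100)" for x
  proof -
    have "\<bar>f3 x\<bar> \<le> cmod (u 3 x) + cmod (v 3 x)"
      unfolding f3_def using abs_Im_le_cmod[of "u 3 x"] abs_Im_le_cmod[of "v 3 x"] by linarith
    also have "\<dots> \<le> (s * T ^ 3) * (2 * (129 ^ 3 + 257 ^ 3))" using nu[of 3 x] nv[of 3 x] by simp
    also have "\<dots> \<le> (s * T ^ 3) * (256 ^ 3 * (228 / 100))" using s by (intro mult_left_mono) auto
    finally show ?thesis by (simp add: B_def power_mult_distrib)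
  qed
  \<comment> \<open>The spacing in units of 1 / B. As 3 l <= y3 - y0, it is at most 1/30, which
    converts the cubic smallness of e into the weaker bounds for the lower derivatives.\<close>
  define X where "X = B * l"
  have X: "0 < X" "X \<le> 1 / 30"
  proof -
    have "3 * l * B \<le> (y3 - y0) * B" using l B by (intro mult_right_mono) auto
    moreover have "(y3 - y0) * B \<le> 1 / 10" using W by (simp add: B_def)
    moreover have "3 * l * B = 3 * X" by (simp add: X_def)
    ultimately show "X \<le> 1 / 30" by linarith
  qed (use B l in \<open>simp add: X_def\<close>)
  have X2: "X ^ 2 \<le> 1 / 900" using power_mono[of X "1 / 30" 2] X by (simp add: power2_eq_square)
  have X3: "X ^ 3 \<le> 1 / 27000" using power_mono[of X "1 / 30" 3] X by (simp add: power3_eq_cube)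
  have e8: "8 * e \<le> X ^ 3 * s / 100" using e by (simp add: X_def B_def s_def mult_ac)
  have e0: "e \<le> s / 10000"
  proof -
    have "X ^ 3 * s \<le> 1 / 27000 * s" using X3 s by (intro mult_right_mono) auto
    then show ?thesis using e8 s by linarith
  qed
  have e1: "2 * e / l \<le> s * B / 10000"
  proof -
    have "X ^ 2 * (X * s) \<le> 1 / 900 * (X * s)" using X2 X s by (intro mult_right_mono) auto
    then have "X ^ 3 * s \<le> X * s / 900" by (simp add: power2_eq_square power3_eq_cube mult_ac)
    then have "2 * e \<le> X * s / 10000" using e8 mult_pos_pos[OF X(1) s(1)] by linarith
    then show ?thesis using l by (simp add: X_def field_simps)
  qed
  have e2: "4 * e / l ^ 2 \<le> s * B ^ 2 / 5000"
  proof -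
    have "X * (X ^ 2 * s) \<le> 1 / 30 * (X ^ 2 * s)" using X s by (intro mult_right_mono) auto
    then have "X ^ 3 * s \<le> X ^ 2 * s / 30" by (simp add: power2_eq_square power3_eq_cube mult_ac)
    then have "4 * e \<le> X ^ 2 * s / 5000" using e8 s zero_le_power2[of X] mult_nonneg_nonneg[of "X^2" s] by linarith
    then show ?thesis using l by (simp add: X_def field_simps)
  qed
  have e3: "8 * e / l ^ 3 \<le> s * B ^ 3 / 100"
    using e8 l by (simp add: X_def field_simps)
  \<comment> \<open>The common point is x, where the third derivative is small: the bounds for f0,
    f1 and f2 are moved there by the mean value theorem, so no fourth derivative has to be
    estimated.\<close>
  obtain x1 x2 x where x1: "x1 \<in> {y0..y3}" "\<bar>f1 x1\<bar> \<le> 2 * e / l"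
    and x2: "x2 \<in> {y0..y3}" "\<bar>f2 x2\<bar> \<le> 4 * e / l ^ 2"
    and x: "x \<in> {y0..y3}" "\<bar>f3 x\<bar> \<le> 8 * e / l ^ 3"
    using small_derivatives_of_separated_small_values[OF d0 d1 d2 l small[unfolded rs]] by blast
  have W': "M * (y3 - y0) \<le> M / B / 10" if "M \<ge> 0" for M
  proof -
    have "y3 - y0 \<le> 1 / B / 10" using W B by (simp add: B_def field_simps)
    from mult_left_mono[OF this that] show ?thesis by simp
  qed
  have "\<bar>f0 x\<bar> \<le> e + s * B * (302 / 100) * (y3 - y0)"
    by (rule mvt_drift[OF d0 M1 x(1) _ small(1)[unfolded rs]]) (use l in auto)
  also have "s * B * (302 / 100) * (y3 - y0) \<le> s * (302 / 1000)"
    using W'[of "s * B * (302 / 100)"] s B by simp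
  finally have f0: "\<bar>f0 x\<bar> \<le> s * (3021 / 10000)" using e0 by simp
  have "\<bar>f1 x\<bar> \<le> 2 * e / l + s * B ^ 2 * (2524 / 1000) * (y3 - y0)"
    by (rule mvt_drift[OF d1 M2 x(1) x1])
  also have "s * B ^ 2 * (2524 / 1000) * (y3 - y0) \<le> s * B * (2524 / 10000)"
    using W'[of "s * B ^ 2 * (2524 / 1000)"] s B by (simp add: power2_eq_square)
  finally have f1: "\<bar>f1 x\<bar> \<le> s * B * (2525 / 10000)" using e1 by simp
  have "\<bar>f2 x\<bar> \<le> 4 * e / l ^ 2 + s * B ^ 3 * (228 / 100) * (y3 - y0)"
    by (rule mvt_drift[OF d2 M3 x(1) x2])
  also have "s * B ^ 3 * (228 / 100) * (y3 - y0) \<le> s * B ^ 2 * (228 / 1000)"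
    using W'[of "s * B ^ 3 * (228 / 100)"] s B by (simp add: power2_eq_square power3_eq_cube)
  finally have f2: "\<bar>f2 x\<bar> \<le> s * B ^ 2 * (2282 / 10000)" using e2 by simp
  have f3: "\<bar>f3 x\<bar> \<le> s * B ^ 3 * (1 / 100)" using x(2) e3 by simp
  have au: "cmod (u r x - of_real ((128 * T) ^ r) * u 0 x) \<le> 2 * s * T ^ r * (129 ^ r - 128 ^ r)"
    and av: "cmod (v r x - of_real ((256 * T) ^ r) * v 0 x) \<le> 2 * s * T ^ r * (257 ^ r - 256 ^ r)" for r
    using golay_block_sums(1)[OF g, of 128 r x] golay_block_sums(2)[OF g, of 256 r x]
    by (simp_all add: u_def v_def s_def)
  define p where "p = Re (u 0 x) / s"
  define P where "P = Im (u 0 x) / s"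
  define q where "q = Re (v 0 x) / s"
  define Q where "Q = Im (v 0 x) / s"
  have uv: "Re (u 0 x) = s * p" "Im (u 0 x) = s * P" "Re (v 0 x) = s * q" "Im (v 0 x) = s * Q"
    using s by (auto simp: p_def P_def q_def Q_def)
  have sq2: "p\<^sup>2 + P\<^sup>2 + q\<^sup>2 + Q\<^sup>2 = 2"
  proof -
    have "(cmod (u 0 x))\<^sup>2 + (cmod (v 0 x))\<^sup>2 = 2 * real T"
      using g norm_cis[of x] unfolding golay_pair_def u_def v_def norm_block_sum_0 by blast
    then have "s\<^sup>2 * (p\<^sup>2 + P\<^sup>2 + q\<^sup>2 + Q\<^sup>2) = s\<^sup>2 * 2"
      using s(2) by (simp add: cmod_power2 uv power_mult_distrib algebra_simps)
    moreover have "s\<^sup>2 \<noteq> 0" using s(1) by simp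
    ultimately show ?thesis using mult_left_cancel by blast
  qed
  have scale: "\<bar>y / (s * B ^ k)\<bar> \<le> c" if "\<bar>y\<bar> \<le> s * B ^ k * c" for y k c
    using that s B by (simp add: abs_mult field_simps)
  have "\<bar>f1 x + s * B * (P / 2) + s * B * Q\<bar> \<le> s * B ^ 1 * (4 / 256)"
  proof -
    have "\<bar>Im (u 1 x) - s * B * (P / 2)\<bar> \<le> 2 * s * T" "\<bar>Im (v 1 x) - s * B * Q\<bar> \<le> 2 * s * T"
      using order_trans[OF abs_Im_le_cmod au[of 1]] order_trans[OF abs_Im_le_cmod av[of 1]]
      by (simp_all add: uv B_def mult_ac)
    then show ?thesis unfolding f1_def by (simp add: B_def)
  qed
  from scale[OF this] have F1: "\<bar>f1 x / (s * B ^ 1) + P / 2 + Q\<bar> \<le> 4 / 256"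
    using s B by (simp add: add_divide_distrib)
  have "\<bar>f2 x + s * B ^ 2 * (p / 4) + s * B ^ 2 * q\<bar> \<le> s * B ^ 2 * (1540 / 65536)"
  proof -
    have "\<bar>Re (u 2 x) - s * B ^ 2 * (p / 4)\<bar> \<le> 2 * s * T ^ 2 * (129 ^ 2 - 128 ^ 2)"
      "\<bar>Re (v 2 x) - s * B ^ 2 * q\<bar> \<le> 2 * s * T ^ 2 * (257 ^ 2 - 256 ^ 2)"
      using order_trans[OF abs_Re_le_cmod au[of 2]] order_trans[OF abs_Re_le_cmod av[of 2]]
      by (simp_all add: uv B_def mult_ac power_mult_distrib Re_power2)
    then show ?thesis unfolding f2_def by (simp add: B_def power_mult_distrib)
  qed
  from scale[OF this] have F2: "\<bar>f2 x / (s * B ^ 2) + p / 4 + q\<bar> \<le> 1540 / 65536"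
    using s B by (simp add: add_divide_distrib)
  have "\<bar>f3 x - s * B ^ 3 * (P / 8) - s * B ^ 3 * Q\<bar> \<le> s * B ^ 3 * (493828 / 16777216)"
  proof -
    have "\<bar>Im (u 3 x) - s * B ^ 3 * (P / 8)\<bar> \<le> 2 * s * T ^ 3 * (129 ^ 3 - 128 ^ 3)"
      "\<bar>Im (v 3 x) - s * B ^ 3 * Q\<bar> \<le> 2 * s * T ^ 3 * (257 ^ 3 - 256 ^ 3)"
      using order_trans[OF abs_Im_le_cmod au[of 3]] order_trans[OF abs_Im_le_cmod av[of 3]]
      by (simp_all add: uv B_def mult_ac power_mult_distrib)
    then show ?thesis unfolding f3_def by (simp add: B_def power_mult_distrib)
  qed
  from scale[OF this] have F3: "\<bar>f3 x / (s * B ^ 3) - P / 8 - Q\<bar> \<le> 493828 / 16777216"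
    using s B by (simp add: diff_divide_distrib)
  have F0: "f0 x / s = p + q" by (simp add: f0_def p_def q_def add_divide_distrib)
  have "p\<^sup>2 + P\<^sup>2 + q\<^sup>2 + Q\<^sup>2 < 2"
    by (rule golay_vandermonde[OF F0 F1 F2 F3])
       (use scale[of "f0 x" 0 "3021 / 10000"] scale[of "f1 x" 1 "2525 / 10000"] scale[of "f2 x" 2 "2282 / 10000"]
          scale[of "f3 x" 3 "1 / 100"] f0 f1 f2 f3 in simp_all)
  then show False using sq2 by simp
qed

section \<open>Sine polynomials from the Fejer-Korovkin kernel\<close>

text \<open>The Fejer-Korovkin kernel: its weights are the top eigenvector of the path graph, which
  maximises the first Fourier coefficient of a nonnegative kernel and so makes the tails small by
  Chebyshev's inequality for 1 - cos.\<close>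

definition fk_weight :: "nat \<Rightarrow> int \<Rightarrow> real" where
  "fk_weight N p = sin (pi * of_int p / real (N + 1))"

definition fk_norm :: "nat \<Rightarrow> real" where
  "fk_norm N = (\<Sum>p\<in>{1..int N}. (fk_weight N p)\<^sup>2)"

definition fk_kernel :: "nat \<Rightarrow> real \<Rightarrow> real" where
  "fk_kernel N x = (\<Sum>p\<in>{1..int N}. \<Sum>q\<in>{1..int N}. fk_weight N p * fk_weight N q * cos (of_int (p - q) * x)) / fk_norm N"

lemma fk_weight_pos:
  assumes "p \<in> {1..int N}"
  shows "fk_weight N p > 0"
  unfolding fk_weight_def
proof (rule sin_gt_zero)
  show "0 < pi * of_int p / real (N + 1)" using assms by simp
  have "real_of_int p < real (N + 1)" using assms by (simp del: of_nat_add)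
  then have "pi * of_int p < pi * real (N + 1)" by (intro mult_strict_left_mono) auto
  then show "pi * of_int p / real (N + 1) < pi" by (subst pos_divide_less_eq) auto
qed

lemma fk_weight_ends: "fk_weight N 0 = 0" "fk_weight N (int N + 1) = 0"
proof -
  have "pi * of_int (int N + 1) / real (N + 1) = pi" by (simp add: field_simps)
  then show "fk_weight N 0 = 0" "fk_weight N (int N + 1) = 0" by (simp_all add: fk_weight_def)
qed

lemma fk_weight_neighbours:
  "fk_weight N (p + 1) + fk_weight N (p - 1) = 2 * cos (pi / real (N + 1)) * fk_weight N p"
proof -
  define x where "x = pi * of_int p / real (N + 1)"
  define y where "y = pi / real (N + 1)"
  have "pi * of_int (p + 1) / real (N + 1) = x + y" "pi * of_int (p - 1) / real (N + 1) = x - y"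
    unfolding x_def y_def by (simp_all add: add_divide_distrib diff_divide_distrib distrib_left right_diff_distrib)
  then show ?thesis unfolding fk_weight_def x_def[symmetric] y_def[symmetric]
    by (simp add: sin_add sin_diff)
qed

lemma fk_norm_pos:
  assumes "N \<ge> 1"
  shows "fk_norm N > 0"
  unfolding fk_norm_def using assms by (intro sum_pos zero_less_power fk_weight_pos) auto

lemma fk_kernel_nonneg: "fk_kernel N x \<ge> 0"
proof -
  have "(\<Sum>p\<in>{1..int N}. \<Sum>q\<in>{1..int N}. fk_weight N p * fk_weight N q * cos (of_int (p - q) * x)) =
    (\<Sum>p\<in>{1..int N}. fk_weight N p * cos (of_int p * x))\<^sup>2 + (\<Sum>p\<in>{1..int N}. fk_weight N p * sin (of_int p * x))\<^sup>2"
    unfolding power2_eq_square sum_product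
    by (simp add: cos_diff left_diff_distrib sum.distrib[symmetric] algebra_simps)
  then show ?thesis unfolding fk_kernel_def fk_norm_def
    by (auto intro!: divide_nonneg_nonneg sum_nonneg)
qed

section \<open>Exact quadrature on the cell midpoints\<close>

lemma sum_cos_odd_multiples: "2 * sin x * (\<Sum>j<n. cos (real (2 * j + 1) * x)) = sin (2 * real n * x)"
proof (induction n)
  case (Suc n)
  have "sin (2 * real (Suc n) * x) = sin (real (2 * n + 1) * x + x)"
    and "sin (2 * real n * x) = sin (real (2 * n + 1) * x - x)"
    by (simp_all add: algebra_simps)
  then have "sin (2 * real (Suc n) * x) = sin (2 * real n * x) + 2 * sin x * cos (real (2 * n + 1) * x)"
    by (simp add: sin_add sin_diff)
  then show ?case using Suc by (simp add: algebra_simps)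
qed auto

definition cell_mid :: "nat \<Rightarrow> nat \<Rightarrow> real" where
  "cell_mid n j = real (2 * j + 1) * (pi / (4 * real n))"

lemma sum_cos_cell_mid:
  fixes l :: int
  assumes "l \<noteq> 0" "\<bar>l\<bar> \<le> int n"
  shows "(\<Sum>j<n. cos (of_int (2 * l) * cell_mid n j)) = 0"
proof -
  define x where "x = of_int l * pi / (2 * real n)"
  have n: "n > 0" using assms by auto
  have "\<bar>real_of_int l\<bar> \<le> real n" using assms(2) by linarith
  then have "\<bar>x\<bar> \<le> pi / 2" using n by (simp add: x_def abs_mult field_simps)
  moreover have "x \<noteq> 0" using assms n by (simp add: x_def)
  ultimately have "sin x \<noteq> 0"
    using sin_gt_zero[of x] sin_gt_zero[of "- x"] pi_gt_zero by (cases "x > 0") (auto simp: abs_if)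
  moreover have "sin (2 * real n * x) = 0"
    using n by (simp add: x_def sin_int_times_real sin_zero_iff_int2)
  moreover have "(\<Sum>j<n. cos (of_int (2 * l) * cell_mid n j)) = (\<Sum>j<n. cos (real (2 * j + 1) * x))"
    by (intro sum.cong refl arg_cong[of _ _ cos]) (simp add: cell_mid_def x_def)
  ultimately show ?thesis using sum_cos_odd_multiples[of x n] by simp
qed

text \<open>Summation over the orbit of the quarter-circle grid under the reflections that leave
  odd sines invariant up to sign.\<close>

definition orbit_sum :: "nat \<Rightarrow> real \<Rightarrow> (real \<Rightarrow> real) \<Rightarrow> real" where
  "orbit_sum n x F = (\<Sum>j<n. F (x - cell_mid n j) + F (x - cell_mid n j + pi) + F (x + cell_mid n j) + F (x + cell_mid n j + pi))"

text \<open>The orbit consists of 4 n equally spaced points of the circle, so summation over it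
  integrates trigonometric polynomials of degree up to 2 n exactly. Odd d cancels under the shift by
  pi, even d reduces to \<open>sum_cos_cell_mid\<close>.\<close>

lemma orbit_sum_cos:
  fixes d :: int
  assumes d: "\<bar>d\<bar> \<le> 2 * int n"
  shows "orbit_sum n x (\<lambda>y. cos (of_int d * y)) = (if d = 0 then 4 * real n else 0)"
proof (cases "even d")
  case True
  then obtain l where l: "d = 2 * l" by auto
  have sh: "cos (of_int d * (y + pi)) = cos (of_int d * y)" for y
  proof -
    have "of_int d * (y + pi) = of_int d * y + of_int l * (2 * pi)" by (simp add: l algebra_simps)
    then show ?thesis by (simp add: cos_add mult.commute[of _ "2*pi"])
  qed
  have "orbit_sum n x (\<lambda>y. cos (of_int d * y)) = (\<Sum>j<n. 4 * cos (of_int d * x) * cos (of_int (2 * l) * cell_mid n j))"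
    unfolding orbit_sum_def sh
    by (intro sum.cong refl) (simp add: l distrib_left right_diff_distrib cos_add cos_diff)
  then show ?thesis using sum_cos_cell_mid[of l n] d
    by (cases "l = 0") (auto simp: l sum_distrib_left[symmetric])
next
  case False
  then obtain l where l: "d = 2 * l + 1" by (auto elim: oddE)
  have sh: "cos (of_int d * (y + pi)) = - cos (of_int d * y)" for y
  proof -
    have "of_int d * (y + pi) = (of_int d * y + pi) + of_int l * (2 * pi)" by (simp add: l algebra_simps)
    then show ?thesis by (simp only: cos_add mult.commute[of _ "2*pi"]) simp
  qed
  have "d \<noteq> 0" using False by auto
  then show ?thesis unfolding orbit_sum_def sh by simp
qed

lemma orbit_sum_linear:
  "orbit_sum n x (\<lambda>y. (\<Sum>p\<in>P. \<Sum>q\<in>Q. c p q * F p q y) / Z) = (\<Sum>p\<in>P. \<Sum>q\<in>Q. c p q * orbit_sum n x (F p q)) / Z"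
proof -
  have swap: "(\<Sum>p\<in>P. \<Sum>q\<in>Q. \<Sum>j<n. G p q j) = (\<Sum>j<n. \<Sum>p\<in>P. \<Sum>q\<in>Q. G p q j)" for G :: "_ \<Rightarrow> _ \<Rightarrow> nat \<Rightarrow> real"
  proof -
    have "(\<Sum>p\<in>P. \<Sum>q\<in>Q. \<Sum>j<n. G p q j) = (\<Sum>p\<in>P. \<Sum>j<n. \<Sum>q\<in>Q. G p q j)"
      by (intro sum.cong refl sum.swap)
    also have "\<dots> = (\<Sum>j<n. \<Sum>p\<in>P. \<Sum>q\<in>Q. G p q j)" by (rule sum.swap)
    finally show ?thesis .
  qed
  have "(\<Sum>p\<in>P. \<Sum>q\<in>Q. c p q * orbit_sum n x (F p q)) = (\<Sum>j<n. \<Sum>p\<in>P. \<Sum>q\<in>Q. c p q *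
      (F p q (x - cell_mid n j) + F p q (x - cell_mid n j + pi) + F p q (x + cell_mid n j) + F p q (x + cell_mid n j + pi)))"
    unfolding orbit_sum_def sum_distrib_left
    by (rule swap)
  then show ?thesis unfolding orbit_sum_def sum_divide_distrib[of _ "{..<n}"]
    by (simp add: sum_divide_distrib sum.distrib distrib_left add_divide_distrib cong: sum.cong)
qed

lemma orbit_sum_fk_kernel:
  assumes "n \<ge> 1"
  shows "orbit_sum n x (fk_kernel (2 * n)) = 4 * real n"
proof -
  have "orbit_sum n x (fk_kernel (2 * n)) = (\<Sum>p\<in>{1..int (2 * n)}. \<Sum>q\<in>{1..int (2 * n)}.
      fk_weight (2 * n) p * fk_weight (2 * n) q * (if q = p then 4 * real n else 0)) / fk_norm (2 * n)"
    unfolding fk_kernel_def[abs_def] orbit_sum_linear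
    by (intro arg_cong2[of _ _ _ _ "(/)"] sum.cong refl, subst orbit_sum_cos) auto
  also have "\<dots> = (\<Sum>p\<in>{1..int (2 * n)}. (fk_weight (2 * n) p)\<^sup>2 * (4 * real n)) / fk_norm (2 * n)"
    by (intro arg_cong2[of _ _ _ _ "(/)"] sum.cong refl) (auto simp: if_distrib power2_eq_square cong: if_cong)
  also have "\<dots> = 4 * real n"
    unfolding sum_distrib_right[symmetric] fk_norm_def[symmetric] using fk_norm_pos[of "2 * n"] assms by simp
  finally show ?thesis .
qed

text \<open>Multiplication by cos y selects the pairs with |p - q| = 1, that is, the quadratic form
  of the path graph, so the eigenvalue of the weights appears; their zeros at 0 and 2 n + 1 supply
  the missing neighbours. The degree rises to 2 n, just within the range of
  \<open>orbit_sum_cos\<close>.\<close>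

lemma orbit_sum_fk_kernel_cos:
  assumes "n \<ge> 1"
  shows "orbit_sum n x (\<lambda>y. fk_kernel (2 * n) y * cos y) = 4 * real n * cos (pi / real (2 * n + 1))"
proof -
  define w where "w = fk_weight (2 * n)"
  define I where "I = {1..int (2 * n)}"
  have "(\<lambda>y. fk_kernel (2 * n) y * cos y) = (\<lambda>y. (\<Sum>p\<in>I. \<Sum>q\<in>I. w p * w q *
     (cos (of_int (p - q + 1) * y) / 2 + cos (of_int (p - q - 1) * y) / 2)) / fk_norm (2 * n))"
  proof
    fix y :: real
    have pr: "cos (of_int d * y) * cos y = cos (of_int (d + 1) * y) / 2 + cos (of_int (d - 1) * y) / 2" for d :: int
      by (simp add: distrib_right left_diff_distrib cos_add cos_diff add_divide_distrib diff_divide_distrib)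
    then show "fk_kernel (2 * n) y * cos y = (\<Sum>p\<in>I. \<Sum>q\<in>I. w p * w q *
       (cos (of_int (p - q + 1) * y) / 2 + cos (of_int (p - q - 1) * y) / 2)) / fk_norm (2 * n)"
      unfolding fk_kernel_def w_def I_def by (simp only: times_divide_eq_left sum_distrib_right mult.assoc pr)
  qed
  then have "orbit_sum n x (\<lambda>y. fk_kernel (2 * n) y * cos y) = (\<Sum>p\<in>I. \<Sum>q\<in>I. w p * w q *
     orbit_sum n x (\<lambda>y. cos (of_int (p - q + 1) * y) / 2 + cos (of_int (p - q - 1) * y) / 2)) / fk_norm (2 * n)"
    by (simp only: orbit_sum_linear)
  also have "\<dots> = (\<Sum>p\<in>I. \<Sum>q\<in>I. w p * w q * ((if q = p + 1 then 2 * real n else 0) + (if q = p - 1 then 2 * real n else 0))) / fk_norm (2 * n)"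
  proof (intro arg_cong2[of _ _ _ _ "(/)"] sum.cong refl arg_cong2[of _ _ _ _ "(*)"])
    fix p q assume pq: "p \<in> I" "q \<in> I"
    have "orbit_sum n x (\<lambda>y. cos (of_int (p - q + 1) * y) / 2 + cos (of_int (p - q - 1) * y) / 2) =
      orbit_sum n x (\<lambda>y. cos (of_int (p - q + 1) * y)) / 2 + orbit_sum n x (\<lambda>y. cos (of_int (p - q - 1) * y)) / 2"
      by (simp add: orbit_sum_def sum.distrib sum_divide_distrib add_divide_distrib)
    moreover have "\<bar>p - q + 1\<bar> \<le> 2 * int n" "\<bar>p - q - 1\<bar> \<le> 2 * int n" using pq by (auto simp: I_def)
    ultimately show "orbit_sum n x (\<lambda>y. cos (of_int (p - q + 1) * y) / 2 + cos (of_int (p - q - 1) * y) / 2) =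
      (if q = p + 1 then 2 * real n else 0) + (if q = p - 1 then 2 * real n else 0)"
      using orbit_sum_cos[of "p - q + 1" n x] orbit_sum_cos[of "p - q - 1" n x] by auto
  qed
  also have "\<dots> = (\<Sum>p\<in>I. w p * (w (p + 1) + w (p - 1)) * (2 * real n)) / fk_norm (2 * n)"
  proof (intro arg_cong2[of _ _ _ _ "(/)"] sum.cong refl)
    fix p assume p: "p \<in> I"
    have fin: "finite I" by (simp add: I_def)
    have "(\<Sum>q\<in>I. w p * w q * ((if q = p + 1 then 2 * real n else 0) + (if q = p - 1 then 2 * real n else 0))) =
      (\<Sum>q\<in>I. if q = p + 1 then w p * w (p + 1) * (2 * real n) else 0) + (\<Sum>q\<in>I. if q = p - 1 then w p * w (p - 1) * (2 * real n) else 0)"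
      unfolding sum.distrib[symmetric] by (intro sum.cong refl) auto
    also have "\<dots> = w p * w (p + 1) * (2 * real n) + w p * w (p - 1) * (2 * real n)"
    proof -
      have "w (p + 1) = 0" if "p + 1 \<notin> I"
      proof -
        have "p + 1 = int (2 * n) + 1" using that p by (auto simp: I_def)
        then show ?thesis unfolding w_def by (simp only: fk_weight_ends)
      qed
      moreover have "w (p - 1) = 0" if "p - 1 \<notin> I"
      proof -
        have "p - 1 = 0" using that p by (auto simp: I_def)
        then show ?thesis unfolding w_def by (simp only: fk_weight_ends)
      qed
      ultimately show ?thesis using fin by auto
    qed
    finally show "(\<Sum>q\<in>I. w p * w q * ((if q = p + 1 then 2 * real n else 0) + (if q = p - 1 then 2 * real n else 0))) =
      w p * (w (p + 1) + w (p - 1)) * (2 * real n)" by (simp add: algebra_simps)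
  qed
  also have "\<dots> = (\<Sum>p\<in>I. (w p)\<^sup>2 * (4 * real n * cos (pi / real (2 * n + 1)))) / fk_norm (2 * n)"
    unfolding w_def fk_weight_neighbours by (simp add: power2_eq_square mult_ac)
  also have "\<dots> = 4 * real n * cos (pi / real (2 * n + 1))"
    unfolding sum_distrib_right[symmetric] w_def I_def fk_norm_def[symmetric] using fk_norm_pos[of "2 * n"] assms by simp
  finally show ?thesis .
qed

text \<open>The distance 5 pi / (4 n) is two and a half cells. The quotient tends to (1/2)^2 /
  (5/4)^2 = 4/25 = 0.16.\<close>

lemma fk_tail_eventually:
  "eventually (\<lambda>n. (1 - cos (pi / real (2 * n + 1))) / (1 - cos (5 * pi / (4 * real n))) \<le> 17 / 100) at_top"
  by real_asymp

text \<open>For k >= 1 this is the coefficient of \<open>cis (k * x)\<close> in the kernel.\<close>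

definition fk_coeff :: "nat \<Rightarrow> nat \<Rightarrow> real" where
  "fk_coeff N k = (\<Sum>p\<in>{1..int N}. \<Sum>q\<in>{1..int N}.
     if \<bar>p - q\<bar> = int k then fk_weight N p * fk_weight N q else 0) / (2 * fk_norm N)"

text \<open>The upper bound uses w p * w q <= (w p)^2 / 2 + (w q)^2 / 2 and the fact that each p has
  at most two partners q at distance k.\<close>

lemma fk_coeff_bounds:
  assumes "N \<ge> 1"
  shows "0 \<le> fk_coeff N k" "fk_coeff N k \<le> 1"
proof -
  define I where "I = {1..int N}"
  define w where "w = fk_weight N"
  have w: "w p > 0" if "p \<in> I" for p using that fk_weight_pos unfolding I_def w_def by blast
  have "(\<Sum>p\<in>I. \<Sum>q\<in>I. if \<bar>p - q\<bar> = int k then w p * w q else 0) \<ge> 0"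
    using w by (intro sum_nonneg) (auto simp: less_imp_le)
  then show "0 \<le> fk_coeff N k"
    unfolding fk_coeff_def I_def[symmetric] w_def[symmetric] using fk_norm_pos[OF assms] by simp
  have half: "(\<Sum>p\<in>I. \<Sum>q\<in>I. if \<bar>p - q\<bar> = int k then (w p)\<^sup>2 / 2 else 0) \<le> fk_norm N"
  proof -
    have "(\<Sum>q\<in>I. if \<bar>p - q\<bar> = int k then (w p)\<^sup>2 / 2 else 0) \<le> (w p)\<^sup>2" for p
    proof -
      have "(\<Sum>q\<in>I. if \<bar>p - q\<bar> = int k then (w p)\<^sup>2 / 2 else 0) = (\<Sum>q\<in>{q\<in>I. \<bar>p - q\<bar> = int k}. (w p)\<^sup>2 / 2)"
        by (subst sum.inter_filter) (auto simp: I_def)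
      also have "\<dots> = card {q\<in>I. \<bar>p - q\<bar> = int k} * ((w p)\<^sup>2 / 2)" by simp
      also have "\<dots> \<le> 2 * ((w p)\<^sup>2 / 2)"
      proof (rule mult_right_mono)
        have "card {q\<in>I. \<bar>p - q\<bar> = int k} \<le> card {p + int k, p - int k}"
          by (rule card_mono) auto
        also have "\<dots> \<le> 2" by (rule card_insert_le_m1) auto
        finally show "real (card {q\<in>I. \<bar>p - q\<bar> = int k}) \<le> 2" by simp
      qed simp
      finally show ?thesis by simp
    qed
    then show ?thesis unfolding fk_norm_def I_def[symmetric] w_def[symmetric] by (intro sum_mono)
  qed
  have half': "(\<Sum>p\<in>I. \<Sum>q\<in>I. if \<bar>p - q\<bar> = int k then (w q)\<^sup>2 / 2 else 0) \<le> fk_norm N"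
    using half by (subst sum.swap) (simp add: abs_minus_commute)
  have "(\<Sum>p\<in>I. \<Sum>q\<in>I. if \<bar>p - q\<bar> = int k then w p * w q else 0)
     \<le> (\<Sum>p\<in>I. \<Sum>q\<in>I. (if \<bar>p - q\<bar> = int k then (w p)\<^sup>2 / 2 else 0) + (if \<bar>p - q\<bar> = int k then (w q)\<^sup>2 / 2 else 0))"
  proof (intro sum_mono)
    fix p q
    have "w p * w q \<le> (w p)\<^sup>2 / 2 + (w q)\<^sup>2 / 2" using sum_squares_bound[of "w p" "w q"] by simp
    then show "(if \<bar>p - q\<bar> = int k then w p * w q else 0) \<le>
      (if \<bar>p - q\<bar> = int k then (w p)\<^sup>2 / 2 else 0) + (if \<bar>p - q\<bar> = int k then (w q)\<^sup>2 / 2 else 0)" by simp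
  qed
  also have "\<dots> \<le> 2 * fk_norm N" unfolding sum.distrib using half half' by simp
  finally show "fk_coeff N k \<le> 1"
    unfolding fk_coeff_def I_def[symmetric] w_def[symmetric] using fk_norm_pos[OF assms] by simp
qed

section \<open>Antisymmetrised kernel and odd sine series\<close>

lemma cos_reflected:
  fixes d :: int
  shows "cos (of_int d * (x - t)) - cos (of_int d * (x - t + pi)) - cos (of_int d * (x + t)) + cos (of_int d * (x + t + pi))
    = (if odd d then 4 * sin (of_int \<bar>d\<bar> * t) * sin (of_int \<bar>d\<bar> * x) else 0)"
proof (cases "odd d")
  case False
  then obtain l where l: "d = 2 * l" by auto
  have "cos (of_int d * (y + pi)) = cos (of_int d * y)" for y
  proof -
    have "of_int d * (y + pi) = of_int d * y + of_int l * (2 * pi)" by (simp add: l algebra_simps)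
    then show ?thesis by (simp add: cos_add mult.commute[of _ "2*pi"])
  qed
  then show ?thesis using False by simp
next
  case True
  then obtain l where l: "d = 2 * l + 1" by (auto elim: oddE)
  have sh: "cos (of_int d * (y + pi)) = - cos (of_int d * y)" for y
  proof -
    have "of_int d * (y + pi) = (of_int d * y + pi) + of_int l * (2 * pi)" by (simp add: l algebra_simps)
    then show ?thesis by (simp only: cos_add mult.commute[of _ "2*pi"]) simp
  qed
  have "sin (of_int \<bar>d\<bar> * t) * sin (of_int \<bar>d\<bar> * x) = sin (of_int d * t) * sin (of_int d * x)"
    by (cases "d \<ge> 0") auto
  then show ?thesis using True unfolding sh
    by (simp add: distrib_left right_diff_distrib cos_add cos_diff)
qed

definition odd_below :: "nat \<Rightarrow> nat set" where "odd_below N = {k. odd k \<and> k < N}"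

text \<open>The signs +, -, -, + on the four images are those by which odd sines change under the
  reflections, so even frequencies and cosine parts drop out. The factor 8 is 4 from
  \<open>cos_reflected\<close> times 2 from the normalisation of \<open>fk_coeff\<close>.\<close>

lemma fk_kernel_reflected:
  "fk_kernel N (x - t) - fk_kernel N (x - t + pi) - fk_kernel N (x + t) + fk_kernel N (x + t + pi)
     = 8 * (\<Sum>k\<in>odd_below N. fk_coeff N k * sin (real k * t) * sin (real k * x))"
proof -
  define I where "I = {1..int N}"
  define w where "w = fk_weight N"
  have fin: "finite (odd_below N)" unfolding odd_below_def by simp
  have inner: "(\<Sum>k\<in>odd_below N. if \<bar>p - q\<bar> = int k then 4 * (sin (real k * t) * sin (real k * x)) else 0)
     = (if odd (p - q) then 4 * sin (of_int \<bar>p - q\<bar> * t) * sin (of_int \<bar>p - q\<bar> * x) else 0)" if "p \<in> I" "q \<in> I" for p q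
  proof -
    have "(\<Sum>k\<in>odd_below N. if \<bar>p - q\<bar> = int k then 4 * (sin (real k * t) * sin (real k * x)) else 0)
      = (\<Sum>k\<in>odd_below N. if k = nat \<bar>p - q\<bar> then 4 * (sin (real k * t) * sin (real k * x)) else 0)"
      by (intro sum.cong refl if_cong) auto
    also have "\<dots> = (if nat \<bar>p - q\<bar> \<in> odd_below N then 4 * (sin (real (nat \<bar>p - q\<bar>) * t) * sin (real (nat \<bar>p - q\<bar>) * x)) else 0)"
      using fin by simp
    also have "nat \<bar>p - q\<bar> \<in> odd_below N \<longleftrightarrow> odd (p - q)"
      using that by (auto simp: odd_below_def I_def even_nat_iff)
    finally show ?thesis by simp
  qed
  have "fk_kernel N (x - t) - fk_kernel N (x - t + pi) - fk_kernel N (x + t) + fk_kernel N (x + t + pi)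
    = (\<Sum>p\<in>I. \<Sum>q\<in>I. w p * w q * (cos (of_int (p - q) * (x - t)) - cos (of_int (p - q) * (x - t + pi))
         - cos (of_int (p - q) * (x + t)) + cos (of_int (p - q) * (x + t + pi)))) / fk_norm N"
    unfolding fk_kernel_def I_def[symmetric] w_def[symmetric] distrib_left right_diff_distrib
      sum.distrib sum_subtractf add_divide_distrib diff_divide_distrib ..
  also have "\<dots> = (\<Sum>p\<in>I. \<Sum>q\<in>I. \<Sum>k\<in>odd_below N. w p * w q * (if \<bar>p - q\<bar> = int k then 4 * (sin (real k * t) * sin (real k * x)) else 0)) / fk_norm N"
    unfolding cos_reflected sum_distrib_left[symmetric] using inner by (simp cong: sum.cong)
  also have "\<dots> = (\<Sum>k\<in>odd_below N. \<Sum>p\<in>I. \<Sum>q\<in>I. (if \<bar>p - q\<bar> = int k then w p * w q else 0) * (4 * (sin (real k * t) * sin (real k * x)))) / fk_norm N"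
  proof (rule arg_cong2[of _ _ _ _ "(/)"])
    have "(\<Sum>p\<in>I. \<Sum>q\<in>I. \<Sum>k\<in>odd_below N. w p * w q * (if \<bar>p - q\<bar> = int k then 4 * (sin (real k * t) * sin (real k * x)) else 0)) =
      (\<Sum>p\<in>I. \<Sum>k\<in>odd_below N. \<Sum>q\<in>I. (if \<bar>p - q\<bar> = int k then w p * w q else 0) * (4 * (sin (real k * t) * sin (real k * x))))"
      by (rule sum.cong[OF refl], subst sum.swap, intro sum.cong refl) auto
    then show "(\<Sum>p\<in>I. \<Sum>q\<in>I. \<Sum>k\<in>odd_below N. w p * w q * (if \<bar>p - q\<bar> = int k then 4 * (sin (real k * t) * sin (real k * x)) else 0)) =
      (\<Sum>k\<in>odd_below N. \<Sum>p\<in>I. \<Sum>q\<in>I. (if \<bar>p - q\<bar> = int k then w p * w q else 0) * (4 * (sin (real k * t) * sin (real k * x))))"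
      by (subst (2) sum.swap)
  qed simp
  also have "\<dots> = 8 * (\<Sum>k\<in>odd_below N. fk_coeff N k * sin (real k * t) * sin (real k * x))"
    unfolding fk_coeff_def I_def[symmetric] w_def[symmetric] sum_distrib_right[symmetric]
      sum_distrib_left[of _ _ "odd_below N"] sum_divide_distrib[of _ "odd_below N"]
    by (intro sum.cong refl) simp
  finally show ?thesis .
qed

text \<open>The factor 100 / sqrt n uses up the bound sqrt n / 100 that the sum over j will satisfy,
  and it scales the total kernel mass 4 n to 50 sqrt n.\<close>

definition sine_coeff :: "nat \<Rightarrow> (nat \<Rightarrow> real) \<Rightarrow> nat \<Rightarrow> real" where
  "sine_coeff n g k = 100 / sqrt n * fk_coeff (2 * n) k * (\<Sum>j<n. g j * sin (real k * cell_mid n j))"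

definition sine_target :: "nat \<Rightarrow> (nat \<Rightarrow> real) \<Rightarrow> real \<Rightarrow> real" where
  "sine_target n g x = (\<Sum>k\<in>odd_below (2 * n). sine_coeff n g k * sin (real k * x))"

lemma sine_target_eq:
  "sine_target n g x = 25 / 2 / sqrt n * (\<Sum>j<n. g j * (fk_kernel (2 * n) (x - cell_mid n j) - fk_kernel (2 * n) (x - cell_mid n j + pi)
      - fk_kernel (2 * n) (x + cell_mid n j) + fk_kernel (2 * n) (x + cell_mid n j + pi)))"
proof -
  have "sine_target n g x = (\<Sum>k\<in>odd_below (2 * n). \<Sum>j<n. 100 / sqrt n * g j * (fk_coeff (2 * n) k * sin (real k * cell_mid n j) * sin (real k * x)))"
    unfolding sine_target_def sine_coeff_def
    by (simp add: sum_distrib_left sum_distrib_right sum_divide_distrib mult_ac)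
  also have "\<dots> = (\<Sum>j<n. 100 / sqrt n * g j * (\<Sum>k\<in>odd_below (2 * n). fk_coeff (2 * n) k * sin (real k * cell_mid n j) * sin (real k * x)))"
    by (subst sum.swap) (simp add: sum_distrib_left)
  finally show ?thesis unfolding fk_kernel_reflected by (simp add: sum_distrib_left mult_ac)
qed

lemma sine_coeff_bound:
  assumes "n \<ge> 1"
  shows "\<bar>sine_coeff n g k\<bar> \<le> 100 / sqrt n * \<bar>\<Sum>j<n. g j * sin (real k * cell_mid n j)\<bar>"
proof -
  have "\<bar>fk_coeff (2 * n) k\<bar> \<le> 1" using fk_coeff_bounds[of "2 * n" k] assms by simp
  then have "100 / sqrt n * \<bar>fk_coeff (2 * n) k\<bar> \<le> 100 / sqrt n * 1" by (intro mult_left_mono) auto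
  then show ?thesis unfolding sine_coeff_def abs_mult by (intro mult_right_mono) (auto simp: abs_mult)
qed

lemma sine_target_le:
  assumes n: "n \<ge> 1" and g: "\<And>j. j < n \<Longrightarrow> \<bar>g j\<bar> \<le> 1"
  shows "\<bar>sine_target n g x\<bar> \<le> 50 * sqrt n"
proof -
  define K where "K = fk_kernel (2 * n)"
  define t where "t = cell_mid n"
  have K: "K y \<ge> 0" for y by (simp add: K_def fk_kernel_nonneg)
  have "\<bar>\<Sum>j<n. g j * (K (x - t j) - K (x - t j + pi) - K (x + t j) + K (x + t j + pi))\<bar> \<le> orbit_sum n x K"
    unfolding orbit_sum_def t_def[symmetric]
  proof (rule order_trans[OF sum_abs], rule sum_mono)
    fix j assume "j \<in> {..<n}"
    then have "\<bar>g j\<bar> \<le> 1" using g by simp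
    moreover have "\<bar>K (x - t j) - K (x - t j + pi) - K (x + t j) + K (x + t j + pi)\<bar> \<le> K (x - t j) + K (x - t j + pi) + K (x + t j) + K (x + t j + pi)"
      using K[of "x - t j"] K[of "x - t j + pi"] K[of "x + t j"] K[of "x + t j + pi"] by linarith
    ultimately show "\<bar>g j * (K (x - t j) - K (x - t j + pi) - K (x + t j) + K (x + t j + pi))\<bar> \<le> K (x - t j) + K (x - t j + pi) + K (x + t j) + K (x + t j + pi)"
      unfolding abs_mult using mult_mono[of "\<bar>g j\<bar>" 1] by fastforce
  qed
  also have "\<dots> = 4 * real n" using orbit_sum_fk_kernel[OF n] by (simp add: K_def)
  finally have "\<bar>sine_target n g x\<bar> \<le> 25 / 2 / sqrt n * (4 * real n)"
    unfolding sine_target_eq abs_mult K_def[symmetric] t_def[symmetric]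
    by (intro mult_mono) auto
  also have "\<dots> = 50 * (real n / sqrt n)" by simp
  finally show ?thesis by (simp add: real_div_sqrt)
qed

section \<open>Size of the target on the bad cells\<close>

lemma cos_le_of_far:
  fixes y d :: real
  assumes "0 \<le> d" "d \<le> \<bar>y\<bar>" "\<bar>y\<bar> \<le> 2 * pi - d"
  shows "cos y \<le> cos d"
proof -
  have "cos \<bar>y\<bar> \<le> cos d"
  proof (cases "\<bar>y\<bar> \<le> pi")
    case True
    then show ?thesis using assms by (subst cos_mono_le_eq) auto
  next
    case False
    have "cos \<bar>y\<bar> = cos (2 * pi - \<bar>y\<bar>)" by (simp add: cos_diff)
    also have "\<dots> \<le> cos d" using assms False by (subst cos_mono_le_eq) auto
    finally show ?thesis .
  qed
  then show ?thesis by simp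
qed

text \<open>Pointwise Chebyshev inequality, with c a cosine: a sign other than 1 loses at most 2 K,
  and at such points 1 - c >= k, so 2 K (1 - c) / k covers the loss.\<close>

lemma signed_kernel_lower:
  fixes K s c k :: real
  assumes "K \<ge> 0" "k > 0" "\<bar>s\<bar> \<le> 1" "c \<le> 1" "s = 1 \<or> 1 - c \<ge> k"
  shows "s * K \<ge> K - 2 * (K - K * c) / k"
proof (cases "s = 1")
  case True
  have "K * c \<le> K * 1" using assms by (intro mult_left_mono) auto
  then show ?thesis using True assms by simp
next
  case False
  then have "K * (1 - c) \<ge> K * k" using assms by (intro mult_left_mono) auto
  then have "(K - K * c) / k \<ge> K" using assms by (simp add: field_simps)
  moreover have "s * K \<ge> (-1) * K" using assms by (intro mult_right_mono) auto
  moreover have "2 * (K - K * c) / k = 2 * ((K - K * c) / k)" by simp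
  ultimately show ?thesis by linarith
qed

text \<open>After multiplication by s, every term whose sign is not known to be + sits at distance
  at least two and a half cells from 0 modulo 2 pi. Together these terms cost at most twice the tail
  quotient, which leaves the share 1 - 2 * 17/100 of 50 sqrt n.\<close>

lemma sine_target_ge:
  assumes n: "n \<ge> 20"
    and tail: "(1 - cos (pi / real (2 * n + 1))) / (1 - cos (5 * pi / (4 * real n))) \<le> 17 / 100"
    and g: "\<And>j. j < n \<Longrightarrow> \<bar>g j\<bar> \<le> 1"
    and i: "2 \<le> i" "i < n"
    and near: "\<And>j. j < n \<Longrightarrow> i \<le> j + 2 \<Longrightarrow> j \<le> i + 2 \<Longrightarrow> g j = s" and s: "\<bar>s\<bar> = 1"
    and x: "real i * (pi / (2 * real n)) \<le> x" "x \<le> real (i + 1) * (pi / (2 * real n))"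
  shows "\<bar>sine_target n g x\<bar> \<ge> 33 * sqrt n"
proof -
  define K where "K = fk_kernel (2 * n)"
  define t where "t = cell_mid n"
  define h where "h = pi / (2 * real n)"
  \<comment> \<open>A midpoint of a cell j with |j - i| >= 3 has at least this distance from every
    point of cell i.\<close>
  define d where "d = 5 / 2 * h"
  define k where "k = 1 - cos d"
  have h: "h > 0" "real n * h = pi / 2" "20 * h \<le> pi / 2"
  proof -
    show h0: "h > 0" and nh: "real n * h = pi / 2" using n by (auto simp: h_def)
    have "20 * h \<le> real n * h" using n h0 by (intro mult_right_mono) auto
    then show "20 * h \<le> pi / 2" using nh by simp
  qed
  have t: "t j = (real j + 1 / 2) * h" for j
    unfolding t_def cell_mid_def h_def by (simp add: field_simps)
  have K: "K y \<ge> 0" for y by (simp add: K_def fk_kernel_nonneg)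
  have d: "0 < d" "d < pi / 2" using h by (auto simp: d_def)
  have "cos d < cos 0" using d by (intro cos_monotone_0_pi) auto
  then have k: "k > 0" by (simp add: k_def)
  have xh: "real i * h \<le> x" "x \<le> (real i + 1) * h" "2 * h \<le> x" "x \<le> pi / 2"
  proof -
    show a: "real i * h \<le> x" and b: "x \<le> (real i + 1) * h" using x by (auto simp: h_def add.commute)
    have "2 * h \<le> real i * h" using i h by (intro mult_right_mono) auto
    then show "2 * h \<le> x" using a by simp
    have "(real i + 1) * h \<le> real n * h" using i h by (intro mult_right_mono) auto
    then show "x \<le> pi / 2" using b h by simp
  qed
  have far: "1 - cos y \<ge> k" if "d \<le> \<bar>y\<bar>" "\<bar>y\<bar> \<le> 2 * pi - d" for y
    using cos_le_of_far[OF _ that] d by (simp add: k_def)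
  have tm: "s * g j * (K (x - t j) - K (x - t j + pi) - K (x + t j) + K (x + t j + pi)) \<ge>
      (K (x - t j) + K (x - t j + pi) + K (x + t j) + K (x + t j + pi)) - 2 / k *
      ((K (x - t j) + K (x - t j + pi) + K (x + t j) + K (x + t j + pi)) -
       (K (x - t j) * cos (x - t j) + K (x - t j + pi) * cos (x - t j + pi) + K (x + t j) * cos (x + t j) + K (x + t j + pi) * cos (x + t j + pi)))"
    if j: "j < n" for j
  proof -
    have "(real j + 1) * h \<le> real n * h" using j h by (intro mult_right_mono) auto
    then have tj: "h / 2 \<le> t j" "t j \<le> pi / 2 - h / 2" using h
      by (auto simp: t algebra_simps intro: mult_nonneg_nonneg)
    have sg: "\<bar>s * g j\<bar> \<le> 1" using g[OF j] s by (simp add: abs_mult)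
    have dist: "s * g j = 1 \<or> d \<le> \<bar>x - t j\<bar>"
    proof (cases "i \<le> j + 2 \<and> j \<le> i + 2")
      case True
      then have "s * g j = s * s" using near j by auto
      also have "\<dots> = 1" using s by (metis abs_mult_self_eq mult_1)
      finally show ?thesis ..
    next
      case False
      then consider "real j + 3 \<le> real i" | "real i + 3 \<le> real j" by linarith
      then have "d \<le> \<bar>x - t j\<bar>"
      proof cases
        case 1
        then have "(real j + 3) * h \<le> real i * h" using h by (intro mult_right_mono) auto
        then show ?thesis using xh(1) unfolding t d_def distrib_right by linarith
      next
        case 2
        then have "(real i + 3) * h \<le> real j * h" using h by (intro mult_right_mono) auto
        then show ?thesis using xh(2) unfolding t d_def distrib_right by linarith
      qed
      then show ?thesis ..
    qed
    \<comment> \<open>From 2 <= i follows x >= 2 h, and t j >= h / 2, so x + t j >= d exactly. The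
      end pi / 2 is milder: x + t j + pi corresponds to the reflected midpoint pi - t j, which
      carries the same sign as t j and is no closer to x, since x and t j are at most pi /
      2.\<close>
    have far1: "\<bar>x - t j\<bar> \<le> 2 * pi - d"
      and far2: "d \<le> \<bar>x - t j + pi\<bar>" "\<bar>x - t j + pi\<bar> \<le> 2 * pi - d"
      and far3: "d \<le> \<bar>x + t j\<bar>" "\<bar>x + t j\<bar> \<le> 2 * pi - d"
      and far4: "d \<le> \<bar>x - t j\<bar> \<Longrightarrow> d \<le> \<bar>x + t j + pi\<bar>" "d \<le> \<bar>x - t j\<bar> \<Longrightarrow> \<bar>x + t j + pi\<bar> \<le> 2 * pi - d"
      using xh(3,4) tj h d pi_gt_zero unfolding d_def by linarith+
    have 1: "s * g j * K (x - t j) \<ge> K (x - t j) - 2 * (K (x - t j) - K (x - t j) * cos (x - t j)) / k"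
      by (rule signed_kernel_lower[OF K k sg]) (use dist far[OF _ far1] in auto)
    have 2: "- (s * g j) * K (x - t j + pi) \<ge> K (x - t j + pi) - 2 * (K (x - t j + pi) - K (x - t j + pi) * cos (x - t j + pi)) / k"
      by (rule signed_kernel_lower[OF K k]) (use sg far[OF far2] in auto)
    have 3: "- (s * g j) * K (x + t j) \<ge> K (x + t j) - 2 * (K (x + t j) - K (x + t j) * cos (x + t j)) / k"
      by (rule signed_kernel_lower[OF K k]) (use sg far[OF far3] in auto)
    have 4: "s * g j * K (x + t j + pi) \<ge> K (x + t j + pi) - 2 * (K (x + t j + pi) - K (x + t j + pi) * cos (x + t j + pi)) / k"
    proof (rule signed_kernel_lower[OF K k sg])
      have "d \<le> \<bar>x - t j\<bar> \<Longrightarrow> 1 - cos (x + t j + pi) \<ge> k"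
        using far far4 by blast
      then show "s * g j = 1 \<or> 1 - cos (x + t j + pi) \<ge> k" using dist by blast
    qed simp
    have "s * g j * (K (x - t j) - K (x - t j + pi) - K (x + t j) + K (x + t j + pi)) =
       s * g j * K (x - t j) + - (s * g j) * K (x - t j + pi) + - (s * g j) * K (x + t j) + s * g j * K (x + t j + pi)"
      by (simp add: algebra_simps)
    moreover have "2 / k * ((A + B + C + D) - (A' + B' + C' + D')) = 2 * (A - A') / k + 2 * (B - B') / k + 2 * (C - C') / k + 2 * (D - D') / k"
      for A B C D A' B' C' D' :: real by (simp add: algebra_simps add_divide_distrib diff_divide_distrib)
    ultimately show ?thesis using add_mono[OF add_mono[OF add_mono[OF 1 2] 3] 4] by (simp only:)
  qed
  have n1: "n \<ge> 1" using n by simp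
  have "s * (\<Sum>j<n. g j * (K (x - t j) - K (x - t j + pi) - K (x + t j) + K (x + t j + pi))) \<ge>
      orbit_sum n x K - 2 / k * (orbit_sum n x K - orbit_sum n x (\<lambda>y. K y * cos y))"
    unfolding orbit_sum_def t_def[symmetric] sum_subtractf[symmetric] sum_distrib_left
    using tm by (intro sum_mono) (auto simp: mult.assoc)
  also have "orbit_sum n x K = 4 * real n" using orbit_sum_fk_kernel[OF n1] by (simp add: K_def)
  also have "orbit_sum n x (\<lambda>y. K y * cos y) = 4 * real n * cos (pi / real (2 * n + 1))"
    using orbit_sum_fk_kernel_cos[OF n1] by (simp add: K_def)
  also have "4 * real n - 2 / k * (4 * real n - 4 * real n * cos (pi / real (2 * n + 1))) =
     4 * real n * (1 - 2 * ((1 - cos (pi / real (2 * n + 1))) / k))"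
    by (simp add: algebra_simps diff_divide_distrib)
  also have "k = 1 - cos (5 * pi / (4 * real n))" by (simp add: k_def d_def h_def)
  finally have "s * (\<Sum>j<n. g j * (K (x - t j) - K (x - t j + pi) - K (x + t j) + K (x + t j + pi))) \<ge>
     4 * real n * (1 - 2 * ((1 - cos (pi / real (2 * n + 1))) / (1 - cos (5 * pi / (4 * real n)))))" .
  moreover have "4 * real n * (1 - 2 * r) \<ge> 4 * real n * (66 / 100)" if "r \<le> 17 / 100" for r :: real
    using that by (intro mult_left_mono) auto
  note this[OF tail]
  ultimately have "s * (\<Sum>j<n. g j * (K (x - t j) - K (x - t j + pi) - K (x + t j) + K (x + t j + pi))) \<ge> 4 * real n * (66 / 100)"
    by linarith
  then have "25 / 2 / sqrt n * (4 * real n * (66 / 100)) \<le> 25 / 2 / sqrt n * (s * (\<Sum>j<n. g j * (K (x - t j) - K (x - t j + pi) - K (x + t j) + K (x + t j + pi))))"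
    by (intro mult_left_mono) auto
  also have "\<dots> = s * sine_target n g x" by (simp add: sine_target_eq K_def t_def)
  also have "\<dots> \<le> \<bar>sine_target n g x\<bar>" using s by (metis abs_ge_self abs_mult mult_1)
  also have "25 / 2 / sqrt n * (4 * real n * (66 / 100)) = 33 * (real n / sqrt n)" by simp
  finally show ?thesis by (simp add: real_div_sqrt)
qed

section \<open>Flat Littlewood polynomials\<close>

lemma sum_cis_grid:
  fixes m :: int and M :: nat
  assumes "\<bar>m\<bar> < int M"
  shows "(\<Sum>j<M. cis (of_int m * (2 * pi * real j / real M))) = (if m = 0 then of_nat M else 0)"
proof (cases "m = 0")
  case False
  define w where "w = cis (2 * pi * of_int m / real M)"
  have M: "M > 0" using assms by auto
  have w1: "w \<noteq> 1"
  proof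
    assume "w = 1"
    then have "cos (2 * pi * of_int m / real M) = 1" by (simp add: w_def complex_eq_iff)
    then obtain k :: int where "2 * pi * of_int m / real M = of_int k * 2 * pi"
      using cos_one_2pi_int by auto
    then have "of_int m = of_int k * real M" using M by (simp add: field_simps)
    then have "of_int m = (of_int (k * int M) :: real)" by simp
    then have "m = k * int M" by (simp only: of_int_eq_iff)
    then have "int M \<le> \<bar>m\<bar>" using False by (auto simp: abs_mult)
    then show False using assms by simp
  qed
  have "w ^ M = cis (2 * pi * of_int m)" using M by (simp add: w_def Complex.DeMoivre)
  also have "\<dots> = 1" using cis_multiple_2pi[of "of_int m"] by simp
  finally have wM: "w ^ M = 1" .
  have "cis (of_int m * (2 * pi * real j / real M)) = w ^ j" for j
    unfolding w_def Complex.DeMoivre by (rule arg_cong[of _ _ cis]) simp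
  then have "(\<Sum>j<M. cis (of_int m * (2 * pi * real j / real M))) = (\<Sum>j<M. w ^ j)" by simp
  also have "\<dots> = 0" using geometric_sum[OF w1, of M] wM by simp
  finally show ?thesis using False by simp
qed auto

lemma parseval_grid:
  fixes U :: "int set" and M :: nat
  assumes "finite U" and U: "\<And>u w. u \<in> U \<Longrightarrow> w \<in> U \<Longrightarrow> \<bar>u - w\<bar> < int M"
  shows "(\<Sum>j<M. (cmod (\<Sum>u\<in>U. cis (of_int u * (x - 2 * pi * real j / real M))))\<^sup>2) = real M * real (card U)"
proof -
  define t where "t j = 2 * pi * real j / real M" for j
  have "complex_of_real (\<Sum>j<M. (cmod (\<Sum>u\<in>U. cis (of_int u * (x - t j))))\<^sup>2)
      = (\<Sum>j<M. \<Sum>u\<in>U. \<Sum>w\<in>U. cis (of_int (u - w) * x) * cis (of_int (w - u) * t j))"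
  proof -
    have "complex_of_real ((cmod (\<Sum>u\<in>U. cis (of_int u * (x - t j))))\<^sup>2) =
      (\<Sum>u\<in>U. \<Sum>w\<in>U. cis (of_int (u - w) * x) * cis (of_int (w - u) * t j))" for j
      unfolding complex_norm_square cnj_sum sum_product cis_cnj cis_mult
      by (intro sum.cong refl arg_cong[of _ _ cis]) (simp add: algebra_simps)
    then show ?thesis by simp
  qed
  also have "\<dots> = (\<Sum>u\<in>U. \<Sum>w\<in>U. cis (of_int (u - w) * x) * (\<Sum>j<M. cis (of_int (w - u) * t j)))"
    by (subst sum.swap, rule sum.cong[OF refl], subst sum.swap) (simp add: sum_distrib_left)
  also have "\<dots> = (\<Sum>u\<in>U. \<Sum>w\<in>U. if u = w then of_nat M else 0)"
  proof (intro sum.cong refl)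
    fix u w assume "u \<in> U" "w \<in> U"
    then have "\<bar>w - u\<bar> < int M" using U by blast
    from sum_cis_grid[OF this]
    show "cis (of_int (u - w) * x) * (\<Sum>j<M. cis (of_int (w - u) * t j)) = (if u = w then of_nat M else 0)"
      unfolding t_def by auto
  qed
  also have "\<dots> = of_real (real M * real (card U))" using assms(1) by (simp add: mult.commute)
  finally show ?thesis unfolding t_def by (simp only: of_real_eq_iff)
qed

text \<open>A product of two Dirichlet blocks acts as a reproducing kernel on trigonometric polynomials of
  degree N; its discrete L1 norm is controlled by Cauchy-Schwarz and Parseval on the grid.\<close>

lemma trig_poly_grid_bound:
  fixes c :: "int \<Rightarrow> complex" and N :: nat
  defines "f \<equiv> \<lambda>x. (\<Sum>k\<in>{-int N..int N}. c k * cis (of_int k * x))"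
  assumes N: "N \<ge> 1" and B: "\<And>j. j < 4 * N \<Longrightarrow> cmod (f (2 * pi * real j / real (4 * N))) \<le> B"
  shows "cmod (f x) \<le> sqrt 2 * B"
proof -
  define M where "M = 4 * N"
  define t where "t j = 2 * pi * real j / real M" for j
  \<comment> \<open>For |k| <= N and v in V, the difference k - v always lies in U, so every
    coefficient of f is reproduced with the same multiplicity card V = 2 N. All k - u - v stay below
    M = 4 N in absolute value, so nothing is aliased. Cauchy-Schwarz then gives sqrt (4 N * 2 N) /
    (2 N) = sqrt 2.\<close>
  define U where "U = {- 3 * int N + 1..int N}"
  define V where "V = {0..2 * int N - 1}"
  define D where "D y = (\<Sum>u\<in>U. cis (of_int u * y))" for y
  define E where "E y = (\<Sum>v\<in>V. cis (of_int v * y))" for y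
  have B0: "B \<ge> 0" using order_trans[OF norm_ge_zero B[of 0]] N by simp
  have card: "card U = 4 * N" "card V = 2 * N" by (auto simp: U_def V_def)
  have DE: "D y * E y = (\<Sum>v\<in>V. \<Sum>u\<in>U. cis (of_int u * y) * cis (of_int v * y))" for y
    unfolding D_def E_def sum_product by (rule sum.swap)
  have "(\<Sum>j<M. f (t j) * (D (x - t j) * E (x - t j))) =
     (\<Sum>j<M. \<Sum>k\<in>{-int N..int N}. \<Sum>v\<in>V. \<Sum>u\<in>U. c k * cis (of_int (u + v) * x) * cis (of_int (k - u - v) * t j))"
  proof (rule sum.cong[OF refl])
    fix j
    have "f (t j) * (D (x - t j) * E (x - t j)) = (\<Sum>k\<in>{-int N..int N}. \<Sum>v\<in>V. \<Sum>u\<in>U.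
        (c k * cis (of_int k * t j)) * (cis (of_int u * (x - t j)) * cis (of_int v * (x - t j))))"
      unfolding DE f_def sum_distrib_right unfolding sum_distrib_left ..
    also have "\<dots> = (\<Sum>k\<in>{-int N..int N}. \<Sum>v\<in>V. \<Sum>u\<in>U. c k * cis (of_int (u + v) * x) * cis (of_int (k - u - v) * t j))"
      unfolding mult.assoc cis_mult
      by (intro sum.cong refl arg_cong2[of _ _ _ _ "(*)"] arg_cong[of _ _ cis]) (simp add: algebra_simps)
    finally show "f (t j) * (D (x - t j) * E (x - t j)) = \<dots>" .
  qed
  also have "\<dots> = (\<Sum>k\<in>{-int N..int N}. \<Sum>v\<in>V. \<Sum>u\<in>U. c k * cis (of_int (u + v) * x) * (\<Sum>j<M. cis (of_int (k - u - v) * t j)))"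
    by (subst sum.swap, rule sum.cong[OF refl], subst sum.swap, rule sum.cong[OF refl], subst sum.swap)
       (simp add: sum_distrib_left)
  also have "\<dots> = (\<Sum>k\<in>{-int N..int N}. \<Sum>v\<in>V. \<Sum>u\<in>U. if u = k - v then c k * cis (of_int k * x) * of_nat M else 0)"
  proof (intro sum.cong refl)
    fix k v u assume "k \<in> {-int N..int N}" "v \<in> V" "u \<in> U"
    then have "\<bar>k - u - v\<bar> < int M" by (auto simp: U_def V_def M_def)
    from sum_cis_grid[OF this]
    show "c k * cis (of_int (u + v) * x) * (\<Sum>j<M. cis (of_int (k - u - v) * t j)) =
      (if u = k - v then c k * cis (of_int k * x) * of_nat M else 0)"
      unfolding t_def by auto
  qed
  also have "\<dots> = (\<Sum>k\<in>{-int N..int N}. \<Sum>v\<in>V. c k * cis (of_int k * x) * of_nat M)"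
  proof (intro sum.cong refl)
    fix k v assume "k \<in> {-int N..int N}" "v \<in> V"
    then have "k - v \<in> U" by (auto simp: U_def V_def)
    then show "(\<Sum>u\<in>U. if u = k - v then c k * cis (of_int k * x) * of_nat M else 0) = c k * cis (of_int k * x) * of_nat M"
      by (simp add: U_def)
  qed
  also have "\<dots> = f x * of_nat (M * (2 * N))"
    by (simp add: f_def card sum_distrib_right sum_distrib_left mult_ac)
  finally have "cmod (f x) * real (M * (2 * N)) = cmod (\<Sum>j<M. f (t j) * (D (x - t j) * E (x - t j)))"
    by (simp add: norm_mult)
  also have "\<dots> \<le> (\<Sum>j<M. B * (cmod (D (x - t j)) * cmod (E (x - t j))))"
  proof (rule order_trans[OF norm_sum], rule sum_mono)
    fix j assume "j \<in> {..<M}"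
    then have "cmod (f (t j)) \<le> B" using B[of j] unfolding t_def M_def by simp
    then show "cmod (f (t j) * (D (x - t j) * E (x - t j))) \<le> B * (cmod (D (x - t j)) * cmod (E (x - t j)))"
      unfolding norm_mult by (intro mult_right_mono) auto
  qed
  also have "\<dots> = B * (\<Sum>j<M. \<bar>cmod (D (x - t j))\<bar> * \<bar>cmod (E (x - t j))\<bar>)"
    by (simp add: sum_distrib_left)
  also have "\<dots> \<le> B * (L2_set (\<lambda>j. cmod (D (x - t j))) {..<M} * L2_set (\<lambda>j. cmod (E (x - t j))) {..<M})"
    by (intro mult_left_mono L2_set_mult_ineq B0)
  also have "L2_set (\<lambda>j. cmod (D (x - t j))) {..<M} = sqrt (real M * real (4 * N))"
  proof -
    have "(\<Sum>j<M. (cmod (D (x - t j)))\<^sup>2) = real M * real (card U)"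
      unfolding D_def t_def by (rule parseval_grid) (auto simp: U_def M_def)
    then show ?thesis by (simp add: L2_set_def card)
  qed
  also have "L2_set (\<lambda>j. cmod (E (x - t j))) {..<M} = sqrt (real M * real (2 * N))"
  proof -
    have "(\<Sum>j<M. (cmod (E (x - t j)))\<^sup>2) = real M * real (card V)"
      unfolding E_def t_def by (rule parseval_grid) (auto simp: V_def M_def)
    then show ?thesis by (simp add: L2_set_def card)
  qed
  also have "B * (sqrt (real M * real (4 * N)) * sqrt (real M * real (2 * N))) = (sqrt 2 * B) * real (M * (2 * N))"
  proof -
    have "sqrt (real M * real (4 * N)) * sqrt (real M * real (2 * N)) = sqrt (2 * (real M * real (2 * N))\<^sup>2)"
      by (simp add: real_sqrt_mult[symmetric] power2_eq_square algebra_simps)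
    also have "\<dots> = sqrt 2 * (real M * real (2 * N))" by (simp add: real_sqrt_mult)
    finally show ?thesis by simp
  qed
  finally show ?thesis using N by (simp add: M_def mult_le_cancel_right)
qed

lemma sum_symmetric_int_interval:
  fixes f :: "int \<Rightarrow> 'a::comm_monoid_add"
  shows "(\<Sum>k\<in>{- int N..int N}. f k) = f 0 + (\<Sum>k\<in>{1..N}. f (int k) + f (- int k))"
proof (induction N)
  case (Suc N)
  have "{- int (Suc N)..int (Suc N)} = insert (int (Suc N)) (insert (- int (Suc N)) {- int N..int N})" by auto
  then show ?case using Suc by (simp add: add_ac)
qed simp

lemma sine_poly_grid_bound:
  fixes r :: "nat \<Rightarrow> real"
  assumes N: "N \<ge> 1" and X: "X \<subseteq> {1..N}"
    and B: "\<And>j. j < 4 * N \<Longrightarrow> \<bar>\<Sum>k\<in>X. r k * sin (real k * (2 * pi * real j / real (4 * N)))\<bar> \<le> B"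
  shows "\<bar>\<Sum>k\<in>X. r k * sin (real k * x)\<bar> \<le> sqrt 2 * B"
proof -
  define c where "c k = (if 0 < k \<and> nat k \<in> X then of_real (r (nat k)) / (2 * \<i>)
      else if k < 0 \<and> nat (- k) \<in> X then - of_real (r (nat (- k))) / (2 * \<i>) else 0)" for k :: int
  have e: "(\<Sum>k\<in>{- int N..int N}. c k * cis (of_int k * y)) = of_real (\<Sum>k\<in>X. r k * sin (real k * y))" for y
  proof -
    have t: "c (int k) * cis (of_int (int k) * y) + c (- int k) * cis (of_int (- int k) * y) =
        (if k \<in> X then of_real (r k * sin (real k * y)) else 0)" if "k \<in> {1..N}" for k
    proof (cases "k \<in> X")
      case True
      then have cc: "c (int k) = of_real (r k) / (2 * \<i>)" "c (- int k) = - of_real (r k) / (2 * \<i>)"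
        using that by (auto simp: c_def)
      show ?thesis unfolding cc using True by (simp add: complex_eq_iff Re_divide Im_divide)
    qed (use that in \<open>auto simp: c_def\<close>)
    have "(\<Sum>k\<in>{- int N..int N}. c k * cis (of_int k * y)) = 0 + (\<Sum>k\<in>{1..N}. if k \<in> X then of_real (r k * sin (real k * y)) else 0)"
      unfolding sum_symmetric_int_interval
      by (rule arg_cong2[of _ _ _ _ "(+)"], simp add: c_def, rule sum.cong[OF refl t])
    also have "\<dots> = (\<Sum>k\<in>{1..N} \<inter> X. of_real (r k * sin (real k * y)))"
      by (simp add: sum.inter_restrict cong: if_cong)
    also have "{1..N} \<inter> X = X" using X by auto
    finally show ?thesis by simp
  qed
  have "cmod (\<Sum>k\<in>{- int N..int N}. c k * cis (of_int k * x)) \<le> sqrt 2 * B"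
    by (rule trig_poly_grid_bound[OF N]) (use B in \<open>simp only: e norm_of_real\<close>)
  then show ?thesis by (simp only: e norm_of_real)
qed

section \<open>Behaviour near 0, symmetries and rounding\<close>

lemma rs_cosine_le:
  assumes g: "golay_pair T a b"
  shows "\<bar>rs_cosine T a b x\<bar> \<le> 4 * sqrt T"
proof -
  have "cmod (block_sum a T 128 0 x) \<le> 2 * sqrt T" "cmod (block_sum b T 256 0 x) \<le> 2 * sqrt T"
    unfolding norm_block_sum_0 using golay_pair_norm_le[OF g norm_cis] by blast+
  then show ?thesis unfolding rs_cosine_def
    using abs_Re_le_cmod[of "block_sum a T 128 0 x + block_sum b T 256 0 x"]
      norm_triangle_ineq[of "block_sum a T 128 0 x" "block_sum b T 256 0 x"] by linarith
qed

text \<open>By the last clause of \<open>golay_pair\<close> the value at 0 is y or 2 y, where y^2 is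
  2 T or T respectively. The derivative is bounded through 772 = 2 (129 + 257).\<close>

lemma rs_cosine_near_0:
  assumes g: "golay_pair T a b"
  shows "rs_cosine T a b x \<ge> sqrt T - 772 * T * sqrt T * \<bar>x\<bar>"
proof -
  obtain y where y: "y \<ge> 0" "moment_sum a T 0 1 = of_real y" "moment_sum b T 0 1 \<in> {0, of_real y}"
    using g unfolding golay_pair_def by blast
  have "(cmod (moment_sum a T 0 1))\<^sup>2 + (cmod (moment_sum b T 0 1))\<^sup>2 = 2 * real T"
    using g unfolding golay_pair_def by (metis norm_one)
  then have "y\<^sup>2 \<ge> T" using y by auto
  then have "sqrt T \<le> y" using y(1) by (simp add: real_le_lsqrt)
  moreover have "rs_cosine T a b 0 \<ge> y"
    using y by (auto simp: rs_cosine_def block_sum_moments)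
  ultimately have r0: "rs_cosine T a b 0 \<ge> sqrt T" by simp
  define f' where "f' z = - Im (block_sum a T 128 (Suc 0) z) - Im (block_sum b T 256 (Suc 0) z)" for z
  have d: "(rs_cosine T a b has_real_derivative f' z) (at z)" for z
    unfolding rs_cosine_def[abs_def] f'_def plus_complex.sel
    using DERIV_add[OF has_derivative_Re_block_sum[of a T 128 0 z] has_derivative_Re_block_sum[of b T 256 0 z]] by simp
  have f': "norm (f' z) \<le> 772 * T * sqrt T" for z
  proof -
    have "cmod (block_sum a T 128 (Suc 0) z) \<le> 258 * (sqrt T * T)" "cmod (block_sum b T 256 (Suc 0) z) \<le> 514 * (sqrt T * T)"
      using golay_block_sums(3)[OF g, of 128 "Suc 0" z] golay_block_sums(4)[OF g, of 256 "Suc 0" z] by simp_all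
    then show ?thesis unfolding f'_def
      using abs_Im_le_cmod[of "block_sum a T 128 (Suc 0) z"] abs_Im_le_cmod[of "block_sum b T 256 (Suc 0) z"]
      by (simp add: mult_ac)
  qed
  have "norm (rs_cosine T a b x - rs_cosine T a b 0) \<le> 772 * T * sqrt T * norm (x - 0)"
    by (rule field_differentiable_bound[of UNIV _ f']) (use d f' in \<open>auto intro: has_field_derivative_at_within\<close>)
  then show ?thesis using r0 by simp
qed

lemma rs_cosine_eq:
  "rs_cosine T a b x = (\<Sum>j<T. a j * cos (real (128 * T + j) * x)) + (\<Sum>j<T. b j * cos (real (256 * T + j) * x))"
  by (simp add: rs_cosine_def Re_block_sum)

lemma reduce_to_quarter_circle:
  fixes x :: real
  obtains y and m :: int where "0 \<le> y" "y \<le> pi / 2" "x = y + of_int m * pi \<or> x = - y + of_int m * pi"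
proof -
  define m where "m = round (x / pi)"
  define z where "z = x - of_int m * pi"
  have "\<bar>of_int m - x / pi\<bar> \<le> 1 / 2" unfolding m_def by (rule of_int_round_abs_le)
  then have "\<bar>of_int m - x / pi\<bar> * pi \<le> 1 / 2 * pi" by (intro mult_right_mono) auto
  moreover have "\<bar>of_int m - x / pi\<bar> * pi = \<bar>(of_int m - x / pi) * pi\<bar>" by (simp add: abs_mult)
  moreover have "(of_int m - x / pi) * pi = - z" by (simp add: z_def left_diff_distrib)
  ultimately have "\<bar>z\<bar> \<le> pi / 2" by simp
  moreover have "x = \<bar>z\<bar> + of_int m * pi \<or> x = - \<bar>z\<bar> + of_int m * pi" by (auto simp: z_def abs_if)
  ultimately show ?thesis using that[of "\<bar>z\<bar>" m] by simp
qed

lemma rs_cosine_reduce: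
  assumes "x = y + of_int m * pi \<or> x = - y + of_int m * pi"
  shows "rs_cosine T a b (2 * x) = rs_cosine T a b (2 * y)"
proof -
  have "cos (real k * (2 * x)) = cos (real k * (2 * y))" for k
  proof -
    define z where "z = 2 * pi * real_of_int (int k * m)"
    have z: "cos z = 1" "sin z = 0" unfolding z_def by (rule cos_int_2pin, rule sin_int_2pin)
    have "real k * (2 * x) = real k * (2 * y) + z \<or> real k * (2 * x) = z - real k * (2 * y)"
      using assms unfolding z_def by (elim disjE; hypsubst; simp add: algebra_simps)
    then show ?thesis using z by (auto simp: cos_add cos_diff)
  qed
  then show ?thesis by (simp only: rs_cosine_eq)
qed

lemma sine_target_reduce:
  assumes "x = y + of_int m * pi \<or> x = - y + of_int m * pi"
  shows "\<bar>sine_target n g x\<bar> = \<bar>sine_target n g y\<bar>"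
proof -
  define s where "s = (if even m then 1 else -1 :: real)"
  define s' where "s' = (if x = y + of_int m * pi then s else - s)"
  have "sin (real k * x) = s' * sin (real k * y)" if "k \<in> odd_below (2 * n)" for k
  proof -
    have odd: "odd k" using that by (simp add: odd_below_def)
    have sn: "sin (real k * (of_int m * pi)) = 0"
      using sin_npi_int[of "int k * m"] by (simp add: mult_ac)
    have cs: "cos (real k * (of_int m * pi)) = s"
      using cos_npi_int[of "int k * m"] odd by (simp add: mult_ac s_def)
    show ?thesis using assms sn cs
      by (cases "x = y + of_int m * pi") (auto simp: s'_def distrib_left sin_add right_diff_distrib sin_diff)
  qed
  then have "sine_target n g x = s' * sine_target n g y"
    unfolding sine_target_def sum_distrib_left by (intro sum.cong refl) simp
  moreover have "\<bar>s'\<bar> = 1" by (simp add: s'_def s_def)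
  ultimately show ?thesis by (simp add: abs_mult)
qed

text \<open>At most 2 n unknown signs are tested on 8 n sample points, four per degree, so the
  logarithm is ln 64. The total sqrt 2 * 8 * sqrt (2 n * 6 ln 2) is about 32.63 sqrt n and has to
  stay below the 33 sqrt n of \<open>sine_target_ge\<close>.\<close>

lemma sine_rounding:
  fixes x0 :: "nat \<Rightarrow> real"
  assumes n: "n \<ge> 1" and X: "X \<subseteq> {1..2 * n}" and x0: "\<And>k. k \<in> X \<Longrightarrow> \<bar>x0 k\<bar> \<le> 1"
  shows "\<exists>x. (\<forall>k\<in>X. x k \<in> {-1, 1}) \<and> (\<forall>y. \<bar>\<Sum>k\<in>X. (x k - x0 k) * sin (real k * y)\<bar> \<le> 327 / 10 * sqrt n)"
proof -
  define v where "v j k = sin (real k * (2 * pi * real j / real (4 * (2 * n))))" for j k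
  have finX: "finite X" using X by (rule finite_subset) simp
  have "card X \<le> card {1..2 * n}" using X by (intro card_mono) auto
  then have cX: "real (card X) \<le> 2 * real n" by simp
  obtain x where x: "\<forall>k\<in>X. x k \<in> {-1, 1}"
    and d: "\<forall>j\<in>{..<4 * (2 * n)}. \<bar>\<Sum>k\<in>X. v j k * (x k - x0 k)\<bar> \<le> 8 * sqrt (2 * real n * ln (16 * (8 * real n) / (2 * real n)))"
    using linear_discrepancy[of X "{..<4 * (2 * n)}" v x0 "2 * real n" "8 * real n"] finX cX n x0
    by (auto simp: v_def)
  define B where "B = 8 * sqrt (2 * real n * ln (16 * (8 * real n) / (2 * real n)))"
  have "\<bar>\<Sum>k\<in>X. (x k - x0 k) * sin (real k * y)\<bar> \<le> sqrt 2 * B" for y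
    using d n X by (intro sine_poly_grid_bound[of "2 * n"]) (auto simp: v_def B_def mult.commute)
  moreover have "sqrt 2 * B \<le> 327 / 10 * sqrt n"
  proof -
    have "ln (16 * (8 * real n) / (2 * real n)) = ln (2 ^ 6)" using n by simp
    also have "\<dots> = 6 * ln 2" by (subst ln_realpow) auto
    also have "\<dots> \<le> 25 / 6" using ln2_le_25_over_36 by simp
    finally have l: "ln (16 * (8 * real n) / (2 * real n)) \<le> 25 / 6" .
    have "sqrt 2 * B = 8 * sqrt (4 * real n * ln (16 * (8 * real n) / (2 * real n)))"
      unfolding B_def by (simp add: real_sqrt_mult[symmetric] mult_ac)
    also have "\<dots> \<le> 8 * sqrt ((327 / 80)\<^sup>2 * real n)"
    proof (intro mult_left_mono real_sqrt_le_mono)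
      have "4 * real n * ln (16 * (8 * real n) / (2 * real n)) \<le> 4 * real n * (25 / 6)"
        using l by (intro mult_left_mono) auto
      also have "\<dots> \<le> (327 / 80)\<^sup>2 * real n" by (simp add: power2_eq_square)
      finally show "4 * real n * ln (16 * (8 * real n) / (2 * real n)) \<le> (327 / 80)\<^sup>2 * real n" .
    qed simp
    also have "\<dots> = 327 / 10 * sqrt n" by (simp add: real_sqrt_mult)
    finally show ?thesis .
  qed
  ultimately show ?thesis using x by (meson order_trans)
qed

section \<open>Choice of scales and assembly of the polynomial\<close>

lemma littlewood_polynomial_parts:
  fixes val :: "nat \<Rightarrow> real" and eps :: "int \<Rightarrow> int"
  assumes C: "C \<subseteq> {1..N}" and e0: "eps 0 = 1"
    and pos: "\<And>k. k \<in> {1..N} \<Longrightarrow> of_int (eps (int k)) = val k"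
    and neg: "\<And>k. k \<in> {1..N} \<Longrightarrow> eps (- int k) = (if k \<in> C then eps (int k) else - eps (int k))"
  shows "(\<Sum>k\<in>{- int N..int N}. of_int (eps k) * cis x powi k) =
     Complex (1 + 2 * (\<Sum>k\<in>C. val k * cos (real k * x))) (2 * (\<Sum>k\<in>{1..N} - C. val k * sin (real k * x)))"
proof -
  have t: "of_int (eps (int k)) * cis x powi int k + of_int (eps (- int k)) * cis x powi (- int k) =
     (if k \<in> C then of_real (2 * (val k * cos (real k * x))) else \<i> * of_real (2 * (val k * sin (real k * x))))"
    if k: "k \<in> {1..N}" for k
  proof -
    have "(of_int (eps (int k)) :: complex) = of_real (val k)" using pos[OF k] by (metis of_real_of_int_eq)
    moreover have "cis x powi int k = cis (real k * x)" "cis x powi (- int k) = cis (- (real k * x))"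
      unfolding cis_power_int by simp_all
    ultimately show ?thesis using neg[OF k] by (auto simp: complex_eq_iff)
  qed
  have "(\<Sum>k\<in>{- int N..int N}. of_int (eps k) * cis x powi k) =
    1 + (\<Sum>k\<in>{1..N}. if k \<in> C then of_real (2 * (val k * cos (real k * x))) else \<i> * of_real (2 * (val k * sin (real k * x))))"
    unfolding sum_symmetric_int_interval
    by (rule arg_cong2[of _ _ _ _ "(+)"], simp add: e0, rule sum.cong[OF refl t])
  also have "\<dots> = 1 + ((\<Sum>k\<in>C. of_real (2 * (val k * cos (real k * x)))) + (\<Sum>k\<in>{1..N} - C. \<i> * of_real (2 * (val k * sin (real k * x)))))"
  proof -
    have "{1..N} \<inter> {k. k \<in> C} = C" "{1..N} \<inter> - {k. k \<in> C} = {1..N} - C" using C by auto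
    then show ?thesis by (subst sum.If_cases) simp_all
  qed
  also have "\<dots> = 1 + (of_real (2 * (\<Sum>k\<in>C. val k * cos (real k * x))) + \<i> * of_real (2 * (\<Sum>k\<in>{1..N} - C. val k * sin (real k * x))))"
    by (simp add: sum_distrib_left)
  finally show ?thesis by (simp add: complex_eq_iff)
qed

lemma power_of_2_scale:
  assumes "n \<ge> 2 ^ 51"
  obtains t where "2 ^ 50 * 2 ^ t \<le> n" "n < 2 ^ 51 * (2 ^ t :: nat)"
proof -
  have "n div 2 ^ 50 \<ge> 1" using assms div_le_mono[of "2 ^ 51" n "2 ^ 50"] by simp
  then obtain t where t: "2 ^ t \<le> n div 2 ^ 50" "n div 2 ^ 50 < 2 ^ (t + 1)"
    using ex_power_ivl1[of 2 "n div 2 ^ 50"] by auto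
  have "2 ^ 50 * 2 ^ t \<le> 2 ^ 50 * (n div 2 ^ 50)" using t(1) by (rule mult_le_mono2)
  also have "\<dots> \<le> n" by simp
  finally have 1: "2 ^ 50 * 2 ^ t \<le> n" .
  have "n < 2 ^ (t + 1) * 2 ^ 50" using t(2) by (subst (asm) div_less_iff_less_mult) auto
  then show ?thesis using that[of t] 1 by simp
qed

text \<open>This is what windows of length 2^37 are for: with q = n / 2^36 the logarithm is 40 ln 2
  <= 28, and 480 sqrt (28 / 2^36) < 1/100.\<close>

lemma sign_sum_numeric:
  assumes n: "n \<ge> 1"
  shows "480 * sqrt (real n / 2 ^ 36 * ln (16 * real n / (real n / 2 ^ 36))) \<le> sqrt n / 100"
proof -
  have "16 * real n / (real n / 2 ^ 36) = 2 ^ 40" using n by simp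
  then have "ln (16 * real n / (real n / 2 ^ 36)) = 40 * ln 2" using ln_realpow[of 2 40] by simp
  also have "\<dots> \<le> 28" using ln2_le_25_over_36 by simp
  finally have "real n / 2 ^ 36 * ln (16 * real n / (real n / 2 ^ 36)) \<le> real n / 2 ^ 36 * 28"
    by (intro mult_left_mono) auto
  also have "\<dots> \<le> (1 / 48000)\<^sup>2 * real n" by (simp add: power2_eq_square)
  finally have "sqrt (real n / 2 ^ 36 * ln (16 * real n / (real n / 2 ^ 36))) \<le> sqrt ((1 / 48000)\<^sup>2 * real n)"
    by (rule real_sqrt_le_mono)
  also have "\<dots> = sqrt n / 48000" by (simp add: real_sqrt_mult)
  finally show ?thesis by simp
qed

text \<open>T is a power of 2 between n / 2^51 and n / 2^50: the upper bound makes bad cells rare,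
  the lower bound keeps the threshold of smallness at sqrt n / 2^160.\<close>

lemma cosine_sine_pair:
  assumes n: "n \<ge> 2 ^ 60"
    and tail: "(1 - cos (pi / real (2 * n + 1))) / (1 - cos (5 * pi / (4 * real n))) \<le> 17 / 100"
  obtains T a b g where "golay_pair T a b" "2 ^ 50 * T \<le> n" "T \<ge> 1"
    "\<And>k. k \<in> odd_below (2 * n) \<Longrightarrow> \<bar>sine_coeff n g k\<bar> \<le> 1"
    "\<And>x. \<bar>sine_target n g x\<bar> \<le> 50 * sqrt n"
    "\<And>x. \<bar>rs_cosine T a b (2 * x)\<bar> \<le> sqrt n / 2 ^ 160 \<Longrightarrow> \<bar>sine_target n g x\<bar> \<ge> 33 * sqrt n"
proof -
  obtain t where t: "2 ^ 50 * 2 ^ t \<le> n" "n < 2 ^ 51 * (2 ^ t :: nat)"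
    by (rule power_of_2_scale[of n]) (use n in simp)
  define T :: nat where "T = 2 ^ t"
  have T1: "T \<ge> 1" by (simp add: T_def)
  have T: "2 ^ 50 * real T \<le> real n" "real n \<le> 2 ^ 51 * real T"
  proof -
    have "real (2 ^ 50 * T) \<le> real n" "real n \<le> real (2 ^ 51 * T)"
      using t by (simp_all only: of_nat_le_iff T_def less_imp_le)
    then show "2 ^ 50 * real T \<le> real n" "real n \<le> 2 ^ 51 * real T" by simp_all
  qed
  have n1: "n \<ge> 1" "n \<ge> 20" and nr: "real n \<ge> 2 ^ 60"
  proof -
    show "n \<ge> 1" "n \<ge> 20" using n by simp_all
    have "real (2 ^ 60) \<le> real n" using n by (simp only: of_nat_le_iff)
    then show "real n \<ge> 2 ^ 60" by simp
  qed
  obtain a b where g: "golay_pair T a b" using rudin_shapiro T_def by blast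
  define c where "c x = rs_cosine T a b (2 * x)" for x
  define e where "e = sqrt n / 2 ^ 160"
  define h where "h = pi / (2 * real n)"
  have h: "h > 0" "real n * h = pi / 2" using n1 by (auto simp: h_def)
  have sT: "sqrt T \<ge> sqrt n / 2 ^ 26"
  proof -
    have "sqrt n \<le> sqrt ((2 ^ 26)\<^sup>2 * real T)" using T by (intro real_sqrt_le_mono) simp
    also have "\<dots> = 2 ^ 26 * sqrt T" by (simp add: real_sqrt_mult)
    finally show ?thesis by simp
  qed
  \<comment> \<open>The exponent 160 is fixed here. The spacing contributes (3 / 2^43)^3 = 27 /
    2^129 and sqrt T contributes 2^-26, and 8 / 2^160 <= 27 / (100 * 2^155).\<close>
  have e8: "8 * e \<le> (256 * real T * (2 * h)) ^ 3 * sqrt T / 100"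
  proof -
    have "3 / 2 ^ 43 \<le> 256 * real T * (2 * h)"
    proof -
      have "256 * real T * (2 * h) = 256 * pi * (real T / real n)" by (simp add: h_def)
      moreover have "real T / real n \<ge> 1 / 2 ^ 51" using T n1 by (simp add: field_simps)
      then have "256 * pi * (real T / real n) \<ge> 256 * 3 * (1 / 2 ^ 51)" using pi_gt3 by (intro mult_mono) auto
      ultimately show ?thesis by simp
    qed
    then have "(3 / 2 ^ 43) ^ 3 \<le> (256 * real T * (2 * h)) ^ 3" by (rule power_mono) simp
    then have m: "(3 / 2 ^ 43) ^ 3 * (sqrt n / 2 ^ 26) \<le> (256 * real T * (2 * h)) ^ 3 * sqrt T"
      using sT h by (intro mult_mono) auto
    have "8 * e \<le> (3 / 2 ^ 43) ^ 3 * (sqrt n / 2 ^ 26) / 100" by (simp add: e_def power3_eq_cube)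
    also have "\<dots> \<le> (256 * real T * (2 * h)) ^ 3 * sqrt T / 100" by (rule divide_right_mono[OF m]) simp
    finally show ?thesis .
  qed
  define cell where "cell i x \<longleftrightarrow> real i * h \<le> x \<and> x \<le> (real i + 1) * h" for i :: nat and x
  define bad where "bad = {i. i < n \<and> (\<exists>x. cell i x \<and> \<bar>c x\<bar> \<le> e)}"
  \<comment> \<open>Indices differing by 2 leave a full cell in between, that is, 2 h after doubling
    the argument. Over 2^37 cells the doubled argument covers at most 2^38 h, and 2^38 h * 256 T =
    2^45 pi T / n <= 2^45 * 3.2 / 2^50 = 1/10, the width that \<open>rs_cosine_not_small\<close>
    admits.\<close>
  have sparse: False if ij: "i0 \<in> bad" "i1 \<in> bad" "i2 \<in> bad" "i3 \<in> bad"
      "i0 + 2 \<le> i1" "i1 + 2 \<le> i2" "i2 + 2 \<le> i3" "i3 < i0 + 2 ^ 37" for i0 i1 i2 i3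
  proof -
    obtain x0 x1 x2 x3 where x: "cell i0 x0" "\<bar>c x0\<bar> \<le> e" "cell i1 x1" "\<bar>c x1\<bar> \<le> e"
      "cell i2 x2" "\<bar>c x2\<bar> \<le> e" "cell i3 x3" "\<bar>c x3\<bar> \<le> e"
      using ij unfolding bad_def by blast
    have gap: "2 * x + 2 * h \<le> 2 * y" if "cell i x" "cell j y" "i + 2 \<le> j" for i j x y
    proof -
      have "real i + 2 \<le> real j" using that by linarith
      then have "(real i + 2) * h \<le> real j * h" using h by (intro mult_right_mono) auto
      then show ?thesis using that unfolding cell_def distrib_right by linarith
    qed
    have "real (i3 + 1) \<le> real (i0 + 2 ^ 37)"
      using ij(8) by (simp only: of_nat_le_iff Suc_eq_plus1[symmetric] Suc_le_eq)
    then have "real i3 + 1 \<le> real i0 + 2 ^ 37"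
      by (simp only: of_nat_add of_nat_1 of_nat_power of_nat_numeral)
    then have "(real i3 + 1) * h \<le> (real i0 + 2 ^ 37) * h" using h by (intro mult_right_mono) auto
    moreover have "2 ^ 38 * h = 2 * (2 ^ 37 * h)" by simp
    ultimately have "2 * x3 - 2 * x0 \<le> 2 ^ 38 * h" using x(1,7) unfolding cell_def distrib_right by linarith
    then have "(2 * x3 - 2 * x0) * (256 * T) \<le> 2 ^ 38 * h * (256 * T)" by (intro mult_right_mono) auto
    also have "\<dots> = 2 ^ 45 * pi * (real T / real n)" by (simp add: h_def)
    also have "\<dots> \<le> 2 ^ 45 * (32 / 10) * (1 / 2 ^ 50)"
      using T n1 pi_less_4 pi_approx by (intro mult_mono) (auto simp: field_simps)
    also have "\<dots> \<le> 1 / 10" by simp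
    finally have W: "(2 * x3 - 2 * x0) * (256 * T) \<le> 1 / 10" .
    show False
      by (rule rs_cosine_not_small[OF g T1 _ gap[OF x(1,3) ij(5)] gap[OF x(3,5) ij(6)] gap[OF x(5,7) ij(7)] W e8])
         (use x h in \<open>auto simp: c_def\<close>)
  qed
  \<comment> \<open>On cells 0 and 1, which \<open>sine_target_ge\<close> does not cover, c is at
    least sqrt T / 2.\<close>
  have bad2: "i \<ge> 2" if ib: "i \<in> bad" for i
  proof (rule ccontr)
    assume "\<not> ?thesis"
    then have i: "real i + 1 \<le> 2" by simp
    obtain x where x: "cell i x" "\<bar>c x\<bar> \<le> e" using ib unfolding bad_def by blast
    have "(real i + 1) * h \<le> 2 * h" using i h by (intro mult_right_mono) auto
    moreover have "0 \<le> real i * h" using h by simp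
    ultimately have x2: "0 \<le> x" "x \<le> 2 * h" using x(1) unfolding cell_def by linarith+
    have "772 * real T * \<bar>2 * x\<bar> \<le> 772 * real T * (4 * h)" using x2 by (intro mult_left_mono) auto
    also have "\<dots> = 1544 * pi * (real T / real n)" by (simp add: h_def)
    also have "\<dots> \<le> 1544 * 4 * (1 / 2 ^ 50)"
      using T n1 pi_less_4 by (intro mult_mono) (auto simp: field_simps)
    also have "\<dots> \<le> 1 / 2" by simp
    finally have "772 * real T * \<bar>2 * x\<bar> * sqrt T \<le> 1 / 2 * sqrt T" by (intro mult_right_mono) auto
    then have "c x \<ge> sqrt T / 2" using rs_cosine_near_0[OF g, of "2 * x"] by (simp add: c_def mult_ac)
    moreover have "e < sqrt n / 2 ^ 26 / 2" using n1 by (simp add: e_def)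
    moreover have "sqrt n / 2 ^ 26 / 2 \<le> sqrt T / 2" by (rule divide_right_mono[OF sT]) simp
    ultimately show False using x(2) by linarith
  qed
  have "\<exists>gg. (\<forall>j. \<bar>gg j\<bar> \<le> 1) \<and>
     (\<forall>i\<in>bad. \<exists>s. \<bar>s\<bar> = 1 \<and> (\<forall>j<n. i \<le> j + 2 \<longrightarrow> j \<le> i + 2 \<longrightarrow> gg j = s)) \<and>
     (\<forall>k\<in>odd_below (2 * n). \<bar>\<Sum>j<n. gg j * sin (real k * cell_mid n j)\<bar> \<le> 480 * sqrt (real n / 2 ^ 36 * ln (16 * real n / (real n / 2 ^ 36))))"
  proof (rule block_signs[of bad n "2 ^ 37" "odd_below (2 * n)"])
    show "bad \<subseteq> {..<n}" by (auto simp: bad_def)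
    show "False" if "i0 \<in> bad" "i1 \<in> bad" "i2 \<in> bad" "i3 \<in> bad"
      "i0 + 2 \<le> i1" "i1 + 2 \<le> i2" "i2 + 2 \<le> i3" "i3 < i0 + 2 ^ 37" for i0 i1 i2 i3
      using sparse that by blast
    have "odd_below (2 * n) \<subseteq> (\<lambda>i. 2 * i + 1) ` {..<n}"
    proof
      fix k assume "k \<in> odd_below (2 * n)"
      then obtain l where "k = 2 * l + 1" "l < n" by (auto simp: odd_below_def elim!: oddE)
      then show "k \<in> (\<lambda>i. 2 * i + 1) ` {..<n}" by auto
    qed
    then have "card (odd_below (2 * n)) \<le> card {..<n}" by (rule surj_card_le[rotated]) simp
    then show "real (card (odd_below (2 * n))) \<le> real n" by simp
    show "real n / real (2 ^ 37) + 2 \<le> real n / 2 ^ 36" using nr by simp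
  qed (auto simp: odd_below_def)
  then obtain gg where gg: "\<And>j. \<bar>gg j\<bar> \<le> 1"
    "\<And>i. i \<in> bad \<Longrightarrow> \<exists>s. \<bar>s\<bar> = 1 \<and> (\<forall>j<n. i \<le> j + 2 \<longrightarrow> j \<le> i + 2 \<longrightarrow> gg j = s)"
    "\<And>k. k \<in> odd_below (2 * n) \<Longrightarrow> \<bar>\<Sum>j<n. gg j * sin (real k * cell_mid n j)\<bar> \<le> 480 * sqrt (real n / 2 ^ 36 * ln (16 * real n / (real n / 2 ^ 36)))"
    by blast
  show ?thesis
  proof (rule that[of T a b gg])
    show "golay_pair T a b" by (rule g)
    show "2 ^ 50 * T \<le> n" using t by (simp add: T_def)
    show "T \<ge> 1" by (rule T1)
    show "\<bar>sine_target n gg x\<bar> \<le> 50 * sqrt n" for x by (rule sine_target_le[OF n1(1) gg(1)])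
    show "\<bar>sine_coeff n gg k\<bar> \<le> 1" if k: "k \<in> odd_below (2 * n)" for k
    proof -
      have "100 / sqrt n * \<bar>\<Sum>j<n. gg j * sin (real k * cell_mid n j)\<bar> \<le> 100 / sqrt n * (sqrt n / 100)"
        using order_trans[OF gg(3)[OF k] sign_sum_numeric[OF n1(1)]] by (intro mult_left_mono) auto
      also have "\<dots> = 1" using n1 by simp
      finally show ?thesis using sine_coeff_bound[OF n1(1), of gg k] by linarith
    qed
    show "\<bar>sine_target n gg x\<bar> \<ge> 33 * sqrt n" if small: "\<bar>rs_cosine T a b (2 * x)\<bar> \<le> sqrt n / 2 ^ 160" for x
    proof -
      obtain y m where y: "0 \<le> y" "y \<le> pi / 2" and xy: "x = y + of_int m * pi \<or> x = - y + of_int m * pi"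
        by (rule reduce_to_quarter_circle)
      have cy: "\<bar>c y\<bar> \<le> e" using small rs_cosine_reduce[OF xy] by (simp add: c_def e_def)
      obtain i where i: "i < n" "cell i y"
      \<comment> \<open>At y = pi / 2 the floor would yield the index n; this point is assigned to
        the last cell as its right end.\<close>
      proof (cases "y = pi / 2")
        case True
        then have "cell (n - 1) y" using h n1 by (simp add: cell_def of_nat_diff algebra_simps)
        then show ?thesis using that[of "n - 1"] n1 by simp
      next
        case False
        define i where "i = nat \<lfloor>y / h\<rfloor>"
        have "y / h \<ge> 0" using y h by simp
        then have i: "real i \<le> y / h" "y / h < real i + 1" by (simp_all add: i_def)
        then have "cell i y" using h by (simp add: cell_def field_simps)
        moreover have "real i * h < real n * h" using calculation h(2) y False unfolding cell_def by linarith
        then have "i < n" using h(1) by (simp only: mult_less_cancel_right_pos of_nat_less_iff)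
        ultimately show ?thesis using that by blast
      qed
      then have ib: "i \<in> bad" using cy unfolding bad_def by blast
      obtain s where s: "\<bar>s\<bar> = 1" "\<And>j. j < n \<Longrightarrow> i \<le> j + 2 \<Longrightarrow> j \<le> i + 2 \<Longrightarrow> gg j = s"
        using gg(2)[OF ib] by blast
      have "\<bar>sine_target n gg y\<bar> \<ge> 33 * sqrt n"
        by (rule sine_target_ge[OF n1(2) tail gg(1) bad2[OF ib] i(1) s(2,1)])
           (use i(2) in \<open>auto simp: cell_def h_def add.commute\<close>)
      then show ?thesis using sine_target_reduce[OF xy] by simp
    qed
  qed
qed

lemma rs_cosine_double_eq:
  fixes val :: "nat \<Rightarrow> real"
  assumes "\<And>j. j < T \<Longrightarrow> val (2 * (128 * T + j)) = a j" "\<And>j. j < T \<Longrightarrow> val (2 * (256 * T + j)) = b j"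
  shows "rs_cosine T a b (2 * x) =
    (\<Sum>k\<in>(\<lambda>j. 2 * (128 * T + j)) ` {..<T} \<union> (\<lambda>j. 2 * (256 * T + j)) ` {..<T}. val k * cos (real k * x))"
proof -
  have inj: "inj_on (\<lambda>j. 2 * (128 * T + j)) {..<T}" "inj_on (\<lambda>j. 2 * (256 * T + j)) {..<T}"
    by (auto simp: inj_on_def)
  have "(\<Sum>k\<in>(\<lambda>j. 2 * (128 * T + j)) ` {..<T} \<union> (\<lambda>j. 2 * (256 * T + j)) ` {..<T}. val k * cos (real k * x)) =
    (\<Sum>j<T. val (2 * (128 * T + j)) * cos (real (2 * (128 * T + j)) * x)) + (\<Sum>j<T. val (2 * (256 * T + j)) * cos (real (2 * (256 * T + j)) * x))"
    using inj by (subst sum.union_disjoint) (auto simp: sum.reindex)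
  also have "\<dots> = (\<Sum>j<T. a j * cos (real (128 * T + j) * (2 * x))) + (\<Sum>j<T. b j * cos (real (256 * T + j) * (2 * x)))"
    using assms by (intro arg_cong2[of _ _ _ _ "(+)"] sum.cong refl) (simp_all add: algebra_simps)
  finally show ?thesis by (simp add: rs_cosine_eq)
qed

lemma flat_littlewood_polynomial:
  assumes n: "n \<ge> 2 ^ 400"
    and tail: "(1 - cos (pi / real (2 * n + 1))) / (1 - cos (5 * pi / (4 * real n))) \<le> 17 / 100"
  shows "\<exists>eps :: int \<Rightarrow> int. (\<forall>k\<in>{- int (2 * n)..int (2 * n)}. eps k \<in> {-1, 1}) \<and>
    (\<forall>x. sqrt n / 2 ^ 160 \<le> cmod (\<Sum>k\<in>{- int (2 * n)..int (2 * n)}. of_int (eps k) * cis x powi k) \<and>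
         cmod (\<Sum>k\<in>{- int (2 * n)..int (2 * n)}. of_int (eps k) * cis x powi k) \<le> 4096 * sqrt n)"
proof -
  define N where "N = 2 * n"
  have n60: "n \<ge> 2 ^ 60" by (rule order_trans[OF _ n]) (rule power_increasing, auto)
  obtain T a b g where gp: "golay_pair T a b" and T: "2 ^ 50 * T \<le> n" "T \<ge> 1"
    and co: "\<And>k. k \<in> odd_below (2 * n) \<Longrightarrow> \<bar>sine_coeff n g k\<bar> \<le> 1"
    and up: "\<And>x. \<bar>sine_target n g x\<bar> \<le> 50 * sqrt n"
    and low: "\<And>x. \<bar>rs_cosine T a b (2 * x)\<bar> \<le> sqrt n / 2 ^ 160 \<Longrightarrow> \<bar>sine_target n g x\<bar> \<ge> 33 * sqrt n"
    by (rule cosine_sine_pair[OF n60 tail]) blast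
  have n1: "n \<ge> 1" using T by simp
  have sq: "sqrt n \<ge> 2 ^ 200"
  proof -
    have "real (2 ^ 400) \<le> real n" using n by (simp only: of_nat_le_iff)
    also have "real (2 ^ 400) = (2 ^ 200)\<^sup>2" by simp
    finally show ?thesis by (rule real_le_rsqrt)
  qed
  have Tn: "4 * sqrt T \<le> sqrt n"
  proof -
    have "4\<^sup>2 * T \<le> n" using T by simp
    then have "real (4\<^sup>2 * T) \<le> real n" by (simp only: of_nat_le_iff)
    then have "sqrt (4\<^sup>2 * real T) \<le> sqrt n" by simp
    then show ?thesis by (simp add: real_sqrt_mult)
  qed
  define A where "A = (\<lambda>j. 2 * (128 * T + j)) ` {..<T}"
  define B where "B = (\<lambda>j. 2 * (256 * T + j)) ` {..<T}"
  define C where "C = A \<union> B"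
  have CN: "C \<subseteq> {1..N}" using T by (auto simp: A_def B_def C_def N_def)
  have evenC: "even k" if "k \<in> C" for k using that by (auto simp: A_def B_def C_def)
  define X where "X = {1..N} - C"
  \<comment> \<open>The frequencies of X that are not in \<open>odd_below (2 * n)\<close> are even;
    their target coefficient is 0, and the rounding turns them into signs along with the
    rest.\<close>
  define x0 where "x0 k = (if k \<in> odd_below (2 * n) then sine_coeff n g k else 0)" for k
  have oddX: "odd_below (2 * n) \<subseteq> X"
    using evenC by (auto simp: odd_below_def X_def N_def Suc_le_eq intro: Nat.gr0I)
  obtain xs where xs: "\<forall>k\<in>X. xs k \<in> {-1, 1}"
    and err: "\<And>y. \<bar>\<Sum>k\<in>X. (xs k - x0 k) * sin (real k * y)\<bar> \<le> 327 / 10 * sqrt n"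
  proof -
    have "X \<subseteq> {1..2 * n}" by (auto simp: X_def N_def)
    moreover have "\<bar>x0 k\<bar> \<le> 1" for k using co[of k] by (simp add: x0_def)
    ultimately show ?thesis using sine_rounding[OF n1, of X x0] that by blast
  qed
  have sx: "(\<Sum>k\<in>X. xs k * sin (real k * y)) = sine_target n g y + (\<Sum>k\<in>X. (xs k - x0 k) * sin (real k * y))" for y
  proof -
    have "sine_target n g y = (\<Sum>k\<in>X. x0 k * sin (real k * y))"
      unfolding sine_target_def using oddX
      by (intro sum.mono_neutral_cong_left) (auto simp: X_def x0_def)
    then show ?thesis by (simp add: left_diff_distrib sum_subtractf)
  qed
  define val where "val k = (if k \<in> A then a (k div 2 - 128 * T) else if k \<in> B then b (k div 2 - 256 * T) else xs k)" for k
  have ab: "a j \<in> {-1, 1}" "b j \<in> {-1, 1}" for j using gp unfolding golay_pair_def by blast+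
  have valA: "val (2 * (128 * T + j)) = a j" if "j < T" for j using that by (simp add: val_def A_def)
  have valB: "val (2 * (256 * T + j)) = b j" if "j < T" for j
  proof -
    have "2 * (256 * T + j) \<notin> A" "2 * (256 * T + j) \<in> B" using that by (auto simp: A_def B_def)
    then show ?thesis by (simp add: val_def)
  qed
  have val1: "val k \<in> {-1, 1}" if "k \<in> {1..N}" for k
    using ab xs that by (auto simp: val_def X_def C_def)
  define sg where "sg k = (if val k = 1 then 1 else -1 :: int)" for k
  define eps where "eps k = (if k = 0 then 1 else if k > 0 then sg (nat k) else if nat (- k) \<in> C then sg (nat (- k)) else - sg (nat (- k)))" for k :: int
  have P: "(\<Sum>k\<in>{- int N..int N}. of_int (eps k) * cis x powi k) =
     Complex (1 + 2 * rs_cosine T a b (2 * x)) (2 * (\<Sum>k\<in>X. xs k * sin (real k * x)))" for x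
  proof -
    have "(\<Sum>k\<in>{- int N..int N}. of_int (eps k) * cis x powi k) =
       Complex (1 + 2 * (\<Sum>k\<in>C. val k * cos (real k * x))) (2 * (\<Sum>k\<in>{1..N} - C. val k * sin (real k * x)))"
    proof (rule littlewood_polynomial_parts[OF CN])
      show "eps 0 = 1" by (simp add: eps_def)
      show "of_int (eps (int k)) = val k" if "k \<in> {1..N}" for k
        using val1[OF that] that by (auto simp: eps_def sg_def)
      show "eps (- int k) = (if k \<in> C then eps (int k) else - eps (int k))" if "k \<in> {1..N}" for k
        using that by (auto simp: eps_def)
    qed
    also have "(\<Sum>k\<in>C. val k * cos (real k * x)) = rs_cosine T a b (2 * x)"
      unfolding C_def A_def B_def by (rule rs_cosine_double_eq[symmetric]) (use valA valB in auto)
    also have "(\<Sum>k\<in>{1..N} - C. val k * sin (real k * x)) = (\<Sum>k\<in>X. xs k * sin (real k * x))"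
      unfolding X_def by (intro sum.cong refl) (auto simp: val_def C_def)
    finally show ?thesis .
  qed
  have "cmod (\<Sum>k\<in>{- int N..int N}. of_int (eps k) * cis x powi k) \<le> 4096 * sqrt n" for x
  proof -
    have "cmod (\<Sum>k\<in>{- int N..int N}. of_int (eps k) * cis x powi k)
       \<le> \<bar>1 + 2 * rs_cosine T a b (2 * x)\<bar> + \<bar>2 * (\<Sum>k\<in>X. xs k * sin (real k * x))\<bar>"
      unfolding P using cmod_le[of "Complex (1 + 2 * rs_cosine T a b (2 * x)) (2 * (\<Sum>k\<in>X. xs k * sin (real k * x)))"] by simp
    also have "\<bar>1 + 2 * rs_cosine T a b (2 * x)\<bar> \<le> 1 + 2 * sqrt n"
      using rs_cosine_le[OF gp, of "2 * x"] Tn by linarith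
    also have "\<bar>2 * (\<Sum>k\<in>X. xs k * sin (real k * x))\<bar> \<le> 2 * (50 * sqrt n + 327 / 10 * sqrt n)"
    proof -
      have "\<bar>2 * (u + v)\<bar> \<le> 2 * (r + r')" if "\<bar>u\<bar> \<le> r" "\<bar>v\<bar> \<le> r'" for u v r r' :: real
        using order_trans[OF abs_triangle_ineq add_mono[OF that]] by (simp add: abs_mult)
      then show ?thesis unfolding sx using up[of x] err[of x] by blast
    qed
    also have "1 + 2 * sqrt n + 2 * (50 * sqrt n + 327 / 10 * sqrt n) \<le> 4096 * sqrt n"
      using sq by simp
    finally show ?thesis by simp
  qed
  moreover have "sqrt n / 2 ^ 160 \<le> cmod (\<Sum>k\<in>{- int N..int N}. of_int (eps k) * cis x powi k)" for x
  proof (rule ccontr)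
    assume "\<not> ?thesis"
    then have less: "cmod (Complex (1 + 2 * rs_cosine T a b (2 * x)) (2 * (\<Sum>k\<in>X. xs k * sin (real k * x)))) < sqrt n / 2 ^ 160"
      unfolding P by simp
    have re: "\<bar>1 + 2 * rs_cosine T a b (2 * x)\<bar> < sqrt n / 2 ^ 160"
      using le_less_trans[OF abs_Re_le_cmod less] by simp
    have im: "\<bar>2 * (\<Sum>k\<in>X. xs k * sin (real k * x))\<bar> < sqrt n / 2 ^ 160"
      using le_less_trans[OF abs_Im_le_cmod less] by simp
    \<comment> \<open>This absorbs the constant term: with r = sqrt n / 2^160 >= 1, |1 + 2 c| < r
      implies |c| < (1 + r) / 2 <= r. It is the reason for n >= 2^400.\<close>
    have "sqrt n / 2 ^ 160 \<ge> 1" using sq by simp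
    then have "\<bar>rs_cosine T a b (2 * x)\<bar> \<le> sqrt n / 2 ^ 160" using re by linarith
    from low[OF this] have "33 * sqrt n \<le> \<bar>sine_target n g x\<bar>" .
    then have "\<bar>\<Sum>k\<in>X. xs k * sin (real k * x)\<bar> \<ge> 3 / 10 * sqrt n"
    proof -
      have "\<bar>u + v\<bar> \<ge> 3 / 10 * r" if "33 * r \<le> \<bar>u\<bar>" "\<bar>v\<bar> \<le> 327 / 10 * r" for u v r :: real
        using that abs_triangle_ineq2[of u "- v"] by simp
      then show ?thesis unfolding sx using \<open>33 * sqrt n \<le> \<bar>sine_target n g x\<bar>\<close> err[of x] by blast
    qed
    then have "3 / 5 * sqrt n < sqrt n / 2 ^ 160" using im by linarith
    then show False using sq by simp
  qed
  moreover have "eps k \<in> {-1, 1}" for k by (auto simp: eps_def sg_def)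
  ultimately show ?thesis unfolding N_def by blast
qed

theorem theorem2p1:
  shows "\<exists>N::nat. \<forall>n\<ge>N. \<exists>\<epsilon>::int \<Rightarrow> int.
           (\<forall>k\<in>{-2 * int n..2 * int n}. \<epsilon> k \<in> {-1, 1}) \<and>
           (\<forall>z::complex. cmod z = 1 \<longrightarrow>
              (let P = (\<Sum>k\<in>{-2 * int n..2 * int n}. of_int (\<epsilon> k) * z powi k) in
                 2 powr (-160) * sqrt (real n) \<le> cmod P \<and>
                 cmod P \<le> 2 powr 12 * sqrt (real n)))"
proof -
  obtain N0 where N0: "\<And>n. n \<ge> N0 \<Longrightarrow> (1 - cos (pi / real (2 * n + 1))) / (1 - cos (5 * pi / (4 * real n))) \<le> 17 / 100"
    using fk_tail_eventually unfolding eventually_at_top_linorder by blast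
  show ?thesis
  proof (intro exI[of _ "max N0 (2 ^ 400)"] allI impI)
    fix n :: nat assume n: "max N0 (2 ^ 400) \<le> n"
    then have n1: "N0 \<le> n" and n2: "2 ^ 400 \<le> n" by (simp_all only: max.bounded_iff)
    obtain eps :: "int \<Rightarrow> int" where eps: "\<forall>k\<in>{- int (2 * n)..int (2 * n)}. eps k \<in> {-1, 1}"
      and b: "\<And>x. sqrt n / 2 ^ 160 \<le> cmod (\<Sum>k\<in>{- int (2 * n)..int (2 * n)}. of_int (eps k) * cis x powi k) \<and>
         cmod (\<Sum>k\<in>{- int (2 * n)..int (2 * n)}. of_int (eps k) * cis x powi k) \<le> 4096 * sqrt n"
      using flat_littlewood_polynomial[OF n2 N0[OF n1]] by blast
    have I: "{- int (2 * n)..int (2 * n)} = {-2 * int n..2 * int n}" by simp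
    have c1: "2 powr (-160) * sqrt (real n) = sqrt n / 2 ^ 160"
    proof -
      have "2 powr (-160 :: real) = inverse (2 powr (160 :: real))" by (rule powr_minus)
      also have "2 powr (160 :: real) = 2 ^ 160" by (rule powr_numeral) simp
      finally show ?thesis by (simp only: divide_inverse mult.commute)
    qed
    have c2: "2 powr 12 * sqrt (real n) = 4096 * sqrt n"
      by (simp add: powr_numeral)
    show "\<exists>\<epsilon>::int \<Rightarrow> int. (\<forall>k\<in>{-2 * int n..2 * int n}. \<epsilon> k \<in> {-1, 1}) \<and>
           (\<forall>z::complex. cmod z = 1 \<longrightarrow>
              (let P = (\<Sum>k\<in>{-2 * int n..2 * int n}. of_int (\<epsilon> k) * z powi k) in
                 2 powr (-160) * sqrt (real n) \<le> cmod P \<and>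
                 cmod P \<le> 2 powr 12 * sqrt (real n)))"
      unfolding c1 c2 Let_def
    proof (intro exI[of _ eps] conjI[OF eps[unfolded I]] allI impI)
      fix z :: complex assume z: "cmod z = 1"
      then have "z = cis (Arg z)" using rcis_cmod_Arg[of z] by (simp add: rcis_def)
      then show "sqrt n / 2 ^ 160 \<le> cmod (\<Sum>k\<in>{-2 * int n..2 * int n}. of_int (eps k) * z powi k) \<and>
         cmod (\<Sum>k\<in>{-2 * int n..2 * int n}. of_int (eps k) * z powi k) \<le> 4096 * sqrt n"
        using b[of "Arg z"] unfolding I by simp
    qed
  qed
qed

end
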